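(* There exists a real constant $C$ such that for all positive integers $N$ coprime to $48$, $$h(\Phi_{\mathfrak f,N})>\frac{\psi(N)}{12}\left(\ln N-2\lambda_N+C\right).$$
   Context: $\mathbb H$ is the upper half-plane. The logarithmic height of a nonzero complex polynomial $P$ (in any number of variables) is $h(P):=\ln\max|c|$, the maximum over all coefficients $c$ of $P$. $\psi(N)=N\prod_{p\mid N,\ p\text{ prime}}(1+1/p)$ is the Dedekind psi function. For a positive integer $N$, $\lambda_N:=\sum_{p^n\| N}\frac{p^n-1}{p^{n-1}(p^2-1)}\ln p$, where the sum is over the primes $p$ dividing $N$ and $p^n$ ($n\geq 1$) is the exact power of $p$ dividing $N$ (so $\lambda_1=0$). The Weber modular function is $\mathfrak f(\tau)=e^{-\pi i/24}\,\eta\left(\frac{\tau+1}{2}\right)/\eta(\tau)$ for $\tau\in\mathbb H$, where $\eta$ is the Dedekind eta function. For $N$ coprime to $48$, $\Phi_{\mathfrak f,N}(X,Y)\in\mathbb C[X,Y]$ is the polynomial such that $\Phi_{\mathfrak f,N}(X,\mathfrak f)$ is the (monic) minimal polynomial over the field $\mathbb C(\mathfrak f)$ of the function $\tau\mapsto\mathfrak f(N\tau)$. *)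

theory Defs
  imports "HOL-Complex_Analysis.Complex_Analysis" "HOL-Computational_Algebra.Computational_Algebra"
begin

definition upper_half_plane :: "complex set" where
  "upper_half_plane = {\<tau>. Im \<tau> > 0}"

definition dedekind_eta :: "complex \<Rightarrow> complex" where
  "dedekind_eta \<tau> =
     exp (of_real pi * \<i> * \<tau> / 12) *
     (\<Prod>n. 1 - exp (2 * of_real pi * \<i> * of_nat (Suc n) * \<tau>))"

definition weber_f :: "complex \<Rightarrow> complex" where
  "weber_f \<tau> = exp (- of_real pi * \<i> / 24) * dedekind_eta ((\<tau> + 1) / 2) / dedekind_eta \<tau>"

definition dedekind_psi :: "nat \<Rightarrow> real" where
  "dedekind_psi N = real N * (\<Prod>p\<in>prime_factors N. 1 + 1 / real p)"

definition lambda :: "nat \<Rightarrow> real" where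
  "lambda N = (\<Sum>p\<in>prime_factors N.
     (real p ^ multiplicity p N - 1) /
     (real p ^ (multiplicity p N - 1) * (real p ^ 2 - 1)) * ln (real p))"

text \<open>
  Meromorphic functions on the upper half-plane are represented by functions
  \<^typ>\<open>complex \<Rightarrow> complex\<close>. Two of them are the same meromorphic function iff they agree on the
  upper half-plane outside a set without accumulation points there; this makes the value
  \<open>x / 0 = 0\<close> at poles irrelevant.

  \<open>rational_functions_in g\<close> is the field \<open>\<complex>(g)\<close>, for \<open>g\<close> holomorphic on the upper half-plane:
  the denominator must not be the zero function.
\<close>

definition rational_functions_in :: "(complex \<Rightarrow> complex) \<Rightarrow> (complex \<Rightarrow> complex) set" where
  "rational_functions_in g =
     {\<lambda>\<tau>. poly p (g \<tau>) / poly q (g \<tau>) | p q. \<exists>\<tau>\<in>upper_half_plane. poly q (g \<tau>) \<noteq> 0}"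

text \<open>
  The monic polynomial \<open>X\<^sup>d + c (d - 1) X\<^sup>d\<^sup>-\<^sup>1 + \<dots> + c 0\<close> with coefficients in the field of
  functions \<open>K\<close> is given by \<open>d\<close> and by the values of \<open>c\<close> below \<open>d\<close>.
\<close>

definition monic_annihilator ::
  "(complex \<Rightarrow> complex) set \<Rightarrow> (complex \<Rightarrow> complex) \<Rightarrow> nat \<Rightarrow> (nat \<Rightarrow> complex \<Rightarrow> complex) \<Rightarrow> bool"
where
  "monic_annihilator K x d c \<longleftrightarrow>
     (\<forall>i<d. c i \<in> K) \<and>
     (\<forall>\<^sub>\<approx>\<tau>\<in>upper_half_plane. x \<tau> ^ d + (\<Sum>i<d. c i \<tau> * x \<tau> ^ i) = 0)"

definition minimal_polynomial ::
  "(complex \<Rightarrow> complex) set \<Rightarrow> (complex \<Rightarrow> complex) \<Rightarrow> nat \<Rightarrow> (nat \<Rightarrow> complex \<Rightarrow> complex) \<Rightarrow> bool"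
where
  "minimal_polynomial K x d c \<longleftrightarrow>
     monic_annihilator K x d c \<and> (\<forall>d' c'. monic_annihilator K x d' c' \<longrightarrow> d \<le> d')"

text \<open>
  A polynomial in \<open>\<complex>[X, Y]\<close> is a polynomial in \<open>X\<close> with coefficients in \<open>\<complex>[Y]\<close>.
\<close>

definition height :: "complex poly poly \<Rightarrow> real" where
  "height P = ln (Max (\<Union>a\<in>set (coeffs P). norm ` set (coeffs a)))"

definition is_weber_modular_polynomial :: "nat \<Rightarrow> complex poly poly \<Rightarrow> bool" where
  "is_weber_modular_polynomial N P \<longleftrightarrow>
     lead_coeff P = 1 \<and>
     minimal_polynomial (rational_functions_in weber_f) (\<lambda>\<tau>. weber_f (of_nat N * \<tau>))
       (degree P) (\<lambda>i \<tau>. poly (coeff P i) (weber_f \<tau>))"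

definition weber_modular_polynomial :: "nat \<Rightarrow> complex poly poly" where
  "weber_modular_polynomial N = (THE P. is_weber_modular_polynomial N P)"

end

theory Submission imports Defs "HOL-Number_Theory.Totient"
begin

text \<open>
  Write \<open>f\<close> for the Weber function and \<open>\<Phi>\<close> for the modular polynomial of odd level \<open>N\<close>.

  The function \<open>f\<close> has no zeros, satisfies \<open>f(-1/\<tau>) = f(\<tau>)\<close>, and is multiplied by a root of unity of
  order \<open>24\<close> under \<open>\<tau> \<mapsto> \<tau> + 2\<close>. The two transformations generate the theta group, which has two cusps:
  \<open>f\<close> grows exponentially at \<open>\<infinity>\<close> and decays exponentially at \<open>1\<close>. A holomorphic function that transforms
  like a power of \<open>f\<close>, grows at most exponentially at \<open>\<infinity>\<close> and is bounded at the cusp \<open>1\<close> is therefore a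
  polynomial in \<open>f\<close> (\<open>weber_f_invariant_imp_poly\<close>). This applies to the elementary symmetric functions
  of the conjugates \<open>f(N \<gamma> \<tau>)\<close>, where \<open>\<gamma>\<close> runs through the invariance group of \<open>f\<close>. Hence the roots of
  \<open>\<Phi>(X, f(\<tau>))\<close> are exactly the values of the conjugates at \<open>\<tau>\<close> (\<open>weber_modular_polynomial_conjugates\<close>).

  Fix a point \<open>\<tau> = 1 + \<i>/K\<close> so close to the cusp \<open>1\<close> that \<open>\<bar>f(\<tau>)\<bar> \<le> 1\<close>. Then the coefficients of the
  monic polynomial \<open>\<Phi>(X, f(\<tau>))\<close> are hardly larger than those of \<open>\<Phi>\<close>, and for a monic polynomial of degree
  \<open>n\<close> the sum of \<open>ln max(1, \<bar>x\<bar>)\<close> over the roots \<open>x\<close> exceeds the logarithm of the largest coefficient by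
  at most \<open>O(n)\<close>. As \<open>n = O(\<psi>(N))\<close>, the height is at least the sum of \<open>ln max(1, \<bar>g(\<tau>)\<bar>)\<close> over the conjugates
  \<open>g\<close>, up to \<open>O(\<psi>(N))\<close> (\<open>height_weber_modular_polynomial_ge\<close>).

  The main term is this sum (\<open>sum_conjugate_values_ge\<close>). Let \<open>g\<close> belong to the bottom row \<open>(c, d)\<close>. For each
  coprime pair \<open>(r, s)\<close> of odd sum, \<open>\<bar>g(\<tau>)\<bar> = \<bar>f(z)\<bar>\<close> for a point \<open>z\<close> of height
  \<open>(G\<^sup>2/N) Im \<tau> / \<bar>r \<tau> + s\<bar>\<^sup>2\<close>, where \<open>G = gcd(r d - s c, N)\<close> (\<open>conj_fun_height\<close>), and
  \<open>ln \<bar>f(z)\<bar> = (\<pi>/24) Im z + O(1)\<close> as soon as \<open>Im z \<ge> 1\<close>. Geometry of numbers shows that the height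
  exceeds \<open>1\<close> for at most one pair up to sign (\<open>short_vectors_le_2\<close>). So the sum over the conjugates is
  at least half a double sum over conjugates and pairs of bounded norm. Each conjugate, up to a
  constant factor, corresponds to \<open>\<phi>(N)\<close> rows modulo \<open>N\<close>. For a fixed pair a unimodular change of rows turns \<open>G\<close>
  into \<open>gcd(c, N)\<close>. The sum over the pairs is now a lattice sum,
  asymptotic to \<open>(4/(\<pi> K)) ln R\<close> for primitive vectors up to norm \<open>R\<close> (\<open>prim_sum_ge\<close>), which gives
  \<open>(1/12) (G\<^sup>2/N) (ln (G\<^sup>2/N) - O(1))\<close> for each row. Summing this over all rows is an exercise in
  multiplicative functions, with the result \<open>\<phi>(N) \<psi>(N) (ln N - 2 \<lambda>\<^sub>N - O(1)) / 12\<close>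
  (\<open>sum_prim_rows_log\<close>).
\<close>

section \<open>The Weber function as an infinite product\<close>

definition weber_prod :: "complex \<Rightarrow> complex" where
  "weber_prod x = (\<Prod>n. 1 + x ^ (2 * n + 1))"

lemma one_plus_power_nonzero:
  fixes x :: complex
  assumes "norm x < 1" "k > 0"
  shows "1 + x ^ k \<noteq> 0" "1 - x ^ k \<noteq> 0"
proof -
  have "norm (x ^ k) < 1"
    using assms by (simp add: norm_power power_less_one_iff)
  thus "1 + x ^ k \<noteq> 0" "1 - x ^ k \<noteq> 0"
    by (auto simp: add_eq_0_iff)
qed

lemma summable_odd_powers:
  fixes x :: real
  assumes "\<bar>x\<bar> < 1"
  shows "summable (\<lambda>n. x ^ (2 * n + 1))"
proof -
  have "summable (\<lambda>n. x * (x\<^sup>2) ^ n)"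
    using assms by (intro summable_mult summable_geometric) (simp add: abs_square_less_1)
  thus ?thesis by (simp add: power_mult)
qed

lemma has_prod_weber_prod:
  assumes "norm x < 1"
  shows "(\<lambda>n. 1 + x ^ (2 * n + 1)) has_prod weber_prod x"
proof -
  have "convergent_prod (\<lambda>n. 1 + x ^ (2 * n + 1))"
  proof (rule summable_imp_convergent_prod_complex)
    show "summable (\<lambda>n. norm (x ^ (2 * n + 1)))"
      using summable_odd_powers[of "norm x"] assms by (simp add: norm_power norm_mult)
    show "x ^ (2 * k + 1) \<noteq> -1" for k
      using one_plus_power_nonzero(1)[OF assms, of "2 * k + 1"] by (auto simp: add_eq_0_iff)
  qed
  thus ?thesis unfolding weber_prod_def by blast
qed

lemma weber_prod_LIMSEQ:
  assumes "norm x < 1"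
  shows "(\<lambda>n. \<Prod>k<n. 1 + x ^ (2 * k + 1)) \<longlonglongrightarrow> weber_prod x"
  using has_prod_imp_tendsto'[OF has_prod_weber_prod[OF assms]] .

lemma weber_prod_nonzero:
  assumes "norm x < 1"
  shows "weber_prod x \<noteq> 0"
proof -
  have "convergent_prod (\<lambda>n. 1 + x ^ (2 * n + 1))"
    using has_prod_weber_prod[OF assms] by (simp add: has_prod_iff)
  thus ?thesis unfolding weber_prod_def
    by (rule prodinf_nonzero) (use one_plus_power_nonzero(1)[OF assms, of "2 * _ + 1"] in simp)
qed

lemma uniform_limit_weber_prod:
  assumes "r < 1"
  shows "uniform_limit (cball 0 r) (\<lambda>n x. \<Prod>k<n. 1 + x ^ (2 * k + 1)) weber_prod sequentially"
proof (cases "r \<ge> 0")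
  case True
  have "uniformly_convergent_on (cball 0 r) (\<lambda>N x::complex. \<Prod>n<N. 1 + x ^ (2 * n + 1))"
  proof (rule uniformly_convergent_on_prod)
    show "uniformly_convergent_on (cball 0 r) (\<lambda>N x::complex. \<Sum>n<N. norm (x ^ (2 * n + 1)))"
    proof (rule Weierstrass_m_test'_ev)
      show "\<forall>\<^sub>F n in sequentially. \<forall>x::complex\<in>cball 0 r. norm (norm (x ^ (2 * n + 1))) \<le> r ^ (2 * n + 1)"
        by (intro always_eventually allI ballI) (simp del: power_Suc power_mult add: norm_power power_mono)
      show "summable (\<lambda>n. r ^ (2 * n + 1))"
        using True assms by (intro summable_odd_powers) auto
    qed
  qed (auto intro!: continuous_intros)
  then obtain P where P: "uniform_limit (cball 0 r) (\<lambda>N x::complex. \<Prod>n<N. 1 + x ^ (2 * n + 1)) P sequentially"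
    by (auto simp: uniformly_convergent_on_def)
  have "P x = weber_prod x" if "x \<in> cball 0 r" for x
    using tendsto_uniform_limitI[OF P that] weber_prod_LIMSEQ[of x] that assms
    by (intro LIMSEQ_unique) auto
  with P show ?thesis
    using uniform_limit_cong'[of "cball 0 r"] by (metis (no_types, lifting))
qed auto

lemma holomorphic_weber_prod: "weber_prod holomorphic_on ball 0 1"
proof (rule holomorphic_uniform_sequence[OF open_ball])
  show "(\<lambda>x. \<Prod>k<n. 1 + x ^ (2 * k + 1)) holomorphic_on ball 0 1" for n
    by (intro holomorphic_intros)
  fix x :: complex assume x: "x \<in> ball 0 1"
  define d where "d = (1 - norm x) / 2"
  have d: "d > 0" "norm x + d < 1"
    using x by (auto simp: d_def field_simps)
  have sub: "cball x d \<subseteq> cball 0 (norm x + d)"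
  proof
    fix y assume "y \<in> cball x d"
    thus "y \<in> cball 0 (norm x + d)"
      using norm_triangle_ineq4[of x "x - y"] by (simp add: dist_norm)
  qed
  show "\<exists>d>0. cball x d \<subseteq> ball 0 1 \<and>
      uniform_limit (cball x d) (\<lambda>n x. \<Prod>k<n. 1 + x ^ (2 * k + 1)) weber_prod sequentially"
  proof (intro exI conjI)
    show "cball x d \<subseteq> ball 0 1" using sub d by force
    show "uniform_limit (cball x d) (\<lambda>n x. \<Prod>k<n. 1 + x ^ (2 * k + 1)) weber_prod sequentially"
      by (rule uniform_limit_on_subset[OF uniform_limit_weber_prod[OF d(2)] sub])
  qed (use d in auto)
qed

lemma weber_prod_mult_minus:
  assumes "norm x < 1"
  shows "weber_prod x * weber_prod (- x) = weber_prod (- (x\<^sup>2))"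
proof -
  have "(\<lambda>n. (\<Prod>k<n. 1 + x ^ (2 * k + 1)) * (\<Prod>k<n. 1 + (- x) ^ (2 * k + 1)))
          \<longlonglongrightarrow> weber_prod x * weber_prod (- x)"
    by (intro tendsto_mult weber_prod_LIMSEQ) (use assms in auto)
  also have "(\<lambda>n. (\<Prod>k<n. 1 + x ^ (2 * k + 1)) * (\<Prod>k<n. 1 + (- x) ^ (2 * k + 1))) =
             (\<lambda>n. \<Prod>k<n. 1 + (- (x\<^sup>2)) ^ (2 * k + 1))"
    by (simp add: prod.distrib[symmetric] power_minus' algebra_simps power_add power_mult[symmetric]
             flip: power2_eq_square)
  finally show ?thesis
    using weber_prod_LIMSEQ[of "- (x\<^sup>2)"] assms
    by (intro LIMSEQ_unique[OF _ weber_prod_LIMSEQ]) (auto simp: norm_power power_less_one_iff)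
qed

text \<open>
  Splitting \<open>\<Prod>(1 - (-x)\<^sup>n)\<close> into even and odd exponents is what turns the quotient of eta functions
  into a single product.
\<close>

lemma weber_prod_quotient:
  assumes x: "norm x < 1"
  shows "(\<Prod>n. 1 - (- x) ^ Suc n) = weber_prod x * (\<Prod>n. 1 - (x\<^sup>2) ^ Suc n)"
    and "(\<Prod>n. 1 - (x\<^sup>2) ^ Suc n) \<noteq> 0"
proof -
  have conv: "convergent_prod (\<lambda>n. 1 - y ^ Suc n)" if y: "norm y < 1" for y :: complex
  proof -
    have "convergent_prod (\<lambda>n. 1 + (- (y ^ Suc n)))"
    proof (rule summable_imp_convergent_prod_complex)
      have "summable (\<lambda>n. norm y ^ Suc n)"
        using y by (subst summable_Suc_iff) (simp add: summable_geometric)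
      thus "summable (\<lambda>n. norm (- (y ^ Suc n)))" by (simp add: norm_power norm_mult)
      show "- (y ^ Suc k) \<noteq> -1" for k
        using one_plus_power_nonzero(2)[OF y, of "Suc k"] by auto
    qed
    thus ?thesis by simp
  qed
  have lim: "(\<lambda>n. \<Prod>k<n. 1 - y ^ Suc k) \<longlonglongrightarrow> (\<Prod>n. 1 - y ^ Suc n)" if "norm y < 1" for y :: complex
    by (rule has_prod_imp_tendsto') (use conv[OF that] in blast)
  have x2: "norm (x\<^sup>2) < 1" using x by (simp add: norm_power power_less_one_iff)
  have "(\<Prod>k<2*n. 1 - (- x) ^ Suc k) = (\<Prod>k<n. 1 + x ^ (2 * k + 1)) * (\<Prod>k<n. 1 - (x\<^sup>2) ^ Suc k)" for n
  proof (induction n)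
    case (Suc n)
    have "(\<Prod>k<2 * Suc n. 1 - (- x) ^ Suc k) =
          (\<Prod>k<2 * n. 1 - (- x) ^ Suc k) * ((1 - (- x) ^ Suc (2 * n)) * (1 - (- x) ^ Suc (Suc (2 * n))))"
      by simp
    also have "(1 - (- x) ^ Suc (2 * n)) = 1 + x ^ (2 * n + 1)"
      by simp
    also have "(1 - (- x) ^ Suc (Suc (2 * n))) = 1 - (x\<^sup>2) ^ Suc n"
      by (simp add: power_mult power2_eq_square)
    finally show ?case using Suc.IH by (simp add: algebra_simps)
  qed auto
  hence *: "(\<lambda>n. \<Prod>k<2*n. 1 - (- x) ^ Suc k) = (\<lambda>n. (\<Prod>k<n. 1 + x ^ (2 * k + 1)) * (\<Prod>k<n. 1 - (x\<^sup>2) ^ Suc k))"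
    by blast
  have "(\<lambda>n. \<Prod>k<2*n. 1 - (- x) ^ Suc k) \<longlonglongrightarrow> weber_prod x * (\<Prod>n. 1 - (x\<^sup>2) ^ Suc n)"
    unfolding * by (intro tendsto_mult weber_prod_LIMSEQ lim x x2)
  moreover have "(\<lambda>n. \<Prod>k<2*n. 1 - (- x) ^ Suc k) \<longlonglongrightarrow> (\<Prod>n. 1 - (- x) ^ Suc n)"
    using LIMSEQ_subseq_LIMSEQ[OF lim[of "-x"], of "\<lambda>n. 2 * n"] x
    by (simp add: strict_mono_def o_def)
  ultimately show "(\<Prod>n. 1 - (- x) ^ Suc n) = weber_prod x * (\<Prod>n. 1 - (x\<^sup>2) ^ Suc n)"
    using LIMSEQ_unique by blast
  show "(\<Prod>n. 1 - (x\<^sup>2) ^ Suc n) \<noteq> 0"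
    by (rule prodinf_nonzero[OF conv[OF x2]]) (use one_plus_power_nonzero(2)[OF x2, of "Suc _"] in simp)
qed

lemma norm_nome_less_1:
  assumes "Im \<tau> > 0" shows "norm (exp (of_real pi * \<i> * \<tau>)) < 1"
  using assms by simp

lemma weber_f_altdef:
  assumes "Im \<tau> > 0"
  shows "weber_f \<tau> = exp (- of_real pi * \<i> * \<tau> / 24) * weber_prod (exp (of_real pi * \<i> * \<tau>))"
proof -
  define x where "x = exp (of_real pi * \<i> * \<tau>)"
  have x: "norm x < 1" unfolding x_def by (rule norm_nome_less_1) fact
  have pow: "exp (2 * of_real pi * \<i> * of_nat (Suc n) * \<tau>) = (x\<^sup>2) ^ Suc n" for n
    unfolding x_def exp_of_nat_mult[symmetric] power_mult[symmetric] by (simp add: algebra_simps)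
  have pow': "exp (2 * of_real pi * \<i> * of_nat (Suc n) * ((\<tau> + 1) / 2)) = (- x) ^ Suc n" for n
  proof -
    have "- x = exp (of_real pi * \<i> * (\<tau> + 1))"
      by (simp add: x_def exp_add algebra_simps)
    thus ?thesis by (simp only: exp_of_nat_mult[symmetric]) (intro arg_cong[of _ _ exp], simp add: field_simps)
  qed
  have "weber_f \<tau> = exp (- of_real pi * \<i> / 24) * exp (of_real pi * \<i> * ((\<tau> + 1) / 2) / 12) /
          exp (of_real pi * \<i> * \<tau> / 12) *
          ((\<Prod>n. 1 - (- x) ^ Suc n) / (\<Prod>n. 1 - (x\<^sup>2) ^ Suc n))"
    unfolding weber_f_def dedekind_eta_def pow pow' by simp
  also have "(\<Prod>n. 1 - (- x) ^ Suc n) / (\<Prod>n. 1 - (x\<^sup>2) ^ Suc n) = weber_prod x"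
    using weber_prod_quotient[OF x] by simp
  also have "exp (- of_real pi * \<i> / 24) * exp (of_real pi * \<i> * ((\<tau> + 1) / 2) / 12) /
          exp (of_real pi * \<i> * \<tau> / 12) = exp (- of_real pi * \<i> * \<tau> / 24)"
    unfolding exp_add[symmetric] exp_diff[symmetric] by (simp add: field_simps)
  finally show ?thesis by (simp add: x_def)
qed

lemma weber_f_nonzero: "Im \<tau> > 0 \<Longrightarrow> weber_f \<tau> \<noteq> 0"
  by (simp add: weber_f_altdef weber_prod_nonzero norm_nome_less_1)

lemma open_upper_half_plane: "open upper_half_plane"
  by (simp add: upper_half_plane_def open_halfspace_Im_gt)

lemma connected_upper_half_plane: "connected upper_half_plane"
  unfolding upper_half_plane_def by (intro convex_connected convex_halfspace_Im_gt)

lemma holomorphic_weber_f: "weber_f holomorphic_on upper_half_plane"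
proof -
  have "(\<lambda>\<tau>. exp (- of_real pi * \<i> * \<tau> / 24) * (weber_prod \<circ> (\<lambda>\<tau>. exp (of_real pi * \<i> * \<tau>))) \<tau>)
          holomorphic_on upper_half_plane"
    by (intro holomorphic_intros holomorphic_on_compose_gen[OF _ holomorphic_weber_prod])
       (auto simp: upper_half_plane_def)
  thus ?thesis
    by (rule holomorphic_transform) (auto simp: upper_half_plane_def weber_f_altdef)
qed

lemma weber_f_plus_2:
  assumes "Im \<tau> > 0"
  shows "weber_f (\<tau> + 2) = exp (- of_real pi * \<i> / 12) * weber_f \<tau>"
proof -
  have "exp (of_real pi * \<i> * (\<tau> + 2)) = exp (of_real pi * \<i> * \<tau>)"
    by (simp add: exp_add algebra_simps)
  moreover have "exp (- of_real pi * \<i> * (\<tau> + 2) / 24) = exp (- of_real pi * \<i> / 12) * exp (- of_real pi * \<i> * \<tau> / 24)"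
    unfolding exp_add[symmetric] by (intro arg_cong[of _ _ exp]) (simp add: field_simps)
  ultimately show ?thesis using assms by (simp add: weber_f_altdef)
qed

lemma norm_weber_f:
  assumes "Im \<tau> > 0"
  shows "norm (weber_f \<tau>) = exp (pi * Im \<tau> / 24) * norm (weber_prod (exp (of_real pi * \<i> * \<tau>)))"
  using assms by (simp add: weber_f_altdef norm_mult)

lemma norm_weber_f_plus_2:
  assumes "Im \<tau> > 0"
  shows "norm (weber_f (\<tau> + 2)) = norm (weber_f \<tau>)"
  using assms by (simp add: weber_f_plus_2 norm_mult)

text \<open>
  In the classical notation this is \<open>f(\<tau>) f\<^sub>1(\<tau>) = f\<^sub>1(2\<tau>)\<close>: up to a constant of modulus \<open>1\<close>, the function
  \<open>f(\<tau> + 1)\<close> is \<open>f\<^sub>1(\<tau>)\<close>.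
\<close>

lemma norm_weber_f_duplication:
  assumes "Im \<tau> > 0"
  shows "norm (weber_f \<tau>) * norm (weber_f (\<tau> + 1)) = norm (weber_f (2 * \<tau> + 1))"
proof -
  define x where "x = exp (of_real pi * \<i> * \<tau>)"
  have x: "norm x < 1" unfolding x_def by (rule norm_nome_less_1) fact
  have 1: "exp (of_real pi * \<i> * (\<tau> + 1)) = - x"
    by (simp add: x_def exp_add algebra_simps)
  have 2: "exp (of_real pi * \<i> * (2 * \<tau> + 1)) = - (x\<^sup>2)"
    by (simp add: x_def exp_add algebra_simps exp_double flip: exp_double)
  have "norm (weber_prod (- (x\<^sup>2))) = norm (weber_prod x) * norm (weber_prod (- x))"
    using weber_prod_mult_minus[OF x] by (metis norm_mult)
  thus ?thesis
    using assms by (simp add: norm_weber_f 1 2 flip: x_def)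
      (simp add: exp_add[symmetric])
qed

lemma weber_prod_bounds:
  assumes "r < 1"
  obtains m M where "m > 0" "M > 0" "\<And>x. norm x \<le> r \<Longrightarrow> m \<le> norm (weber_prod x) \<and> norm (weber_prod x) \<le> M"
proof (cases "r \<ge> 0")
  case True
  have cont: "continuous_on (cball 0 r) (\<lambda>x. norm (weber_prod x))"
    using assms by (intro continuous_intros holomorphic_on_imp_continuous_on
                     holomorphic_on_subset[OF holomorphic_weber_prod]) auto
  have ne: "cball (0::complex) r \<noteq> {}" using True by auto
  obtain a where a: "a \<in> cball 0 r" "\<And>x. x \<in> cball 0 r \<Longrightarrow> norm (weber_prod a) \<le> norm (weber_prod x)"
    using continuous_attains_inf[OF compact_cball ne cont] by auto
  obtain b where b: "b \<in> cball 0 r" "\<And>x. x \<in> cball 0 r \<Longrightarrow> norm (weber_prod x) \<le> norm (weber_prod b)"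
    using continuous_attains_sup[OF compact_cball ne cont] by auto
  show ?thesis
    by (rule that[of "norm (weber_prod a)" "norm (weber_prod b)"])
       (use a b assms weber_prod_nonzero[of a] weber_prod_nonzero[of b] in auto)
next
  case False
  show ?thesis
    by (rule that[of 1 1]) (use False in \<open>auto dest: order_trans[OF norm_ge_zero]\<close>)
qed

lemma weber_f_growth:
  assumes "\<epsilon> > 0"
  obtains m M where "m > 0" "M > 0"
    "\<And>\<tau>. Im \<tau> \<ge> \<epsilon> \<Longrightarrow> m * exp (pi * Im \<tau> / 24) \<le> norm (weber_f \<tau>) \<and>
          norm (weber_f \<tau>) \<le> M * exp (pi * Im \<tau> / 24)"
proof -
  have "exp (- pi * \<epsilon>) < 1" using assms by simp
  from weber_prod_bounds[OF this] obtain m M where mM: "m > 0" "M > 0"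
    "\<And>x. norm x \<le> exp (- pi * \<epsilon>) \<Longrightarrow> m \<le> norm (weber_prod x) \<and> norm (weber_prod x) \<le> M"
    by metis
  show ?thesis
  proof (rule that[OF mM(1,2)])
    fix \<tau> :: complex assume "Im \<tau> \<ge> \<epsilon>"
    thus "m * exp (pi * Im \<tau> / 24) \<le> norm (weber_f \<tau>) \<and> norm (weber_f \<tau>) \<le> M * exp (pi * Im \<tau> / 24)"
      using mM(3)[of "exp (of_real pi * \<i> * \<tau>)"] assms
      by (simp add: norm_weber_f mult.commute)
  qed
qed

section \<open>The inversion formula\<close>

text \<open>
  The logarithmic derivative of the reflection formula for the Gamma function.
\<close>

lemma cot_partial_fractions:
  fixes z :: complex
  assumes z: "z \<notin> \<int>"
  shows "(\<lambda>k. 1 / (z + of_nat k) - 1 / (1 - z + of_nat k)) sums (pi * cot (of_real pi * z))"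
proof -
  have z': "1 - z \<notin> \<int>" using z by (metis Ints_1 Ints_diff diff_diff_eq2 add_diff_cancel_left')
  have nz: "rGamma z * rGamma (1 - z) \<noteq> 0"
    using z z' nonpos_Ints_subset_Ints by (auto simp: rGamma_eq_zero_iff)
  have nn: "z \<notin> \<int>\<^sub>\<le>\<^sub>0" "1 - z \<notin> \<int>\<^sub>\<le>\<^sub>0"
    using z z' nonpos_Ints_subset_Ints by auto
  have der: "((\<lambda>w. rGamma w * rGamma (1 - w)) has_field_derivative
          (rGamma z * rGamma (1 - z)) * (Digamma (1 - z) - Digamma z)) (at z)"
    using nn
    by (auto intro!: derivative_eq_intros DERIV_chain2[OF has_field_derivative_rGamma_no_nonpos_int, of "\<lambda>w. 1 - w"]
       has_field_derivative_rGamma_no_nonpos_int simp: algebra_simps)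
  have "((\<lambda>w. sin (of_real pi * w) / of_real pi) has_field_derivative cos (of_real pi * z)) (at z)"
    by (auto intro!: derivative_eq_intros)
  hence "rGamma z * rGamma (1 - z) * (Digamma (1 - z) - Digamma z) = cos (of_real pi * z)"
    using der by (simp add: rGamma_reflection_complex DERIV_unique)
  hence eq: "Digamma (1 - z) - Digamma z = pi * cot (of_real pi * z)"
    using nz unfolding rGamma_reflection_complex by (simp add: cot_def field_simps)
  have nz': "w \<noteq> 0" if "w \<notin> \<int>" for w :: complex using that by auto
  have "(\<lambda>k. (inverse (of_nat (Suc k)) - inverse (1 - z + of_nat k)) -
             (inverse (of_nat (Suc k)) - inverse (z + of_nat k))) sums
          ((Digamma (1 - z) + euler_mascheroni) - (Digamma z + euler_mascheroni))"
    using summable_Digamma[OF nz'[OF z]] summable_Digamma[OF nz'[OF z']]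
    by (intro sums_diff) (simp_all add: Digamma_def summable_sums)
  thus ?thesis using eq by (simp add: inverse_eq_divide algebra_simps)
qed

text \<open>
  The partial fractions of the cotangent at \<open>\<i> x\<close>, where a telescoping series is subtracted to pair the
  pole at \<open>k + 1\<close> with the pole at \<open>-(k + 1)\<close>.
\<close>

lemma coth_partial_fractions:
  fixes x :: real
  assumes x: "x > 0"
  shows "(\<lambda>m. x / (x\<^sup>2 + (real m + 1)\<^sup>2)) sums ((pi * cosh (pi * x) / sinh (pi * x) - 1 / x) / 2)"
proof -
  define z where "z = \<i> * complex_of_real x"
  have zI: "z + of_nat k \<noteq> 0" "of_nat k - z \<noteq> 0" for k
    using x by (auto simp: z_def complex_eq_iff)
  have z: "z \<notin> \<int>" using x by (auto simp: z_def complex_is_Int_iff)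
  have tele: "(\<lambda>k. 1 / (z + of_nat k) - 1 / (z + of_nat (Suc k))) sums (1 / (z + of_nat 0) - 0)"
  proof (rule telescope_sums')
    have "filterlim (\<lambda>k. z + of_nat k) at_infinity sequentially"
      by (rule tendsto_add_filterlim_at_infinity[OF tendsto_const tendsto_of_nat])
    thus "(\<lambda>k. 1 / (z + of_nat k)) \<longlonglongrightarrow> 0"
      by (rule tendsto_divide_0[OF tendsto_const])
  qed
  have "(\<lambda>k. (1 / (z + of_nat k) - 1 / (1 - z + of_nat k)) - (1 / (z + of_nat k) - 1 / (z + of_nat (Suc k))))
          sums (pi * cot (of_real pi * z) - 1 / z)"
    using sums_diff[OF cot_partial_fractions[OF z] tele] by simp
  hence "(\<lambda>k. \<i> / 2 * ((1 / (z + of_nat k) - 1 / (1 - z + of_nat k)) - (1 / (z + of_nat k) - 1 / (z + of_nat (Suc k)))))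
          sums (\<i> / 2 * (pi * cot (of_real pi * z) - 1 / z))"
    by (rule sums_mult)
  also have "(\<lambda>k. \<i> / 2 * ((1 / (z + of_nat k) - 1 / (1 - z + of_nat k)) - (1 / (z + of_nat k) - 1 / (z + of_nat (Suc k)))))
     = (\<lambda>m. complex_of_real (x / (x\<^sup>2 + (real m + 1)\<^sup>2)))"
  proof
    fix k
    have "1 / (z + of_nat (Suc k)) - 1 / (1 - z + of_nat k) = (- 2 * z) / ((of_nat (Suc k))\<^sup>2 - z\<^sup>2)"
    proof -
      have a: "1 - z + of_nat k = of_nat (Suc k) - z" by simp
      have "(of_nat (Suc k))\<^sup>2 - z\<^sup>2 = (z + of_nat (Suc k)) * (of_nat (Suc k) - z)"
        by (simp add: algebra_simps power2_eq_square)
      thus ?thesis unfolding a using zI[of "Suc k"] by (subst diff_frac_eq) (auto simp del: of_nat_Suc)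
    qed
    also have "((of_nat (Suc k))\<^sup>2 - z\<^sup>2) = complex_of_real (x\<^sup>2 + (real k + 1)\<^sup>2)"
      by (simp add: z_def power_mult_distrib algebra_simps)
    finally have *: "1 / (z + of_nat (Suc k)) - 1 / (1 - z + of_nat k) = - 2 * z / complex_of_real (x\<^sup>2 + (real k + 1)\<^sup>2)" .
    have "\<i> / 2 * ((1 / (z + of_nat k) - 1 / (1 - z + of_nat k)) - (1 / (z + of_nat k) - 1 / (z + of_nat (Suc k))))
      = \<i> / 2 * (1 / (z + of_nat (Suc k)) - 1 / (1 - z + of_nat k))" by simp
    also have "\<dots> = complex_of_real (x / (x\<^sup>2 + (real k + 1)\<^sup>2))"
      unfolding * by (simp add: z_def)
    finally show "\<i> / 2 * ((1 / (z + of_nat k) - 1 / (1 - z + of_nat k)) - (1 / (z + of_nat k) - 1 / (z + of_nat (Suc k))))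
      = complex_of_real (x / (x\<^sup>2 + (real k + 1)\<^sup>2))" .
  qed
  also have "\<i> / 2 * (pi * cot (of_real pi * z) - 1 / z) = complex_of_real ((pi * cosh (pi * x) / sinh (pi * x) - 1 / x) / 2)"
  proof -
    have "of_real pi * z = \<i> * of_real (pi * x)" by (simp add: z_def)
    hence "cot (of_real pi * z) = of_real (cosh (pi * x)) / (\<i> * of_real (sinh (pi * x)))"
    proof -
      have "cos (\<i> * of_real (pi * x)) = of_real (cosh (pi * x))"
        by (simp add: cos_exp_eq cosh_field_def exp_minus exp_of_real[symmetric] add.commute)
      moreover have "sin (\<i> * of_real (pi * x)) = \<i> * of_real (sinh (pi * x))"
        by (simp add: sin_exp_eq sinh_field_def exp_minus exp_of_real[symmetric] field_simps)
      ultimately show ?thesis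
        unfolding \<open>of_real pi * z = \<i> * of_real (pi * x)\<close> cot_def by simp
    qed
    moreover have "sinh (pi * x) \<noteq> 0" using x by simp
    ultimately show ?thesis using x by (simp only: z_def) (simp add: field_simps)
  qed
  finally show ?thesis by (simp only: sums_of_real_iff)
qed

text \<open>
  The alternating series is the full series minus twice the terms with odd \<open>m\<close>. The latter form the
  full series at \<open>x/2\<close> up to a factor, and \<open>coth y - coth (2y) = 1 / sinh (2y)\<close>.
\<close>

lemma cosech_partial_fractions:
  fixes x :: real
  assumes x: "x > 0"
  shows "(\<lambda>m. (-1) ^ m * (x / (x\<^sup>2 + (real m + 1)\<^sup>2))) sums ((1 / x - pi / sinh (pi * x)) / 2)"
proof -
  define a where "a = (\<lambda>m. x / (x\<^sup>2 + (real m + 1)\<^sup>2))"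
  have odd: "(\<lambda>m. if odd m then a m else 0) sums ((pi * cosh (pi * (x / 2)) / sinh (pi * (x / 2)) - 1 / (x / 2)) / 2 / 2)"
  proof -
    have "(\<lambda>m. (x / 2) / ((x / 2)\<^sup>2 + (real m + 1)\<^sup>2) / 2) sums
        ((pi * cosh (pi * (x / 2)) / sinh (pi * (x / 2)) - 1 / (x / 2)) / 2 / 2)"
      by (intro sums_divide coth_partial_fractions) (use x in auto)
    also have "(\<lambda>m. (x / 2) / ((x / 2)\<^sup>2 + (real m + 1)\<^sup>2) / 2) = (\<lambda>m. if odd (2 * m + 1) then a (2 * m + 1) else 0)"
    proof
      fix m
      have "(x / 2) / ((x / 2)\<^sup>2 + (real m + 1)\<^sup>2) / 2 = x / (4 * ((x / 2)\<^sup>2 + (real m + 1)\<^sup>2))"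
        by simp
      also have "4 * ((x / 2)\<^sup>2 + (real m + 1)\<^sup>2) = x\<^sup>2 + (real (2 * m + 1) + 1)\<^sup>2"
        by (simp add: power2_eq_square algebra_simps)
      finally show "(x / 2) / ((x / 2)\<^sup>2 + (real m + 1)\<^sup>2) / 2 = (if odd (2 * m + 1) then a (2 * m + 1) else 0)"
        by (simp add: a_def)
    qed
    finally show ?thesis
      by (subst (asm) sums_mono_reindex[where g = "\<lambda>m. 2 * m + 1" and f = "\<lambda>m. if odd m then a m else 0"])
         (auto simp: strict_mono_def elim!: oddE)
  qed
  have "(\<lambda>m. a m - 2 * (if odd m then a m else 0)) sums
     ((pi * cosh (pi * x) / sinh (pi * x) - 1 / x) / 2 - 2 * ((pi * cosh (pi * (x / 2)) / sinh (pi * (x / 2)) - 1 / (x / 2)) / 2 / 2))"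
    unfolding a_def[symmetric] using coth_partial_fractions[OF x]
    by (intro sums_diff sums_mult odd) (simp add: a_def)
  also have "(\<lambda>m. a m - 2 * (if odd m then a m else 0)) = (\<lambda>m. (-1) ^ m * a m)"
    by (auto simp: fun_eq_iff)
  also have "((pi * cosh (pi * x) / sinh (pi * x) - 1 / x) / 2 - 2 * ((pi * cosh (pi * (x / 2)) / sinh (pi * (x / 2)) - 1 / (x / 2)) / 2 / 2))
     = (1 / x - pi / sinh (pi * x)) / 2"
  proof -
    define y where "y = pi * (x / 2)"
    have y: "y > 0" "pi * x = 2 * y" using x by (auto simp: y_def)
    have "cosh y / sinh y - cosh (2 * y) / sinh (2 * y) = 1 / sinh (2 * y)"
    proof -
      have s: "sinh y > 0" "cosh y > 0" using y by auto
      have "cosh y ^ 2 - sinh y ^ 2 = 1" by (simp add: cosh_square_eq)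
      have "cosh y / sinh y - cosh (2 * y) / sinh (2 * y) = (2 * cosh y ^ 2 - cosh (2 * y)) / sinh (2 * y)"
        using s unfolding sinh_double by (simp add: field_simps power2_eq_square)
      also have "2 * cosh y ^ 2 - cosh (2 * y) = 1"
        unfolding cosh_double by (simp add: cosh_square_eq)
      finally show ?thesis .
    qed
    hence "pi * (cosh y / sinh y - cosh (2 * y) / sinh (2 * y)) = pi / sinh (2 * y)" by simp
    thus ?thesis using x unfolding y(2) y_def[symmetric] by (simp add: field_simps)
  qed
  finally show ?thesis by (simp add: a_def)
qed

lemma alternating_partial_sum_bounds:
  fixes a :: "nat \<Rightarrow> real"
  assumes "\<And>m. a m \<ge> 0" "\<And>m. a (Suc m) \<le> a m"
  shows "0 \<le> (\<Sum>m<M. (-1) ^ m * a m) \<and> (\<Sum>m<M. (-1) ^ m * a m) \<le> a 0"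
  using assms
proof (induction M arbitrary: a)
  case (Suc M)
  have "(\<Sum>m<Suc M. (-1) ^ m * a m) = a 0 - (\<Sum>m<M. (-1) ^ m * a (Suc m))"
    by (subst sum.lessThan_Suc_shift) (simp add: sum_negf)
  thus ?case using Suc.IH[of "\<lambda>m. a (Suc m)"] Suc.prems(1)[of 0] Suc.prems(2)[of 0] Suc.prems by fastforce
qed auto

text \<open>
  The double series converges only conditionally. Partial sums of an alternating series lie between
  \<open>0\<close> and its first term, so the first terms \<open>a k 0\<close> dominate and the interchange follows by dominated
  convergence.
\<close>

lemma alternating_double_series_swap:
  fixes a :: "nat \<Rightarrow> nat \<Rightarrow> real"
  assumes nonneg: "\<And>k m. a k m \<ge> 0" and dec: "\<And>k m. a k (Suc m) \<le> a k m"
    and lim: "\<And>k. a k \<longlonglongrightarrow> 0" and summ: "summable (\<lambda>k. a k 0)"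
  shows "(\<lambda>m. (-1) ^ m * (\<Sum>k. (-1) ^ k * a k m)) sums (\<Sum>k. (-1) ^ k * (\<Sum>m. (-1) ^ m * a k m))"
proof -
  have le0: "a k m \<le> a k 0" for k m
    by (induction m) (use dec order_trans in blast)+
  have summ_m: "summable (\<lambda>k. (-1) ^ k * a k m)" for m
    by (rule summable_comparison_test'[OF summ, of 0]) (use le0 nonneg in \<open>auto simp: abs_mult\<close>)
  have leib: "summable (\<lambda>m. (-1) ^ m * a k m)" for k
    by (rule summable_Leibniz(1)[OF lim]) (use dec nonneg in \<open>auto simp: monoseq_Suc\<close>)
  have "((\<lambda>M. \<Sum>k. (-1) ^ k * (\<Sum>m<M. (-1) ^ m * a k m)) \<longlonglongrightarrow> (\<Sum>k. (-1) ^ k * (\<Sum>m. (-1) ^ m * a k m)))"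
  proof (rule tannerys_theorem[THEN conjunct2, THEN conjunct2])
    show "(\<lambda>M. (-1) ^ k * (\<Sum>m<M. (-1) ^ m * a k m)) \<longlonglongrightarrow> (-1) ^ k * (\<Sum>m. (-1) ^ m * a k m)" for k
      by (intro tendsto_mult tendsto_const summable_LIMSEQ leib)
    have "norm ((-1) ^ k * (\<Sum>m<M. (-1) ^ m * a k m)) \<le> a k 0" for k M
      using alternating_partial_sum_bounds[of "a k" M] nonneg dec by (simp add: abs_mult)
    thus "\<forall>\<^sub>F (k, M) in sequentially \<times>\<^sub>F sequentially. norm ((-1) ^ k * (\<Sum>m<M. (-1) ^ m * a k m)) \<le> a k 0"
      by (intro always_eventually) auto
  qed (use summ in auto)
  also have "(\<lambda>M. \<Sum>k. (-1) ^ k * (\<Sum>m<M. (-1) ^ m * a k m)) = (\<lambda>M. \<Sum>m<M. (-1) ^ m * (\<Sum>k. (-1) ^ k * a k m))"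
  proof
    fix M
    have "(\<Sum>k. (-1) ^ k * (\<Sum>m<M. (-1) ^ m * a k m)) = (\<Sum>k. \<Sum>m<M. (-1) ^ m * ((-1) ^ k * a k m))"
      by (simp add: sum_distrib_left mult_ac)
    also have "\<dots> = (\<Sum>m<M. \<Sum>k. (-1) ^ m * ((-1) ^ k * a k m))"
      by (intro suminf_sum summable_mult summ_m)
    also have "\<dots> = (\<Sum>m<M. (-1) ^ m * (\<Sum>k. (-1) ^ k * a k m))"
      by (intro sum.cong refl suminf_mult summ_m)
    finally show "(\<Sum>k. (-1) ^ k * (\<Sum>m<M. (-1) ^ m * a k m)) = (\<Sum>m<M. (-1) ^ m * (\<Sum>k. (-1) ^ k * a k m))" .
  qed
  finally show ?thesis by (simp add: sums_def)
qed

lemma sums_alternating: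
  fixes a :: "nat \<Rightarrow> real"
  assumes "a sums A" "(\<lambda>m. a (2 * m + 1)) sums B"
  shows "(\<lambda>m. (-1) ^ m * a m) sums (A - 2 * B)" and "(\<lambda>m. a (2 * m)) sums (A - B)"
proof -
  have odd: "(\<lambda>m. if odd m then a m else 0) sums B"
  proof -
    have "(\<lambda>m. if odd (2 * m + 1) then a (2 * m + 1) else 0) sums B"
      using assms(2) by simp
    thus ?thesis
      by (subst (asm) sums_mono_reindex[where g = "\<lambda>m. 2 * m + 1" and f = "\<lambda>m. if odd m then a m else 0"])
         (auto simp: strict_mono_def elim!: oddE)
  qed
  have "(\<lambda>m. a m - 2 * (if odd m then a m else 0)) sums (A - 2 * B)"
    by (intro sums_diff sums_mult odd assms)
  also have "(\<lambda>m. a m - 2 * (if odd m then a m else 0)) = (\<lambda>m. (-1) ^ m * a m)"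
    by (auto simp: fun_eq_iff)
  finally show "(\<lambda>m. (-1) ^ m * a m) sums (A - 2 * B)" .
  have "(\<lambda>m. a m - (if odd m then a m else 0)) sums (A - B)"
    by (intro sums_diff odd assms)
  also have "(\<lambda>m. a m - (if odd m then a m else 0)) = (\<lambda>m. if even m then a m else 0)"
    by (auto simp: fun_eq_iff)
  finally have "(\<lambda>m. if even (2 * m) then a (2 * m) else 0) sums (A - B)"
    by (subst sums_mono_reindex[where g = "\<lambda>m. 2 * m" and f = "\<lambda>m. if even m then a m else 0"])
       (auto simp: strict_mono_def elim!: evenE)
  thus "(\<lambda>m. a (2 * m)) sums (A - B)" by simp
qed

lemma inverse_squares_parity_sums:
  shows "(\<lambda>k. (-1) ^ k / (real k + 1)\<^sup>2) sums (pi\<^sup>2 / 12)"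
    and "(\<lambda>k. 1 / (real (2 * k) + 1)\<^sup>2) sums (pi\<^sup>2 / 8)"
proof -
  define a where "a = (\<lambda>k. 1 / (real k + 1)\<^sup>2)"
  have 1: "a sums (pi\<^sup>2 / 6)" using inverse_squares_sums by (simp add: a_def add.commute)
  have "(\<lambda>m. a m / 4) sums (pi\<^sup>2 / 6 / 4)" by (intro sums_divide 1)
  also have "(\<lambda>m. a m / 4) = (\<lambda>m. a (2 * m + 1))"
    by (auto simp: a_def fun_eq_iff divide_simps) (simp_all add: power2_eq_square algebra_simps)
  finally have 2: "(\<lambda>m. a (2 * m + 1)) sums (pi\<^sup>2 / 6 / 4)" .
  show "(\<lambda>k. (-1) ^ k / (real k + 1)\<^sup>2) sums (pi\<^sup>2 / 12)"
    using sums_alternating(1)[OF 1 2] by (simp add: a_def)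
  show "(\<lambda>k. 1 / (real (2 * k) + 1)\<^sup>2) sums (pi\<^sup>2 / 8)"
    using sums_alternating(2)[OF 1 2] by (simp add: a_def)
qed

text \<open>The logarithm of the product, as a Lambert series in \<open>1 / sinh\<close>.\<close>

lemma weber_prod_exp:
  fixes t :: real
  assumes t: "t > 0"
  shows "weber_prod (of_real (exp (- (pi * t)))) =
           of_real (exp (\<Sum>k. (-1) ^ k / (real k + 1) * (1 / (2 * sinh (pi * (t * (real k + 1)))))))"
proof -
  define x where "x = exp (- (pi * t))"
  have x: "0 < x" "x < 1" using t by (auto simp: x_def)
  define b where "b = (\<lambda>k n. (-1) ^ k / (real k + 1) * x ^ ((2 * n + 1) * (k + 1)))"
  have geo: "(\<lambda>n. x ^ ((2 * n + 1) * (k + 1))) sums (1 / (2 * sinh (pi * (t * (real k + 1)))))" for k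
  proof -
    define u where "u = x ^ (k + 1)"
    have u: "0 < u" "u < 1" using x by (auto simp: u_def power_Suc_less_one simp del: power_Suc)
    have "(\<lambda>n. u * (u\<^sup>2) ^ n) sums (u * (1 / (1 - u\<^sup>2)))"
      by (intro sums_mult geometric_sums) (use u in \<open>simp add: power_less_one_iff\<close>)
    also have "(\<lambda>n. u * (u\<^sup>2) ^ n) = (\<lambda>n. x ^ ((2 * n + 1) * (k + 1)))"
      by (simp add: u_def fun_eq_iff power_mult[symmetric] power_add[symmetric] algebra_simps flip: power_Suc)
    also have "u * (1 / (1 - u\<^sup>2)) = 1 / (inverse u - u)"
      using u by (simp add: field_simps power2_eq_square)
    also have "u = exp (- (pi * (t * (real k + 1))))"
      unfolding u_def x_def exp_of_nat_mult[symmetric] by (simp add: algebra_simps)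
    also have "inverse \<dots> - \<dots> = 2 * sinh (pi * (t * (real k + 1)))"
      by (simp add: sinh_field_def exp_minus)
    finally show ?thesis .
  qed
  have u_bound: "1 / (2 * sinh (pi * (t * (real k + 1)))) \<le> x ^ (k + 1) / (1 - x\<^sup>2)" for k
  proof (rule sums_le[OF _ geo])
    have "(\<lambda>n. x ^ (k + 1) * (x\<^sup>2) ^ n) sums (x ^ (k + 1) * (1 / (1 - x\<^sup>2)))"
      by (intro sums_mult geometric_sums) (use x in \<open>simp add: power_less_one_iff\<close>)
    thus "(\<lambda>n. x ^ (k + 1) * (x\<^sup>2) ^ n) sums (x ^ (k + 1) / (1 - x\<^sup>2))" by simp
    show "x ^ ((2 * n + 1) * (k + 1)) \<le> x ^ (k + 1) * (x\<^sup>2) ^ n" for n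
      unfolding power_mult[symmetric] power_add[symmetric]
      by (rule power_decreasing) (use x in auto)
  qed
  have summ_bound: "summable (\<lambda>k. x ^ (k + 1) / (1 - x\<^sup>2))"
    using x by (intro summable_divide summable_ignore_initial_segment summable_geometric) auto
  have ln: "ln (1 + x ^ (2 * n + 1)) = (\<Sum>k. b k n)" "summable (\<lambda>k. b k n)" for n
  proof -
    have y: "0 < x ^ (2 * n + 1)" "x ^ (2 * n + 1) < 1"
      using x by (auto simp del: power_Suc intro: power_Suc_less_one simp: power_less_one_iff)
    show "ln (1 + x ^ (2 * n + 1)) = (\<Sum>k. b k n)"
    proof -
      have "(-1) ^ k * (1 / real (k + 1)) * ((1 + x ^ (2 * n + 1)) - 1) ^ Suc k = b k n" for k
        unfolding b_def power_mult by simp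
      thus ?thesis using ln_series[of "1 + x ^ (2 * n + 1)"] y by (simp only:)
    qed
    show "summable (\<lambda>k. b k n)"
    proof (rule summable_comparison_test')
      show "summable (\<lambda>k. x ^ (k + 1))"
        using x by (intro summable_ignore_initial_segment summable_geometric) auto
      show "norm (b k n) \<le> x ^ (k + 1)" if "k \<ge> 0" for k
      proof -
        have "norm (b k n) = x ^ ((2 * n + 1) * (k + 1)) / (real k + 1)"
          using x by (simp add: b_def abs_mult)
        also have "\<dots> \<le> x ^ ((2 * n + 1) * (k + 1)) / 1"
          by (intro divide_left_mono) (use x in auto)
        also have "\<dots> \<le> x ^ (k + 1)"
          unfolding div_by_1 by (rule power_decreasing) (use x in auto)
        finally show ?thesis .
      qed
    qed
  qed
  define L where "L = (\<Sum>k. (-1) ^ k / (real k + 1) * (1 / (2 * sinh (pi * (t * (real k + 1))))))"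
  have "(\<lambda>N. \<Sum>k. \<Sum>n<N. b k n) \<longlonglongrightarrow> L"
    unfolding L_def
  proof (rule tannerys_theorem[THEN conjunct2, THEN conjunct2])
    show "(\<lambda>N. \<Sum>n<N. b k n) \<longlonglongrightarrow> (-1) ^ k / (real k + 1) * (1 / (2 * sinh (pi * (t * (real k + 1)))))" for k
      using sums_mult[OF geo[of k], of "(-1) ^ k / (real k + 1)"] unfolding sums_def b_def .
    have "norm (\<Sum>n<N. b k n) \<le> x ^ (k + 1) / (1 - x\<^sup>2)" for k N
    proof -
      have "norm (\<Sum>n<N. b k n) = (\<Sum>n<N. x ^ ((2 * n + 1) * (k + 1))) / (real k + 1)"
      proof -
        have "(\<Sum>n<N. b k n) = (-1) ^ k / (real k + 1) * (\<Sum>n<N. x ^ ((2 * n + 1) * (k + 1)))"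
          by (simp only: b_def sum_distrib_left)
        moreover have "(\<Sum>n<N. x ^ ((2 * n + 1) * (k + 1))) \<ge> 0"
          using x by (intro sum_nonneg) simp
        ultimately show ?thesis by (simp only: norm_mult norm_divide norm_power) simp
      qed
      also have "\<dots> \<le> (\<Sum>n<N. x ^ ((2 * n + 1) * (k + 1))) / 1"
        by (intro divide_left_mono) (use x in \<open>auto intro!: sum_nonneg\<close>)
      also have "\<dots> \<le> 1 / (2 * sinh (pi * (t * (real k + 1))))"
        using sum_le_suminf[OF sums_summable[OF geo[of k]], of "{..<N}"] sums_unique[OF geo[of k]] x by simp
      also note u_bound[of k]
      finally show ?thesis .
    qed
    thus "\<forall>\<^sub>F (k, N) in sequentially \<times>\<^sub>F sequentially. norm (\<Sum>n<N. b k n) \<le> x ^ (k + 1) / (1 - x\<^sup>2)"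
      by (intro always_eventually) auto
  qed (use summ_bound in auto)
  also have "(\<lambda>N. \<Sum>k. \<Sum>n<N. b k n) = (\<lambda>N. \<Sum>n<N. ln (1 + x ^ (2 * n + 1)))"
    unfolding ln(1) using ln(2) by (intro ext suminf_sum)
  finally have "(\<lambda>N. exp (\<Sum>n<N. ln (1 + x ^ (2 * n + 1)))) \<longlonglongrightarrow> exp L"
    by (rule tendsto_exp)
  also have "(\<lambda>N. exp (\<Sum>n<N. ln (1 + x ^ (2 * n + 1)))) = (\<lambda>N. \<Prod>n<N. 1 + x ^ (2 * n + 1))"
    using x by (auto simp: exp_sum fun_eq_iff add_pos_pos intro!: prod.cong)
  finally have "(\<lambda>N. of_real (\<Prod>n<N. 1 + x ^ (2 * n + 1))) \<longlonglongrightarrow> complex_of_real (exp L)"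
    by (rule tendsto_of_real)
  moreover have "(\<lambda>N. of_real (\<Prod>n<N. 1 + x ^ (2 * n + 1))) \<longlonglongrightarrow> weber_prod (of_real x)"
    using weber_prod_LIMSEQ[of "of_real x"] x by simp
  ultimately show ?thesis
    using LIMSEQ_unique unfolding L_def x_def by blast
qed

text \<open>
  Partial fractions of \<open>1 / sinh\<close> turn \<open>ln f(\<i> t)\<close> into this double series. The substitution of \<open>1/t\<close> for
  \<open>t\<close> exchanges \<open>k\<close> and \<open>m\<close> in its terms, so that the inversion formula amounts to exchanging the order
  of summation.
\<close>

definition alternating_lattice_sum :: "real \<Rightarrow> real" where
  "alternating_lattice_sum t = (\<Sum>k. (-1) ^ k * (\<Sum>m. (-1) ^ m * (t / (t\<^sup>2 * (real k + 1)\<^sup>2 + (real m + 1)\<^sup>2))))"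

lemma alternating_lattice_sum_swap_hyps:
  fixes t :: real
  assumes t: "t > 0"
  defines "a \<equiv> (\<lambda>k m. t / (t\<^sup>2 * (real k + 1)\<^sup>2 + (real m + 1)\<^sup>2))"
  shows "\<And>k m. a k m \<ge> 0" "\<And>k m. a k (Suc m) \<le> a k m" "\<And>k. a k \<longlonglongrightarrow> 0" "summable (\<lambda>k. a k 0)"
proof -
  have pos: "t\<^sup>2 * (real k + 1)\<^sup>2 + (real m + 1)\<^sup>2 > 0" for k m
    using t by (intro add_pos_pos mult_pos_pos) auto
  show "a k m \<ge> 0" for k m using pos[of k m] t by (simp add: a_def)
  show "a k (Suc m) \<le> a k m" for k m
    unfolding a_def using pos[of k m] pos[of k "Suc m"] t
    by (intro divide_left_mono add_left_mono power_mono mult_pos_pos) auto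
  show "a k \<longlonglongrightarrow> 0" for k
  proof (rule tendsto_0_le[where K = 1])
    show "(\<lambda>m. t * inverse (real (Suc m))) \<longlonglongrightarrow> 0"
      using tendsto_mult[OF tendsto_const LIMSEQ_inverse_real_of_nat, of t] by simp
    have "norm (a k m) \<le> norm (t * inverse (real (Suc m))) * 1" for m
    proof -
      have "real m + 1 \<le> (real m + 1)\<^sup>2" by (simp add: power2_eq_square)
      also have "\<dots> \<le> t\<^sup>2 * (real k + 1)\<^sup>2 + (real m + 1)\<^sup>2" by simp
      finally have "a k m \<le> t / (real m + 1)"
        unfolding a_def using t pos[of k m] by (intro divide_left_mono mult_pos_pos) auto
      thus ?thesis using \<open>a k m \<ge> 0\<close> t by (simp add: divide_inverse add.commute)
    qed
    thus "\<forall>\<^sub>F m in sequentially. norm (a k m) \<le> norm (t * inverse (real (Suc m))) * 1"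
      by (intro always_eventually) auto
  qed
  show "summable (\<lambda>k. a k 0)"
  proof (rule summable_comparison_test')
    show "summable (\<lambda>k. (1 / t) * (1 / (real k + 1)\<^sup>2))"
      using sums_summable[OF inverse_squares_sums] by (intro summable_mult) (simp add: add.commute)
    show "norm (a k 0) \<le> (1 / t) * (1 / (real k + 1)\<^sup>2)" for k
    proof -
      have "a k 0 \<le> t / (t\<^sup>2 * (real k + 1)\<^sup>2)"
        unfolding a_def using t pos[of k 0] by (intro divide_left_mono mult_pos_pos) auto
      thus ?thesis using \<open>a k 0 \<ge> 0\<close> t by (simp add: power2_eq_square)
    qed
  qed
qed

lemma alternating_lattice_sum_inverse:
  assumes t: "t > 0"
  shows "alternating_lattice_sum (1 / t) = alternating_lattice_sum t"
proof -
  have eq: "1 / t / ((1 / t)\<^sup>2 * (real k + 1)\<^sup>2 + (real m + 1)\<^sup>2) =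
            t / (t\<^sup>2 * (real m + 1)\<^sup>2 + (real k + 1)\<^sup>2)" for k m
  proof -
    have "1 / t / ((1 / t)\<^sup>2 * (real k + 1)\<^sup>2 + (real m + 1)\<^sup>2) =
         t\<^sup>2 * (1 / t) / (t\<^sup>2 * ((1 / t)\<^sup>2 * (real k + 1)\<^sup>2 + (real m + 1)\<^sup>2))"
      using t by (subst mult_divide_mult_cancel_left) auto
    also have "t\<^sup>2 * (1 / t) = t" using t by (simp add: power2_eq_square)
    also have "(t\<^sup>2 * ((1 / t)\<^sup>2 * (real k + 1)\<^sup>2 + (real m + 1)\<^sup>2)) = t\<^sup>2 * (real m + 1)\<^sup>2 + (real k + 1)\<^sup>2"
      using t by (simp add: algebra_simps power_divide)
    finally show ?thesis .
  qed
  show ?thesis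
    unfolding alternating_lattice_sum_def eq
    using alternating_double_series_swap[OF alternating_lattice_sum_swap_hyps[OF t]] by (simp add: sums_iff)
qed

lemma weber_f_imaginary_axis:
  assumes t: "t > 0"
  shows "weber_f (\<i> * of_real t) = of_real (exp (pi / 24 * (t + 1 / t) - alternating_lattice_sum t / pi))"
proof -
  define a where "a = (\<lambda>k m. t / (t\<^sup>2 * (real k + 1)\<^sup>2 + (real m + 1)\<^sup>2))"
  have a: "\<And>k m. a k m \<ge> 0" "\<And>k m. a k (Suc m) \<le> a k m" "\<And>k. a k \<longlonglongrightarrow> 0" "summable (\<lambda>k. a k 0)"
    using alternating_lattice_sum_swap_hyps[OF t] unfolding a_def by blast+
  have leib: "summable (\<lambda>m. (-1) ^ m * a k m)" for k
    by (rule summable_Leibniz(1)[OF a(3)]) (use a(1,2) in \<open>auto simp: monoseq_Suc\<close>)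
  have inner: "norm ((-1) ^ k * (\<Sum>m. (-1) ^ m * a k m)) \<le> a k 0" for k
  proof -
    have "0 \<le> (\<Sum>m. (-1) ^ m * a k m)" "(\<Sum>m. (-1) ^ m * a k m) \<le> a k 0"
      using alternating_partial_sum_bounds[of "a k", OF a(1,2)]
      by (auto intro!: LIMSEQ_le_const[OF summable_LIMSEQ[OF leib]] LIMSEQ_le_const2[OF summable_LIMSEQ[OF leib]])
    thus ?thesis by (simp add: abs_mult)
  qed
  have S: "(\<lambda>k. (-1) ^ k * (\<Sum>m. (-1) ^ m * a k m)) sums alternating_lattice_sum t"
  proof -
    have "(\<lambda>k. (-1) ^ k * (\<Sum>m. (-1) ^ m * a k m)) sums (\<Sum>k. (-1) ^ k * (\<Sum>m. (-1) ^ m * a k m))"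
      by (rule summable_sums, rule summable_comparison_test'[OF a(4), of 0], rule inner)
    thus ?thesis by (simp add: alternating_lattice_sum_def a_def)
  qed
  have trm: "(-1) ^ k / (real k + 1) * (1 / (2 * sinh (pi * (t * (real k + 1)))))
      = (1 / (2 * pi * t)) * ((-1) ^ k / (real k + 1)\<^sup>2) - (1 / pi) * ((-1) ^ k * (\<Sum>m. (-1) ^ m * a k m))" for k
  proof -
    define x where "x = t * (real k + 1)"
    have x: "x > 0" using t by (simp add: x_def)
    have "(\<lambda>m. (-1) ^ m * (x / (x\<^sup>2 + (real m + 1)\<^sup>2)) / (real k + 1)) sums ((1 / x - pi / sinh (pi * x)) / 2 / (real k + 1))"
      by (intro sums_divide cosech_partial_fractions x)
    also have "(\<lambda>m. (-1) ^ m * (x / (x\<^sup>2 + (real m + 1)\<^sup>2)) / (real k + 1)) = (\<lambda>m. (-1) ^ m * a k m)"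
      by (simp add: a_def x_def fun_eq_iff power_mult_distrib)
    finally have *: "(\<Sum>m. (-1) ^ m * a k m) = (1 / x - pi / sinh (pi * x)) / 2 / (real k + 1)"
      by (simp add: sums_iff)
    have "sinh (pi * x) \<noteq> 0" using x by simp
    moreover have "q / r * (1 / (2 * s)) = 1 / (2 * pi * t) * (q / r\<^sup>2) - 1 / pi * (q * ((1 / (t * r) - pi / s) / 2 / r))"
      if "r > 0" "s \<noteq> 0" for q r s :: real
      using that t by (simp add: field_simps power2_eq_square)
    ultimately show ?thesis unfolding * x_def by simp
  qed
  have "(\<lambda>k. (-1) ^ k / (real k + 1) * (1 / (2 * sinh (pi * (t * (real k + 1)))))) sums
      (1 / (2 * pi * t) * (pi\<^sup>2 / 12) - 1 / pi * alternating_lattice_sum t)"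
    unfolding trm by (intro sums_diff sums_mult S inverse_squares_parity_sums)
  hence "(\<Sum>k. (-1) ^ k / (real k + 1) * (1 / (2 * sinh (pi * (t * (real k + 1)))))) =
      pi / 24 * (1 / t) - alternating_lattice_sum t / pi"
    using t by (simp only: sums_iff) (simp add: power2_eq_square)
  moreover have "exp (of_real pi * \<i> * (\<i> * of_real t)) = complex_of_real (exp (- (pi * t)))"
    unfolding exp_of_real[symmetric] by (rule arg_cong[of _ _ exp]) (simp add: complex_eq_iff)
  moreover have "exp (- of_real pi * \<i> * (\<i> * of_real t) / 24) = complex_of_real (exp (pi / 24 * t))"
    unfolding exp_of_real[symmetric] by (rule arg_cong[of _ _ exp]) (simp add: complex_eq_iff)
  ultimately have "weber_f (\<i> * of_real t) = complex_of_real (exp (pi / 24 * t) * exp (pi / 24 * (1 / t) - alternating_lattice_sum t / pi))"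
    using t weber_prod_exp[OF t] by (subst weber_f_altdef) simp_all
  thus ?thesis by (simp add: exp_add[symmetric] algebra_simps)
qed

lemma Im_neg_inverse:
  assumes "Im \<tau> > 0"
  shows "Im (-1 / \<tau>) = Im \<tau> / (norm \<tau>)\<^sup>2" "Im (-1 / \<tau>) > 0"
proof -
  have \<tau>: "\<tau> \<noteq> 0" using assms by auto
  show "Im (-1 / \<tau>) = Im \<tau> / (norm \<tau>)\<^sup>2"
    by (simp add: Im_divide cmod_power2)
  thus "Im (-1 / \<tau>) > 0" using assms \<tau> by simp
qed

text \<open>
  On the imaginary axis both parts of \<open>ln f(\<i> t)\<close>, the explicit one \<open>(t + 1/t) \<pi>/24\<close> and the lattice sum,
  are symmetric in \<open>t\<close> and \<open>1/t\<close>; the identity theorem does the rest.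
\<close>

theorem weber_f_neg_inverse:
  assumes "Im \<tau> > 0"
  shows "weber_f (-1 / \<tau>) = weber_f \<tau>"
proof -
  define U where "U = {\<i> * complex_of_real t | t. t > 0}"
  have "weber_f (-1 / \<tau>) - weber_f \<tau> = 0"
  proof (rule analytic_continuation[of "\<lambda>\<tau>. weber_f (-1 / \<tau>) - weber_f \<tau>" upper_half_plane U \<i> \<tau>])
    have "(weber_f \<circ> (\<lambda>\<tau>. -1 / \<tau>)) holomorphic_on upper_half_plane"
      by (intro holomorphic_on_compose_gen[OF _ holomorphic_weber_f] holomorphic_intros)
         (use Im_neg_inverse(2) in \<open>force simp: upper_half_plane_def\<close>)+
    thus "(\<lambda>\<tau>. weber_f (-1 / \<tau>) - weber_f \<tau>) holomorphic_on upper_half_plane"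
      by (intro holomorphic_intros holomorphic_weber_f) (simp add: o_def)
    show "U \<subseteq> upper_half_plane" by (auto simp: U_def upper_half_plane_def)
    show "\<i> islimpt U"
      unfolding islimpt_approachable
    proof safe
      fix e :: real assume "e > 0"
      have "dist (\<i> * complex_of_real (1 + e / 2)) \<i> = norm (\<i> * complex_of_real (e / 2))"
        by (simp add: dist_norm algebra_simps)
      also have "\<dots> < e" using \<open>e > 0\<close> by (simp add: norm_mult)
      finally show "\<exists>x'\<in>U. x' \<noteq> \<i> \<and> dist x' \<i> < e"
        using \<open>e > 0\<close> by (intro bexI[of _ "\<i> * complex_of_real (1 + e / 2)"])
           (auto simp: U_def complex_eq_iff intro!: exI[of _ "1 + e / 2"])
    qed
    show "weber_f (-1 / z) - weber_f z = 0" if "z \<in> U" for z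
    proof -
      from that obtain t where t: "z = \<i> * complex_of_real t" "t > 0" by (auto simp: U_def)
      have "-1 / z = \<i> * complex_of_real (1 / t)" using t by (simp add: divide_simps)
      thus ?thesis
        using weber_f_imaginary_axis[of "1 / t"] weber_f_imaginary_axis[of t] t
        by (simp add: alternating_lattice_sum_inverse add.commute)
    qed
  qed (use assms in \<open>auto simp: upper_half_plane_def open_halfspace_Im_gt convex_connected convex_halfspace_Im_gt\<close>)
  thus ?thesis by simp
qed

lemma norm_weber_f_neg_inverse:
  "Im \<tau> > 0 \<Longrightarrow> norm (weber_f (-1 / \<tau>)) = norm (weber_f \<tau>)"
  by (simp only: weber_f_neg_inverse)

section \<open>Decay at the second cusp\<close>

text \<open>
  The point \<open>1\<close> represents the second cusp of the theta group. To transfer the growth of \<open>f\<close> at \<open>\<infinity>\<close> into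
  decay at this cusp, it suffices to bound the product of \<open>\<bar>f(1 - 1/\<tau>)\<bar>\<close> and \<open>\<bar>f(2\<tau> + 1)\<bar>\<close> from both sides.
  It is invariant under \<open>\<tau> + 1\<close> and \<open>2\<tau>\<close>, and these maps move every point into a compact set.
\<close>

definition cusp_ratio :: "complex \<Rightarrow> real" where
  "cusp_ratio \<tau> = norm (weber_f (1 - 1 / \<tau>)) * norm (weber_f (2 * \<tau> + 1))"

lemma cusp_ratio_plus_1:
  assumes "Im \<tau> > 0"
  shows "cusp_ratio (\<tau> + 1) = cusp_ratio \<tau>"
proof -
  have \<tau>: "\<tau> \<noteq> 0" "\<tau> + 1 \<noteq> 0" using assms by (auto simp: complex_eq_iff)
  define w where "w = -1 - 1 / \<tau>"
  have Imw: "Im w > 0" using Im_neg_inverse(2)[OF assms] by (simp add: w_def)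
  have "w = - (\<tau> + 1) / \<tau>" using \<tau> by (simp add: w_def field_simps)
  hence "1 - 1 / (\<tau> + 1) = -1 / w" using \<tau>
  proof -
    have "w = - (\<tau> + 1) / \<tau>" by fact
    moreover have "w \<noteq> 0" using Imw by auto
    ultimately show ?thesis using \<tau> by (simp add: divide_simps mult.commute)
  qed
  hence "norm (weber_f (1 - 1 / (\<tau> + 1))) = norm (weber_f w)"
    using norm_weber_f_neg_inverse[OF Imw] by simp
  also have "\<dots> = norm (weber_f (w + 2))" using norm_weber_f_plus_2[OF Imw] by simp
  also have "w + 2 = 1 - 1 / \<tau>" by (simp add: w_def)
  finally have "norm (weber_f (1 - 1 / (\<tau> + 1))) = norm (weber_f (1 - 1 / \<tau>))" .
  moreover have "norm (weber_f (2 * (\<tau> + 1) + 1)) = norm (weber_f (2 * \<tau> + 1))"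
    using norm_weber_f_plus_2[of "2 * \<tau> + 1"] assms by (simp add: algebra_simps)
  ultimately show ?thesis by (simp add: cusp_ratio_def)
qed

text \<open>
  The duplication formula is used at \<open>2\<tau>\<close> and at \<open>-1/(2\<tau>)\<close>, where the inversion formula links the two.
\<close>

lemma cusp_ratio_double:
  assumes "Im \<tau> > 0"
  shows "cusp_ratio (2 * \<tau>) = cusp_ratio \<tau>"
proof -
  have \<tau>: "\<tau> \<noteq> 0" using assms by auto
  define w where "w = -1 / (2 * \<tau>)"
  have Imw: "Im w > 0" unfolding w_def by (rule Im_neg_inverse(2)) (use assms in simp)
  have "norm (weber_f w) = norm (weber_f (2 * \<tau>))"
    unfolding w_def by (rule norm_weber_f_neg_inverse) (use assms in simp)
  moreover have "norm (weber_f w) * norm (weber_f (w + 1)) = norm (weber_f (2 * w + 1))"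
    by (rule norm_weber_f_duplication[OF Imw])
  moreover have "2 * w + 1 = 1 - 1 / \<tau>" "w + 1 = 1 - 1 / (2 * \<tau>)"
    using \<tau> by (auto simp: w_def)
  ultimately have 1: "norm (weber_f (2 * \<tau>)) * norm (weber_f (1 - 1 / (2 * \<tau>))) = norm (weber_f (1 - 1 / \<tau>))"
    by simp
  have 2: "norm (weber_f (2 * \<tau>)) * norm (weber_f (2 * \<tau> + 1)) = norm (weber_f (2 * (2 * \<tau>) + 1))"
    by (rule norm_weber_f_duplication) (use assms in simp)
  show ?thesis
    unfolding cusp_ratio_def 1[symmetric] 2[symmetric] by (simp add: mult_ac)
qed

lemma cusp_ratio_plus_int:
  assumes "Im \<tau> > 0"
  shows "cusp_ratio (\<tau> + of_int n) = cusp_ratio \<tau>"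
proof -
  have nat: "cusp_ratio (\<tau> + of_nat k) = cusp_ratio \<tau>" if "Im \<tau> > 0" for k \<tau>
  proof (induction k)
    case (Suc k)
    have "cusp_ratio (\<tau> + of_nat (Suc k)) = cusp_ratio ((\<tau> + of_nat k) + 1)"
      by (simp add: add_ac)
    thus ?case using Suc that by (simp add: cusp_ratio_plus_1)
  qed auto
  show ?thesis
  proof (cases "n \<ge> 0")
    case True
    thus ?thesis using nat[OF assms, of "nat n"] by simp
  next
    case False
    thus ?thesis using nat[of "\<tau> + of_int n" "nat (-n)"] assms by simp
  qed
qed

lemma Im_power_2_mult: "Im (2 ^ k * \<tau>) = Im \<tau> * 2 ^ k"
  by (induction k) (simp_all add: mult.assoc)

lemma cusp_ratio_power_2:
  assumes "Im \<tau> > 0"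
  shows "cusp_ratio (2 ^ k * \<tau>) = cusp_ratio \<tau>"
  using assms
proof (induction k)
  case (Suc k)
  have "0 < Im (2 ^ k * \<tau>)" using assms by (simp add: Im_power_2_mult)
  hence "cusp_ratio (2 * (2 ^ k * \<tau>)) = cusp_ratio (2 ^ k * \<tau>)"
    by (rule cusp_ratio_double)
  with Suc show ?case unfolding power_Suc mult.assoc by metis
qed simp

lemma cusp_ratio_bounds:
  obtains m M where "m > 0" "M > 0" "\<And>\<tau>. Im \<tau> > 0 \<Longrightarrow> m \<le> cusp_ratio \<tau> \<and> cusp_ratio \<tau> \<le> M"
proof -
  define K where "K = cbox (Complex (-1) 1) (Complex 1 2)"
  have mem_K: "\<tau> \<in> K \<longleftrightarrow> -1 \<le> Re \<tau> \<and> Re \<tau> \<le> 1 \<and> 1 \<le> Im \<tau> \<and> Im \<tau> \<le> 2" for \<tau>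
    by (auto simp: K_def in_cbox_complex_iff)
  have reduce: "\<exists>\<tau>'\<in>K. cusp_ratio \<tau> = cusp_ratio \<tau>'" if \<tau>: "Im \<tau> > 0" for \<tau>
  proof -
    have "\<exists>w. 1 \<le> Im w \<and> Im w \<le> 2 \<and> cusp_ratio \<tau> = cusp_ratio w"
    proof -
      define j where "j = \<lfloor>log 2 (Im \<tau>)\<rfloor>"
      have j: "2 powr j \<le> Im \<tau>" "Im \<tau> \<le> 2 powr (j + 1)"
      proof -
        have "real_of_int j \<le> log 2 (Im \<tau>)" "log 2 (Im \<tau>) \<le> real_of_int j + 1"
          unfolding j_def by linarith+
        thus "2 powr j \<le> Im \<tau>" "Im \<tau> \<le> 2 powr (j + 1)"
          using \<tau> by (simp_all add: le_log_iff log_le_iff)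
      qed
      show ?thesis
      proof (cases "j \<ge> 0")
        case True
        define k where "k = nat j"
        have kj: "real_of_int j = real k" using True by (simp add: k_def)
        have k: "2 ^ k \<le> Im \<tau>" "Im \<tau> \<le> 2 * 2 ^ k"
          using j kj by (auto simp: powr_add powr_realpow)
        define w where "w = \<tau> / of_real (2 ^ k)"
        have w: "2 ^ k * w = \<tau>" by (simp add: w_def)
        have Imw: "Im w = Im \<tau> / 2 ^ k" using Im_power_2_mult[of k w] w by simp
        have "1 \<le> Im w" "Im w \<le> 2" unfolding Imw using k by (simp_all add: divide_simps)
        thus ?thesis
          using cusp_ratio_power_2[of w k] unfolding w by (intro exI[of _ w]) simp
      next
        case False
        define k where "k = nat (-j)"
        have kj: "real_of_int j = - real k" using False by (simp add: k_def)
        have k: "1 \<le> Im \<tau> * 2 ^ k" "Im \<tau> * 2 ^ k \<le> 2"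
        proof -
          have "2 powr (- real k) \<le> Im \<tau>" "Im \<tau> \<le> 2 powr (- real k) * 2"
            using j by (simp_all add: kj powr_add powr_diff powr_minus divide_inverse mult.commute)
          thus "1 \<le> Im \<tau> * 2 ^ k" "Im \<tau> * 2 ^ k \<le> 2"
            by (simp_all add: powr_minus powr_realpow field_simps)
        qed
        have "Im (2 ^ k * \<tau>) = Im \<tau> * 2 ^ k"
          by (rule Im_power_2_mult)
        thus ?thesis
          using k cusp_ratio_power_2[OF \<tau>, of k] by (intro exI[of _ "2 ^ k * \<tau>"]) (simp only: simp_thms)
      qed
    qed
    then obtain w where w: "1 \<le> Im w" "Im w \<le> 2" "cusp_ratio \<tau> = cusp_ratio w" by blast
    define w' where "w' = w + of_int (- \<lfloor>Re w\<rfloor>)"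
    have "w' \<in> K" using w unfolding mem_K w'_def by (simp add: of_int_floor_le, linarith)
    moreover have "cusp_ratio w' = cusp_ratio w"
      unfolding w'_def by (rule cusp_ratio_plus_int) (use w in auto)
    ultimately show ?thesis using w by metis
  qed
  have Im_pos: "Im (1 - 1 / \<tau>) > 0" if "Im \<tau> > 0" for \<tau>
    using Im_neg_inverse(2)[OF that] by simp
  have cont: "continuous_on K cusp_ratio"
  proof -
    have "(weber_f \<circ> (\<lambda>\<tau>. 1 - 1 / \<tau>)) holomorphic_on K" "(weber_f \<circ> (\<lambda>\<tau>. 2 * \<tau> + 1)) holomorphic_on K"
    proof -
      show "(weber_f \<circ> (\<lambda>\<tau>. 1 - 1 / \<tau>)) holomorphic_on K"
      proof (rule holomorphic_on_compose_gen[OF _ holomorphic_weber_f])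
        show "(\<lambda>\<tau>. 1 - 1 / \<tau>) holomorphic_on K"
          by (intro holomorphic_intros) (auto simp: mem_K)
        show "(\<lambda>\<tau>. 1 - 1 / \<tau>) ` K \<subseteq> upper_half_plane"
          unfolding upper_half_plane_def using Im_pos mem_K by force
      qed
      show "(weber_f \<circ> (\<lambda>\<tau>. 2 * \<tau> + 1)) holomorphic_on K"
        by (intro holomorphic_on_compose_gen[OF _ holomorphic_weber_f] holomorphic_intros)
           (auto simp: mem_K upper_half_plane_def)
    qed
    thus ?thesis unfolding cusp_ratio_def
      by (intro continuous_intros holomorphic_on_imp_continuous_on) (auto simp: o_def)
  qed
  have pos: "cusp_ratio \<tau> > 0" if "Im \<tau> > 0" for \<tau>
    using weber_f_nonzero[OF Im_pos[OF that]] weber_f_nonzero[of "2 * \<tau> + 1"] that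
    by (simp add: cusp_ratio_def)
  have "Complex 0 1 \<in> K" by (simp add: mem_K)
  hence K: "compact K" "K \<noteq> {}" by (auto simp: K_def)
  obtain a where a: "a \<in> K" "\<And>x. x \<in> K \<Longrightarrow> cusp_ratio a \<le> cusp_ratio x"
    using continuous_attains_inf[OF K cont] by auto
  obtain b where b: "b \<in> K" "\<And>x. x \<in> K \<Longrightarrow> cusp_ratio x \<le> cusp_ratio b"
    using continuous_attains_sup[OF K cont] by auto
  show ?thesis
  proof (rule that[of "cusp_ratio a" "cusp_ratio b"])
    show "cusp_ratio a > 0" "cusp_ratio b > 0"
      using a(1) b(1) by (auto simp: mem_K intro!: pos)
    fix \<tau> :: complex assume "Im \<tau> > 0"
    from reduce[OF this] obtain \<tau>' where "\<tau>' \<in> K" "cusp_ratio \<tau> = cusp_ratio \<tau>'" by blast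
    thus "cusp_ratio a \<le> cusp_ratio \<tau> \<and> cusp_ratio \<tau> \<le> cusp_ratio b"
      using a(2) b(2) by simp
  qed
qed

lemma weber_f_decay_at_cusp_1:
  assumes "\<epsilon> > 0"
  obtains m M where "m > 0" "M > 0"
    "\<And>z. Im z \<ge> \<epsilon> \<Longrightarrow> m * exp (- pi * Im z / 12) \<le> norm (weber_f (1 - 1 / z)) \<and>
          norm (weber_f (1 - 1 / z)) \<le> M * exp (- pi * Im z / 12)"
proof -
  obtain m1 M1 where 1: "m1 > 0" "M1 > 0" "\<And>\<tau>. Im \<tau> > 0 \<Longrightarrow> m1 \<le> cusp_ratio \<tau> \<and> cusp_ratio \<tau> \<le> M1"
    using cusp_ratio_bounds by blast
  obtain m2 M2 where 2: "m2 > 0" "M2 > 0"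
    "\<And>\<tau>. Im \<tau> \<ge> 2 * \<epsilon> \<Longrightarrow> m2 * exp (pi * Im \<tau> / 24) \<le> norm (weber_f \<tau>) \<and>
          norm (weber_f \<tau>) \<le> M2 * exp (pi * Im \<tau> / 24)"
    using weber_f_growth[of "2 * \<epsilon>"] assms by auto
  show ?thesis
  proof (rule that[of "m1 / M2" "M1 / m2"])
    fix z :: complex assume z: "Im z \<ge> \<epsilon>"
    define u where "u = norm (weber_f (1 - 1 / z))"
    define v where "v = norm (weber_f (2 * z + 1))"
    define E where "E = exp (pi * Im z / 12)"
    have E: "E > 0" "exp (- pi * Im z / 12) = 1 / E"
      by (auto simp: E_def exp_minus field_simps)
    have v: "m2 * E \<le> v" "v \<le> M2 * E"
      using 2(3)[of "2 * z + 1"] z by (simp_all add: v_def E_def)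
    have uv: "m1 \<le> u * v" "u * v \<le> M1"
      using 1(3)[of z] z assms by (simp_all add: u_def v_def cusp_ratio_def)
    have "u \<ge> 0" by (simp add: u_def)
    have "m1 \<le> u * (M2 * E)" using uv(1) mult_left_mono[OF v(2) \<open>u \<ge> 0\<close>] by linarith
    moreover have "u * (m2 * E) \<le> M1" using uv(2) mult_left_mono[OF v(1) \<open>u \<ge> 0\<close>] by linarith
    ultimately show "m1 / M2 * exp (- pi * Im z / 12) \<le> u \<and> u \<le> M1 / m2 * exp (- pi * Im z / 12)"
      unfolding E(2) using E(1) 2(1,2) by (simp add: field_simps)
  qed (use 1 2 in auto)
qed

section \<open>The theta group\<close>

definition mob :: "int \<Rightarrow> int \<Rightarrow> int \<Rightarrow> int \<Rightarrow> complex \<Rightarrow> complex" where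
  "mob a b c d \<tau> = (of_int a * \<tau> + of_int b) / (of_int c * \<tau> + of_int d)"

text \<open>
  The matrices congruent modulo \<open>2\<close> to the identity or to the matrix of \<open>-1/\<tau>\<close>.
\<close>

definition theta :: "int \<Rightarrow> int \<Rightarrow> int \<Rightarrow> int \<Rightarrow> bool" where
  "theta a b c d \<longleftrightarrow> a * d - b * c = 1 \<and> even (a * b) \<and> even (c * d)"

lemma theta_parity:
  assumes "theta a b c d"
  shows "(odd a \<and> even b \<and> even c \<and> odd d) \<or> (even a \<and> odd b \<and> odd c \<and> even d)"
proof -
  have "odd (a * d - b * c)" using assms by (simp add: theta_def)
  moreover have "even (a * b)" "even (c * d)" using assms by (auto simp: theta_def)
  ultimately show ?thesis by auto
qed

lemma theta_parityI:
  assumes "a * d - b * c = 1"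
    and "(odd a \<and> even b \<and> even c \<and> odd d) \<or> (even a \<and> odd b \<and> odd c \<and> even d)"
  shows "theta a b c d"
  using assms by (auto simp: theta_def)

lemma theta_inverse: "theta a b c d \<Longrightarrow> theta d (- b) (- c) a"
  by (rule theta_parityI) (use theta_parity[of a b c d] in \<open>auto simp: theta_def algebra_simps\<close>)

lemma theta_transpose: "theta a b c d \<Longrightarrow> theta a c b d"
  by (rule theta_parityI) (use theta_parity[of a b c d] in \<open>auto simp: theta_def mult.commute\<close>)

lemma theta_swap_rows: "theta a b c d \<Longrightarrow> theta c d (- a) (- b)"
  by (auto simp: theta_def algebra_simps)

lemma theta_mult:
  assumes "theta a b c d" "theta a' b' c' d'"
  shows "theta (a * a' + b * c') (a * b' + b * d') (c * a' + d * c') (c * b' + d * d')"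
proof (rule theta_parityI)
  have "(a * a' + b * c') * (c * b' + d * d') - (a * b' + b * d') * (c * a' + d * c') =
        (a * d - b * c) * (a' * d' - b' * c')" by (simp add: algebra_simps)
  thus "(a * a' + b * c') * (c * b' + d * d') - (a * b' + b * d') * (c * a' + d * c') = 1"
    using assms by (simp add: theta_def)
qed (use theta_parity[OF assms(1)] theta_parity[OF assms(2)] in auto)

lemma theta_shift:
  assumes "theta a b c d"
  shows "theta (a + 2 * n * c) (b + 2 * n * d) c d"
  using theta_mult[of 1 "2 * n" 0 1 a b c d] assms by (simp add: theta_def)

lemma theta_coprime:
  assumes "theta a b c d"
  shows "coprime c d" "coprime a c" "coprime a b"
proof -
  have det: "a * d - b * c = 1" using assms by (simp add: theta_def)
  have "k dvd 1" if "k dvd c" "k dvd d" for k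
    unfolding det[symmetric] using that by simp
  thus "coprime c d" by (rule coprimeI)
  have "k dvd 1" if "k dvd a" "k dvd c" for k
    unfolding det[symmetric] using that by simp
  thus "coprime a c" by (rule coprimeI)
  have "k dvd 1" if "k dvd a" "k dvd b" for k
    unfolding det[symmetric] using that by simp
  thus "coprime a b" by (rule coprimeI)
qed

text \<open>
  If a completion of the row by Bezout coefficients has odd \<open>a b\<close>, adding the bottom row to the top
  row repairs the parity.
\<close>

lemma theta_bottom_row:
  assumes "coprime c d" "odd (c + d)"
  obtains a b where "theta a b c d"
proof -
  from assms(1) obtain u v where uv: "u * d + v * c = 1"
    by (metis bezout_int coprime_iff_gcd_eq_1 add.commute gcd.commute)
  define a b where "a = u" and "b = - v"
  have det: "a * d - b * c = 1" using uv by (simp add: a_def b_def)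
  have cd: "even (c * d)" using assms(2) by auto
  show ?thesis
  proof (cases "even (a * b)")
    case True
    thus ?thesis using that[of a b] det cd by (simp add: theta_def)
  next
    case False
    have "theta (a + c) (b + d) c d"
      using det cd False assms(2) by (auto simp: theta_def algebra_simps)
    thus ?thesis by (rule that)
  qed
qed

lemma linear_nonzero:
  assumes "Im \<tau> > 0" "c \<noteq> 0 \<or> d \<noteq> 0"
  shows "of_int c * \<tau> + of_int d \<noteq> 0"
proof
  assume eq: "of_int c * \<tau> + of_int d = 0"
  hence "Im (of_int c * \<tau> + of_int d) = 0" by simp
  hence "c = 0" using assms by simp
  thus False using eq assms by simp
qed

lemma Im_mob:
  assumes "Im \<tau> > 0" "c \<noteq> 0 \<or> d \<noteq> 0"
  shows "Im (mob a b c d \<tau>) = of_int (a * d - b * c) * Im \<tau> / (norm (of_int c * \<tau> + of_int d))\<^sup>2"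
  unfolding mob_def Im_divide cmod_power2 by (simp add: algebra_simps)

lemma Im_mob_theta:
  assumes "Im \<tau> > 0" "theta a b c d"
  shows "Im (mob a b c d \<tau>) = Im \<tau> / (norm (of_int c * \<tau> + of_int d))\<^sup>2" "Im (mob a b c d \<tau>) > 0"
proof -
  have nz: "c \<noteq> 0 \<or> d \<noteq> 0" using assms(2) by (auto simp: theta_def)
  show "Im (mob a b c d \<tau>) = Im \<tau> / (norm (of_int c * \<tau> + of_int d))\<^sup>2"
  proof -
    have "a * d - b * c = 1" using assms(2) by (simp add: theta_def)
    thus ?thesis using Im_mob[OF assms(1) nz, of a b] by (simp only:)
  qed
  thus "Im (mob a b c d \<tau>) > 0"
    using assms(1) linear_nonzero[OF assms(1) nz] by simp
qed

lemma mob_mob: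
  assumes "Im \<tau> > 0" "c' \<noteq> 0 \<or> d' \<noteq> 0"
  shows "mob a b c d (mob a' b' c' d' \<tau>) =
         mob (a * a' + b * c') (a * b' + b * d') (c * a' + d * c') (c * b' + d * d') \<tau>"
proof -
  define D where "D = of_int c' * \<tau> + of_int d'"
  have D: "D \<noteq> 0" unfolding D_def by (rule linear_nonzero) fact+
  define E where "E = of_int a' * \<tau> + of_int b'"
  have "mob a b c d (mob a' b' c' d' \<tau>) = (of_int a * (E / D) + of_int b) / (of_int c * (E / D) + of_int d)"
    by (simp add: mob_def D_def E_def)
  also have "\<dots> = ((of_int a * (E / D) + of_int b) * D) / ((of_int c * (E / D) + of_int d) * D)"
    using D by simp
  also have "(of_int a * (E / D) + of_int b) * D = of_int a * E + of_int b * D"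
    using D by (simp add: algebra_simps)
  also have "(of_int c * (E / D) + of_int d) * D = of_int c * E + of_int d * D"
    using D by (simp add: algebra_simps)
  finally show ?thesis
    by (simp add: mob_def D_def E_def algebra_simps)
qed

lemma mob_shift:
  assumes "Im \<tau> > 0" "c \<noteq> 0 \<or> d \<noteq> 0"
  shows "mob (a + n * c) (b + n * d) c d \<tau> = mob a b c d \<tau> + of_int n"
  using linear_nonzero[OF assms] by (simp add: mob_def field_simps)

definition zeta24 :: "int \<Rightarrow> complex" where
  "zeta24 k = exp (- of_real pi * \<i> * of_int k / 12)"

lemma zeta24_add: "zeta24 (j + k) = zeta24 j * zeta24 k"
  by (simp add: zeta24_def exp_add[symmetric] field_simps)

lemma zeta24_0 [simp]: "zeta24 0 = 1"
  by (simp add: zeta24_def)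

lemma norm_zeta24 [simp]: "norm (zeta24 k) = 1"
  by (simp add: zeta24_def)

lemma zeta24_nonzero [simp]: "zeta24 k \<noteq> 0"
  by (simp add: zeta24_def)

lemma zeta24_minus: "zeta24 (- k) = inverse (zeta24 k)"
  by (simp add: zeta24_def exp_minus)

lemma zeta24_power: "zeta24 k ^ n = zeta24 (int n * k)"
  by (induction n) (simp_all add: zeta24_add[symmetric] algebra_simps)

lemma zeta24_mult_24: "zeta24 (24 * k) = 1"
proof -
  have "zeta24 (24 * k) = exp (of_int (2 * (-k)) * of_real pi * \<i>)"
    by (simp add: zeta24_def algebra_simps)
  also have "\<dots> = 1" by (auto simp: exp_eq_1 intro!: exI[of _ "-k"])
  finally show ?thesis .
qed

lemma zeta24_mod: "zeta24 (k mod 24) = zeta24 k"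
proof -
  have "zeta24 k = zeta24 (24 * (k div 24) + k mod 24)" by simp
  also have "\<dots> = zeta24 (k mod 24)" unfolding zeta24_add zeta24_mult_24 by simp
  finally show ?thesis by simp
qed

lemma finite_range_zeta24: "finite (range zeta24)" "card (range zeta24) \<le> 24"
proof -
  have "range zeta24 = zeta24 ` {0..<24}"
  proof safe
    fix k show "zeta24 k \<in> zeta24 ` {0..<24}"
      by (rule image_eqI[of _ _ "k mod 24"]) (auto simp: zeta24_mod)
  qed auto
  thus "finite (range zeta24)" "card (range zeta24) \<le> 24"
    using card_image_le[of "{0..<24::int}" zeta24] by auto
qed

lemma weber_f_plus_even:
  assumes "Im \<tau> > 0"
  shows "weber_f (\<tau> + of_int (2 * n)) = zeta24 n * weber_f \<tau>"
proof -
  have nat: "weber_f (\<tau> + of_int (2 * int k)) = zeta24 (int k) * weber_f \<tau>" if "Im \<tau> > 0" for k \<tau>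
  proof (induction k)
    case (Suc k)
    have "weber_f (\<tau> + of_int (2 * int (Suc k))) = weber_f ((\<tau> + of_int (2 * int k)) + 2)"
      by (simp add: algebra_simps)
    also have "\<dots> = zeta24 1 * weber_f (\<tau> + of_int (2 * int k))"
      by (subst weber_f_plus_2) (use that in \<open>auto simp: zeta24_def\<close>)
    also have "\<dots> = zeta24 (int (Suc k)) * weber_f \<tau>"
      unfolding Suc by (simp add: zeta24_add)
    finally show ?case .
  qed auto
  show ?thesis
  proof (cases "n \<ge> 0")
    case True
    thus ?thesis using nat[OF assms, of "nat n"] by simp
  next
    case False
    have "weber_f (\<tau> + of_int (2 * n) + of_int (2 * int (nat (-n)))) = zeta24 (-n) * weber_f (\<tau> + of_int (2 * n))"
      using nat[of "\<tau> + of_int (2 * n)" "nat (-n)"] assms False by simp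
    thus ?thesis using False by (simp add: zeta24_minus field_simps)
  qed
qed

text \<open>
  The theta group is generated by \<open>\<tau> + 2\<close> and \<open>-1/\<tau>\<close>: an even multiple of \<open>c\<close> can be added to \<open>a\<close> so
  that \<open>\<bar>a\<bar> < \<bar>c\<bar>\<close>, equality being excluded because \<open>a\<close> and \<open>c\<close> are coprime of opposite parity.
\<close>

theorem weber_f_theta:
  assumes "theta a b c d"
  obtains k where "\<And>\<tau>. Im \<tau> > 0 \<Longrightarrow> weber_f (mob a b c d \<tau>) = zeta24 k * weber_f \<tau>"
proof -
  have "\<exists>k. \<forall>\<tau>. Im \<tau> > 0 \<longrightarrow> weber_f (mob a b c d \<tau>) = zeta24 k * weber_f \<tau>"
    using assms
  proof (induction "nat \<bar>c\<bar>" arbitrary: a b c d rule: less_induct)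
    case less
    show ?case
    proof (cases "c = 0")
      case True
      hence "a * d = 1" using less.prems by (simp add: theta_def)
      hence ad: "a = d" "d = 1 \<or> d = -1"
        by (auto simp: zmult_eq_1_iff)
      have "even (d * b)" using theta_parity[OF less.prems] True by auto
      then obtain n where n: "d * b = 2 * n" by blast
      have "mob a b c d \<tau> = \<tau> + of_int (2 * n)" for \<tau>
        unfolding n[symmetric] using ad True by (auto simp: mob_def)
      thus ?thesis using weber_f_plus_even by auto
    next
      case False
      define r where "r = a mod (2 * \<bar>c\<bar>)"
      define s where "s = (if r < \<bar>c\<bar> then r else r - 2 * \<bar>c\<bar>)"
      have r: "0 \<le> r" "r < 2 * \<bar>c\<bar>" using False by (auto simp: r_def)
      have "\<bar>s\<bar> \<le> \<bar>c\<bar>" using r by (auto simp: s_def)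
      have "\<exists>n. s = a + 2 * n * c"
      proof -
        have "a = 2 * \<bar>c\<bar> * (a div (2 * \<bar>c\<bar>)) + r" by (simp add: r_def)
        hence "s = a + 2 * (- (a div (2 * \<bar>c\<bar>)) - (if r < \<bar>c\<bar> then 0 else 1)) * \<bar>c\<bar>"
          by (auto simp: s_def algebra_simps)
        also have "\<bar>c\<bar> = sgn c * c" by (simp add: sgn_if)
        finally show ?thesis by (metis mult.assoc)
      qed
      then obtain n where n: "s = a + 2 * n * c" by blast
      define t where "t = b + 2 * n * d"
      have th: "theta s t c d" unfolding n t_def by (rule theta_shift[OF less.prems])
      have "\<bar>s\<bar> \<noteq> \<bar>c\<bar>"
        using theta_parity[OF th] by (metis dvd_abs_iff)
      with \<open>\<bar>s\<bar> \<le> \<bar>c\<bar>\<close> have lt: "nat \<bar>s\<bar> < nat \<bar>c\<bar>" by linarith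
      have th': "theta (- c) (- d) s t"
        using theta_swap_rows[OF theta_swap_rows[OF theta_swap_rows[OF th]]] by simp
      from less.hyps[OF lt th'] obtain k where
        k: "\<And>\<tau>. Im \<tau> > 0 \<Longrightarrow> weber_f (mob (- c) (- d) s t \<tau>) = zeta24 k * weber_f \<tau>" by blast
      have "weber_f (mob a b c d \<tau>) = zeta24 (k - n) * weber_f \<tau>" if \<tau>: "Im \<tau> > 0" for \<tau>
      proof -
        have nz: "s \<noteq> 0 \<or> t \<noteq> 0" "c \<noteq> 0 \<or> d \<noteq> 0" using th by (auto simp: theta_def)
        define w where "w = mob s t c d \<tau>"
        have w: "w = mob a b c d \<tau> + of_int (2 * n)"
          unfolding w_def n t_def by (rule mob_shift[OF \<tau> nz(2)])
        have "w = -1 / mob (- c) (- d) s t \<tau>"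
          using linear_nonzero[OF \<tau> nz(1)] linear_nonzero[OF \<tau> nz(2)]
        proof -
          define X Y where "X = of_int s * \<tau> + of_int t" and "Y = of_int c * \<tau> + of_int d"
          have "mob (- c) (- d) s t \<tau> = - Y / X" "w = X / Y"
            by (simp_all add: w_def mob_def X_def Y_def)
          moreover have "X \<noteq> 0" "Y \<noteq> 0"
            unfolding X_def Y_def by (rule linear_nonzero[OF \<tau> nz(1)], rule linear_nonzero[OF \<tau> nz(2)])
          ultimately show ?thesis by simp
        qed
        hence "weber_f w = zeta24 k * weber_f \<tau>"
          using k[OF \<tau>] weber_f_neg_inverse[OF Im_mob_theta(2)[OF \<tau> th']] by simp
        moreover have "weber_f w = zeta24 n * weber_f (mob a b c d \<tau>)"
          unfolding w by (rule weber_f_plus_even[OF Im_mob_theta(2)[OF \<tau> less.prems]])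
        ultimately have "zeta24 n * weber_f (mob a b c d \<tau>) = zeta24 n * (zeta24 (k - n) * weber_f \<tau>)"
          by (simp add: zeta24_add[symmetric] mult.assoc[symmetric])
        thus ?thesis by simp
      qed
      thus ?thesis by blast
    qed
  qed
  thus ?thesis using that by blast
qed

lemma norm_weber_f_theta:
  assumes "theta a b c d" "Im \<tau> > 0"
  shows "norm (weber_f (mob a b c d \<tau>)) = norm (weber_f \<tau>)"
  using weber_f_theta[OF assms(1)] assms(2) by (metis norm_mult norm_zeta24 mult_1)

text \<open>
  Invariance of \<open>f\<close> itself, not only up to a root of unity, is what makes rational functions of \<open>f\<close>
  invariant.
\<close>

definition weber_group :: "int \<Rightarrow> int \<Rightarrow> int \<Rightarrow> int \<Rightarrow> bool" where
  "weber_group a b c d \<longleftrightarrow> theta a b c d \<and> (\<forall>\<tau>. Im \<tau> > 0 \<longrightarrow> weber_f (mob a b c d \<tau>) = weber_f \<tau>)"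

text \<open>
  The translation by \<open>2\<close> multiplies \<open>f\<close> by the generator \<open>zeta24 1\<close> of the group of multipliers.
\<close>

lemma theta_shift_weber_group:
  assumes "theta a b c d"
  obtains n where "weber_group (a + 2 * n * c) (b + 2 * n * d) c d"
proof -
  obtain k where k: "\<And>\<tau>. Im \<tau> > 0 \<Longrightarrow> weber_f (mob a b c d \<tau>) = zeta24 k * weber_f \<tau>"
    by (rule weber_f_theta[OF assms]) blast
  have "weber_f (mob (a + 2 * (-k) * c) (b + 2 * (-k) * d) c d \<tau>) = weber_f \<tau>" if \<tau>: "Im \<tau> > 0" for \<tau>
  proof -
    have nz: "c \<noteq> 0 \<or> d \<noteq> 0" using assms by (auto simp: theta_def)
    have "weber_f (mob (a + 2 * (-k) * c) (b + 2 * (-k) * d) c d \<tau>) = zeta24 (-k) * weber_f (mob a b c d \<tau>)"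
      unfolding mob_shift[OF \<tau> nz] by (rule weber_f_plus_even[OF Im_mob_theta(2)[OF \<tau> assms]])
    also have "\<dots> = weber_f \<tau>" by (simp add: k \<tau> zeta24_minus)
    finally show ?thesis .
  qed
  hence "weber_group (a + 2 * (-k) * c) (b + 2 * (-k) * d) c d"
    unfolding weber_group_def using theta_shift[OF assms, of "-k"] by blast
  thus ?thesis by (rule that)
qed

lemma weber_group_mult:
  assumes "weber_group a b c d" "weber_group a' b' c' d'"
  shows "weber_group (a * a' + b * c') (a * b' + b * d') (c * a' + d * c') (c * b' + d * d')"
  unfolding weber_group_def
proof (intro conjI allI impI)
  show "theta (a * a' + b * c') (a * b' + b * d') (c * a' + d * c') (c * b' + d * d')"
    using assms theta_mult by (simp add: weber_group_def)
  fix \<tau> assume \<tau>: "Im \<tau> > 0"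
  have th: "theta a' b' c' d'" using assms by (simp add: weber_group_def)
  hence nz: "c' \<noteq> 0 \<or> d' \<noteq> 0" by (auto simp: theta_def)
  show "weber_f (mob (a * a' + b * c') (a * b' + b * d') (c * a' + d * c') (c * b' + d * d') \<tau>) = weber_f \<tau>"
    unfolding mob_mob[OF \<tau> nz, symmetric]
    using assms Im_mob_theta(2)[OF \<tau> th] \<tau> by (simp add: weber_group_def)
qed

lemma mob_inverse:
  assumes "Im \<tau> > 0" "theta a b c d"
  shows "mob a b c d (mob d (-b) (-c) a \<tau>) = \<tau>" "mob d (-b) (-c) a (mob a b c d \<tau>) = \<tau>"
proof -
  have det: "a * d - b * c = 1" using assms by (simp add: theta_def)
  hence det': "a * d + b * (-c) = 1" "d * a + (-b) * c = 1" "c * (-b) + d * a = 1" "-c * b + a * d = 1"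
    by (auto simp: algebra_simps)
  have z: "a * -b + b * a = 0" "c * d + d * -c = 0" "d * b + -b * d = 0" "-c * a + a * c = 0"
    by simp_all
  have nz: "c \<noteq> 0 \<or> d \<noteq> 0" "- c \<noteq> 0 \<or> a \<noteq> 0" using assms(2) by (auto simp: theta_def)
  show "mob a b c d (mob d (-b) (-c) a \<tau>) = \<tau>"
    unfolding mob_mob[OF assms(1) nz(2)] det' z by (simp add: mob_def)
  show "mob d (-b) (-c) a (mob a b c d \<tau>) = \<tau>"
    unfolding mob_mob[OF assms(1) nz(1)] det' z by (simp add: mob_def)
qed

section \<open>The transformation of order \<open>N\<close>\<close>

lemma of_nat_mult_mob:
  assumes "c = int N * c'" "N > 0"
  shows "of_nat N * mob a b c d \<tau> = mob a (int N * b) c' d (of_nat N * \<tau>)"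
  using assms by (simp add: mob_def algebra_simps)

lemma theta_conjugate:
  assumes "theta a b (int N * c') d" "odd N"
  shows "theta a (int N * b) c' d"
  using assms by (auto simp: theta_def algebra_simps)

text \<open>
  The quotient of the two matrices has a lower left entry divisible by \<open>N\<close>, so that its conjugate by
  \<open>diag(N, 1)\<close> is integral; it lies in the theta group because \<open>N\<close> is odd.
\<close>

lemma level_equiv_theta:
  assumes "theta a1 b1 c1 d1" "theta a2 b2 c2 d2" "odd N" "int N dvd c1 * d2 - d1 * c2"
  obtains k where "\<And>\<tau>. Im \<tau> > 0 \<Longrightarrow>
     weber_f (of_nat N * mob a1 b1 c1 d1 \<tau>) = zeta24 k * weber_f (of_nat N * mob a2 b2 c2 d2 \<tau>)"
proof -
  have N: "N > 0" using \<open>odd N\<close> by (auto intro: Nat.gr0I)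
  define a b c d where "a = a1 * d2 + b1 * (-c2)" "b = a1 * (-b2) + b1 * a2"
    "c = c1 * d2 + d1 * (-c2)" "d = c1 * (-b2) + d1 * a2"
  have th: "theta a b c d"
    unfolding a_b_c_d_def by (intro theta_mult assms theta_inverse)
  from assms(4) obtain c' where c': "c = int N * c'" by (auto simp: a_b_c_d_def)
  have th': "theta a (int N * b) c' d"
    using theta_conjugate[of a b N c' d] th assms(3) c' by simp
  obtain k where k: "\<And>\<tau>. Im \<tau> > 0 \<Longrightarrow> weber_f (mob a (int N * b) c' d \<tau>) = zeta24 k * weber_f \<tau>"
    by (rule weber_f_theta[OF th']) blast
  show ?thesis
  proof (rule that[of k])
    fix \<tau> assume \<tau>: "Im \<tau> > 0"
    define w where "w = mob a2 b2 c2 d2 \<tau>"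
    have w: "Im w > 0" unfolding w_def by (rule Im_mob_theta(2)[OF \<tau> assms(2)])
    have nz: "- c2 \<noteq> 0 \<or> a2 \<noteq> 0" using assms(2) by (auto simp: theta_def)
    have "mob a1 b1 c1 d1 \<tau> = mob a1 b1 c1 d1 (mob d2 (-b2) (-c2) a2 w)"
      unfolding w_def by (simp only: mob_inverse(2)[OF \<tau> assms(2)])
    also have "\<dots> = mob a b c d w"
      unfolding mob_mob[OF w nz] a_b_c_d_def ..
    finally have "of_nat N * mob a1 b1 c1 d1 \<tau> = mob a (int N * b) c' d (of_nat N * w)"
      using of_nat_mult_mob[OF c' N] by simp
    thus "weber_f (of_nat N * mob a1 b1 c1 d1 \<tau>) = zeta24 k * weber_f (of_nat N * mob a2 b2 c2 d2 \<tau>)"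
      using k[of "of_nat N * w"] w N by (simp add: w_def)
  qed
qed

text \<open>
  Left multiplication by the theta group makes the product of \<open>diag(N, 1)\<close> and an element of the theta
  group upper triangular; then only the quotient of the diagonal entries governs the growth at \<open>\<infinity>\<close>.
\<close>

lemma level_triangular:
  assumes th: "theta \<alpha> \<beta> \<gamma> \<delta>" and N: "odd N"
  obtains a b d k where "a > 0" "d > 0" "a * d = int N" "even b" "a = gcd (int N) \<gamma>"
    "\<And>\<tau>. Im \<tau> > 0 \<Longrightarrow> weber_f (of_nat N * mob \<alpha> \<beta> \<gamma> \<delta> \<tau>) = zeta24 k * weber_f (mob a b 0 d \<tau>)"
proof -
  have N0: "N > 0" using N by (auto intro: Nat.gr0I)
  define a where "a = gcd (int N) \<gamma>"
  define d where "d = int N div a"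
  define r where "r = \<gamma> div a"
  have a: "a > 0" using N0 by (simp add: a_def)
  have Nad: "int N = a * d" and \<gamma>: "\<gamma> = a * r" by (simp_all add: a_def d_def r_def)
  have d: "d > 0" using Nad a N0 by (metis of_nat_0_less_iff zero_less_mult_pos)
  have odd_ad: "odd a" "odd d" using N Nad by (metis even_mult_iff even_of_nat)+
  have cop: "coprime d r"
    using div_gcd_coprime[of "int N" \<gamma>] N0 by (simp add: a_def d_def r_def)
  moreover have "coprime \<alpha> r"
    using theta_coprime(2)[OF th] \<gamma> by (metis coprime_mult_right_iff)
  ultimately have "coprime (d * \<alpha>) r" by simp
  moreover have "odd (d * \<alpha> + r)"
    using theta_parity[OF th] odd_ad \<gamma> by auto
  ultimately obtain x y where xy: "theta x y (d * \<alpha>) r"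
    by (rule theta_bottom_row)
  define p q s where "p = d * \<alpha>" "q = - x" "s = - y"
  have U: "theta p q r s"
    using theta_transpose[OF theta_swap_rows[OF xy]] by (simp add: p_q_s_def)
  define b where "b = s * int N * \<beta> - q * \<delta>"
  have detU: "p * s - q * r = 1" and det: "\<alpha> * \<delta> - \<beta> * \<gamma> = 1"
    using U th by (auto simp: theta_def)
  have "even b"
    using theta_parity[OF U] theta_parity[OF th] N odd_ad \<gamma> by (auto simp: b_def p_q_s_def)
  have e1: "p * a = int N * \<alpha>" and e2: "r * a = \<gamma>"
    by (simp_all add: p_q_s_def Nad \<gamma> mult_ac)
  have d_eq: "d = p * \<delta> - r * (int N * \<beta>)"
  proof -
    have "p * \<delta> - r * (int N * \<beta>) = d * (\<alpha> * \<delta> - \<beta> * \<gamma>)"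
      by (simp add: p_q_s_def Nad \<gamma> algebra_simps)
    thus ?thesis by (simp add: det)
  qed
  have e3: "p * b + q * d = int N * \<beta>"
  proof -
    have "p * b + q * d = (p * s - q * r) * (int N * \<beta>)"
      by (simp add: b_def d_eq algebra_simps)
    thus ?thesis by (simp add: detU)
  qed
  have e4: "r * b + s * d = \<delta>"
  proof -
    have "r * b + s * d = (p * s - q * r) * \<delta>"
      by (simp add: b_def d_eq algebra_simps)
    thus ?thesis by (simp add: detU)
  qed
  obtain k where k: "\<And>\<tau>. Im \<tau> > 0 \<Longrightarrow> weber_f (mob p q r s \<tau>) = zeta24 k * weber_f \<tau>"
    by (rule weber_f_theta[OF U]) blast
  show ?thesis
  proof (rule that[of a d b k])
    fix \<tau> assume \<tau>: "Im \<tau> > 0"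
    have "mob p q r s (mob a b 0 d \<tau>) = mob (p * a) (p * b + q * d) (r * a) (r * b + s * d) \<tau>"
      using mob_mob[OF \<tau>, of 0 d p q r s a b] d by simp
    also have "\<dots> = of_nat N * mob \<alpha> \<beta> \<gamma> \<delta> \<tau>"
      unfolding e1 e2 e3 e4 by (simp add: mob_def algebra_simps)
    finally have eq: "of_nat N * mob \<alpha> \<beta> \<gamma> \<delta> \<tau> = mob p q r s (mob a b 0 d \<tau>)" by simp
    show "weber_f (of_nat N * mob \<alpha> \<beta> \<gamma> \<delta> \<tau>) = zeta24 k * weber_f (mob a b 0 d \<tau>)"
      unfolding eq by (rule k) (use a d \<tau> in \<open>simp add: mob_def\<close>)
  next
    show "a > 0" "d > 0" "even b" by fact+
    show "a * d = int N" by (rule Nad[symmetric])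
    show "a = gcd (int N) \<gamma>" by (rule a_def)
  qed
qed

text \<open>
  The triangular matrix maps the cusp \<open>1\<close> to \<open>(a + b)/d\<close>, a quotient of odd numbers, and the theta
  group moves any such fraction back to \<open>1\<close>.
\<close>

lemma level_triangular_cusp_1:
  assumes N: "odd N" and a: "a > 0" and d: "d > 0" and ad: "a * d = int N" and b: "even b"
  obtains a' b' d' where "a' > 0" "d' > 0" "a' * d' = int N"
    "\<And>z. Im z > 0 \<Longrightarrow> norm (weber_f (mob a b 0 d (1 - 1 / z))) = norm (weber_f (1 - 1 / mob a' b' 0 d' z))"
proof -
  have odd_ad: "odd a" "odd d" using N ad by (metis even_mult_iff even_of_nat)+
  define a' where "a' = gcd (a + b) d"
  define x y where "x = (a + b) div a'" "y = d div a'"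
  have a': "a' > 0" using d by (simp add: a'_def)
  have x: "a + b = x * a'" and y: "d = y * a'" by (simp_all add: a'_def x_y_def)
  have y0: "y > 0" using y d a' by (metis zero_less_mult_pos2)
  have odd_xy: "odd x" "odd y" using x y odd_ad b by (metis even_add even_mult_iff)+
  have cop: "coprime y x"
    using div_gcd_coprime[of "a + b" d] d by (simp add: a'_def x_y_def coprime_commute)
  then obtain u v where "u * y + v * x = 1"
    by (metis bezout_int coprime_iff_gcd_eq_1)
  define p r where "p = u" "r = - v"
  have det: "y * p - x * r = 1" using \<open>u * y + v * x = 1\<close> by (simp add: p_r_def mult.commute)
  have "odd (y * p - x * r)" by (simp add: det)
  hence pr: "odd (p + r)" using odd_xy by simp
  have U: "theta p (x - p) r (y - r)"
    using det pr odd_xy by (auto simp: theta_def algebra_simps)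
  define b' d' where "b' = a * r" "d' = a * y"
  have d': "d' > 0" using a y0 by (simp add: b'_d'_def)
  show ?thesis
  proof (rule that[of a' d' b'])
    show "a' * d' = int N" using ad y by (simp add: b'_d'_def mult_ac)
    fix z assume z: "Im z > 0"
    define w where "w = mob a' b' 0 d' z"
    have w: "Im w > 0" using a' d' z by (simp add: w_def mob_def)
    have w0: "w \<noteq> 0" "z \<noteq> 0" using w z by auto
    have Im1: "Im (1 - 1 / w) > 0" using Im_neg_inverse(2)[OF w] by simp
    have m1: "1 - 1 / u = mob 1 (-1) 1 0 u" if "u \<noteq> 0" for u
      using that by (simp add: mob_def field_simps)
    have "mob p (x - p) r (y - r) (1 - 1 / w) = mob x (- p) y (- r) w"
      using mob_mob[OF w, of 1 0 p "x - p" r "y - r" 1 "-1"] m1[OF w0(1)] by simp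
    also have "\<dots> = mob (x * a') (x * b' - p * d') (y * a') (y * b' - r * d') z"
      using mob_mob[OF z, of 0 d' x "-p" y "-r" a' b'] d' by (simp add: w_def)
    also have "x * b' - p * d' = - a"
    proof -
      have "x * b' - p * d' = - a * (y * p - x * r)" by (simp add: b'_d'_def algebra_simps)
      thus ?thesis by (simp add: det)
    qed
    also have "y * b' - r * d' = 0" by (simp add: b'_d'_def algebra_simps)
    also have "mob (x * a') (- a) (y * a') 0 z = mob a b 0 d (1 - 1 / z)"
      using mob_mob[OF z, of 1 0 a b 0 d 1 "-1"] m1[OF w0(2)] by (simp add: x y)
    finally show "norm (weber_f (mob a b 0 d (1 - 1 / z))) = norm (weber_f (1 - 1 / mob a' b' 0 d' z))"
      using norm_weber_f_theta[OF U Im1] by (simp add: w_def)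
  qed (use a' d' in auto)
qed

lemma Im_mob_triangular: "d > 0 \<Longrightarrow> Im (mob a b 0 d \<tau>) = of_int a * Im \<tau> / of_int d"
  by (simp add: mob_def)

lemma divisor_quotient_bounds:
  assumes "a > 0" "d > 0" "a * d = int N"
  shows "1 / real N \<le> of_int a / of_int d" "(of_int a :: real) / of_int d \<le> real N"
    "0 \<le> (of_int a :: real) / of_int d"
proof -
  have N: "real N = of_int a * of_int d" using assms(3) by (metis of_int_mult of_int_of_nat_eq)
  have ge: "(of_int a :: real) \<ge> 1" "(of_int d :: real) \<ge> 1" using assms by auto
  have "1 \<le> (of_int a :: real) * of_int a" using ge mult_mono[of 1 "of_int a :: real" 1] by simp
  thus "1 / real N \<le> of_int a / of_int d" using ge unfolding N by (simp add: field_simps)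
  have "1 \<le> (of_int d :: real) * of_int d" using ge mult_mono[of 1 "of_int d :: real" 1] by simp
  hence "of_int a * 1 \<le> of_int a * ((of_int d :: real) * of_int d)" using ge by (intro mult_left_mono) auto
  thus "(of_int a :: real) / of_int d \<le> real N" using ge unfolding N by (simp add: field_simps)
  show "0 \<le> (of_int a :: real) / of_int d" using ge by simp
qed

text \<open>
  The diagonal quotients lie between \<open>1/N\<close> and \<open>N\<close>, so the growth at \<open>\<infinity>\<close> is at most exponential. At the
  cusp \<open>1\<close> all the conjugates decay, like \<open>f\<close>.
\<close>

lemma level_growth:
  assumes N: "odd N"
  obtains C where "C > 0" "\<And>\<alpha> \<beta> \<gamma> \<delta> \<tau>. theta \<alpha> \<beta> \<gamma> \<delta> \<Longrightarrow> Im \<tau> \<ge> 1 \<Longrightarrow>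
      norm (weber_f (of_nat N * mob \<alpha> \<beta> \<gamma> \<delta> \<tau>)) \<le> C * exp (pi * real N / 24 * Im \<tau>)"
    "\<And>\<alpha> \<beta> \<gamma> \<delta> z. theta \<alpha> \<beta> \<gamma> \<delta> \<Longrightarrow> Im z \<ge> 1 \<Longrightarrow>
      norm (weber_f (of_nat N * mob \<alpha> \<beta> \<gamma> \<delta> (1 - 1 / z))) \<le> C"
proof -
  have N0: "N > 0" using N by (auto intro: Nat.gr0I)
  have eps: "1 / real N > 0" using N0 by simp
  obtain m1 M1 where 1: "m1 > 0" "M1 > 0" "\<And>\<tau>. Im \<tau> \<ge> 1 / real N \<Longrightarrow> m1 * exp (pi * Im \<tau> / 24) \<le> norm (weber_f \<tau>) \<and>
          norm (weber_f \<tau>) \<le> M1 * exp (pi * Im \<tau> / 24)"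
    using weber_f_growth[OF eps] by metis
  obtain m2 M2 where 2: "m2 > 0" "M2 > 0" "\<And>z. Im z \<ge> 1 / real N \<Longrightarrow> m2 * exp (- pi * Im z / 12) \<le> norm (weber_f (1 - 1 / z)) \<and>
          norm (weber_f (1 - 1 / z)) \<le> M2 * exp (- pi * Im z / 12)"
    using weber_f_decay_at_cusp_1[OF eps] by metis
  show ?thesis
  proof (rule that[of "M1 + M2"])
    show "M1 + M2 > 0" using 1 2 by simp
  next
    fix \<alpha> \<beta> \<gamma> \<delta> and \<tau> :: complex assume th: "theta \<alpha> \<beta> \<gamma> \<delta>" and \<tau>: "Im \<tau> \<ge> 1"
    obtain a b d k where tri: "a > 0" "d > 0" "a * d = int N"
      "\<And>\<tau>. Im \<tau> > 0 \<Longrightarrow> weber_f (of_nat N * mob \<alpha> \<beta> \<gamma> \<delta> \<tau>) = zeta24 k * weber_f (mob a b 0 d \<tau>)"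
      by (rule level_triangular[OF th N]) blast
    note ad = divisor_quotient_bounds[OF tri(1-3)]
    have Im: "Im (mob a b 0 d \<tau>) = of_int a / of_int d * Im \<tau>" using tri by (simp add: Im_mob_triangular)
    have "1 / real N * 1 \<le> of_int a / of_int d * Im \<tau>"
      using ad \<tau> by (intro mult_mono) auto
    hence "norm (weber_f (mob a b 0 d \<tau>)) \<le> M1 * exp (pi * (of_int a / of_int d * Im \<tau>) / 24)"
      using 1(3)[of "mob a b 0 d \<tau>"] unfolding Im by simp
    also have "\<dots> \<le> (M1 + M2) * exp (pi * real N / 24 * Im \<tau>)"
    proof (intro mult_mono)
      have "of_int a / of_int d * Im \<tau> \<le> real N * Im \<tau>"
        using ad \<tau> by (intro mult_right_mono) auto
      hence "pi * (of_int a / of_int d * Im \<tau>) \<le> pi * (real N * Im \<tau>)" by (intro mult_left_mono) auto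
      thus "exp (pi * (of_int a / of_int d * Im \<tau>) / 24) \<le> exp (pi * real N / 24 * Im \<tau>)" by simp
    qed (use 1 2 in auto)
    finally show "norm (weber_f (of_nat N * mob \<alpha> \<beta> \<gamma> \<delta> \<tau>)) \<le> (M1 + M2) * exp (pi * real N / 24 * Im \<tau>)"
      using tri(4)[of \<tau>] \<tau> by (simp add: norm_mult)
  next
    fix \<alpha> \<beta> \<gamma> \<delta> and z :: complex assume th: "theta \<alpha> \<beta> \<gamma> \<delta>" and z: "Im z \<ge> 1"
    obtain a b d k where tri: "a > 0" "d > 0" "a * d = int N" "even b"
      "\<And>\<tau>. Im \<tau> > 0 \<Longrightarrow> weber_f (of_nat N * mob \<alpha> \<beta> \<gamma> \<delta> \<tau>) = zeta24 k * weber_f (mob a b 0 d \<tau>)"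
      by (rule level_triangular[OF th N]) blast
    obtain a' b' d' where c: "a' > 0" "d' > 0" "a' * d' = int N"
      "\<And>z. Im z > 0 \<Longrightarrow> norm (weber_f (mob a b 0 d (1 - 1 / z))) = norm (weber_f (1 - 1 / mob a' b' 0 d' z))"
      by (rule level_triangular_cusp_1[OF N tri(1-4)]) blast
    have Im1: "Im (1 - 1 / z) > 0" using Im_neg_inverse(2)[of z] z by simp
    have "norm (weber_f (of_nat N * mob \<alpha> \<beta> \<gamma> \<delta> (1 - 1 / z))) = norm (weber_f (1 - 1 / mob a' b' 0 d' z))"
      using tri(5)[OF Im1] c(4)[of z] z by (simp add: norm_mult)
    also have "\<dots> \<le> M2 * exp (- pi * Im (mob a' b' 0 d' z) / 12)"
    proof -
      have "1 / real N * 1 \<le> of_int a' / of_int d' * Im z"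
        using divisor_quotient_bounds[OF c(1-3)] z by (intro mult_mono) auto
      thus ?thesis using 2(3)[of "mob a' b' 0 d' z"] c by (simp add: Im_mob_triangular)
    qed
    also have "\<dots> \<le> (M1 + M2) * 1"
      using 1 2 c z by (intro mult_mono) (auto simp: Im_mob_triangular)
    finally show "norm (weber_f (of_nat N * mob \<alpha> \<beta> \<gamma> \<delta> (1 - 1 / z))) \<le> M1 + M2" by simp
  qed
qed

text \<open>
  For the quotient of the two matrices with lower left entry \<open>c\<close>, the growth of \<open>f(N \<tau>)\<close> at \<open>\<infinity>\<close> is preserved only if
  the diagonal quotient is \<open>N\<close>, and the upper diagonal entry is \<open>gcd N c\<close>.
\<close>

lemma level_equiv_converse:
  assumes th1: "theta a1 b1 c1 d1" and th2: "theta a2 b2 c2 d2" and N: "odd N"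
    and eq: "\<And>\<tau>. Im \<tau> > 0 \<Longrightarrow>
       norm (weber_f (of_nat N * mob a1 b1 c1 d1 \<tau>)) = norm (weber_f (of_nat N * mob a2 b2 c2 d2 \<tau>))"
  shows "int N dvd c1 * d2 - d1 * c2"
proof -
  have N0: "N > 0" using N by (auto intro: Nat.gr0I)
  define a b c d where "a = a1 * d2 + b1 * (-c2)" "b = a1 * (-b2) + b1 * a2"
    "c = c1 * d2 + d1 * (-c2)" "d = c1 * (-b2) + d1 * a2"
  have th: "theta a b c d"
    unfolding a_b_c_d_def by (intro theta_mult assms theta_inverse)
  have eq': "norm (weber_f (of_nat N * mob a b c d w)) = norm (weber_f (of_nat N * w))" if w: "Im w > 0" for w
  proof -
    define \<tau> where "\<tau> = mob d2 (-b2) (-c2) a2 w"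
    have \<tau>: "Im \<tau> > 0" unfolding \<tau>_def by (rule Im_mob_theta(2)[OF w theta_inverse[OF th2]])
    have nz: "- c2 \<noteq> 0 \<or> a2 \<noteq> 0" using th2 by (auto simp: theta_def)
    have "mob a b c d w = mob a1 b1 c1 d1 \<tau>"
      unfolding \<tau>_def mob_mob[OF w nz] a_b_c_d_def ..
    moreover have "w = mob a2 b2 c2 d2 \<tau>"
      unfolding \<tau>_def by (simp only: mob_inverse(1)[OF w th2])
    ultimately show ?thesis using eq[OF \<tau>] by simp
  qed
  obtain a' b' d' k where tri: "a' > 0" "d' > 0" "a' * d' = int N" "a' = gcd (int N) c"
    "\<And>\<tau>. Im \<tau> > 0 \<Longrightarrow> weber_f (of_nat N * mob a b c d \<tau>) = zeta24 k * weber_f (mob a' b' 0 d' \<tau>)"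
    by (rule level_triangular[OF th N]) blast
  note ad = divisor_quotient_bounds[OF tri(1-3)]
  have eps: "1 / real N > 0" using N0 by simp
  obtain m M where mM: "m > 0" "M > 0" "\<And>\<tau>. Im \<tau> \<ge> 1 / real N \<Longrightarrow> m * exp (pi * Im \<tau> / 24) \<le> norm (weber_f \<tau>) \<and>
          norm (weber_f \<tau>) \<le> M * exp (pi * Im \<tau> / 24)"
    using weber_f_growth[OF eps] by metis
  define q where "q = (of_int a' :: real) / of_int d'"
  have bound: "m * exp (pi * (real N - q) / 24 * y) \<le> M" if y: "y \<ge> 1" for y
  proof -
    define \<tau> where "\<tau> = \<i> * complex_of_real y"
    have "1 / real N \<le> real N * y"
    proof -
      have "1 / real N \<le> 1" using N0 by simp
      moreover have "1 * 1 \<le> real N * y" using N0 y by (intro mult_mono) auto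
      ultimately show ?thesis by linarith
    qed
    hence "m * exp (pi * (real N * y) / 24) \<le> norm (weber_f (of_nat N * \<tau>))"
      using mM(3)[of "of_nat N * \<tau>"] by (simp add: \<tau>_def)
    also have "\<dots> = norm (weber_f (mob a' b' 0 d' \<tau>))"
      using eq'[of \<tau>] tri(5)[of \<tau>] y by (simp add: norm_mult \<tau>_def)
    also have "\<dots> \<le> M * exp (pi * (q * y) / 24)"
    proof -
      have "1 / real N * 1 \<le> q * y"
        unfolding q_def using ad y by (intro mult_mono) auto
      thus ?thesis using mM(3)[of "mob a' b' 0 d' \<tau>"] tri(2) by (simp add: Im_mob_triangular \<tau>_def q_def)
    qed
    finally have "m * (exp (pi * (real N * y) / 24) / exp (pi * (q * y) / 24)) \<le> M"
      by (simp add: field_simps)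
    also have "exp (pi * (real N * y) / 24) / exp (pi * (q * y) / 24) = exp (pi * (real N - q) / 24 * y)"
      unfolding exp_diff[symmetric] by (simp add: field_simps)
    finally show ?thesis .
  qed
  have "q \<ge> real N"
  proof (rule ccontr)
    assume "\<not> q \<ge> real N"
    hence pos: "pi * (real N - q) / 24 > 0" by simp
    define y where "y = max 1 (M / m / (pi * (real N - q) / 24))"
    have "m * (pi * (real N - q) / 24 * y) < m * exp (pi * (real N - q) / 24 * y)"
      using mM(1) exp_gt_self by (intro mult_strict_left_mono) auto
    also have "\<dots> \<le> M" by (rule bound) (simp add: y_def)
    finally have "pi * (real N - q) / 24 * y < M / m" using mM(1) by (simp add: field_simps)
    moreover have "pi * (real N - q) / 24 * (M / m / (pi * (real N - q) / 24)) \<le> pi * (real N - q) / 24 * y"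
      using pos by (intro mult_left_mono) (auto simp: y_def)
    moreover have "c * (e / c) = e" if "c > 0" for c e :: real using that by simp
    from this[OF pos, of "M / m"] have "pi * (real N - q) / 24 * (M / m / (pi * (real N - q) / 24)) = M / m" .
    ultimately show False by linarith
  qed
  moreover have "of_int d' \<ge> (1::real)" using tri(2) by auto
  ultimately have "real N * 1 \<le> of_int a'"
  proof -
    assume "real N \<le> q" and d': "of_int d' \<ge> (1::real)"
    hence "real N * of_int d' \<le> of_int a'" by (simp add: q_def field_simps)
    moreover have "real N * 1 \<le> real N * of_int d'" using d' by (intro mult_left_mono) auto
    ultimately show ?thesis by linarith
  qed
  hence "int N \<le> a'" by linarith
  moreover have "a' \<le> int N" unfolding tri(4) using N0 by (intro zdvd_imp_le) auto
  ultimately have "gcd (int N) c = int N" using tri(4) by simp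
  hence "int N dvd c" by (metis gcd_dvd2)
  thus ?thesis by (simp add: a_b_c_d_def)
qed

section \<open>Invariant functions are polynomials in the Weber function\<close>

lemma integer_translation_invariant:
  fixes U :: "complex \<Rightarrow> 'a" and p :: real
  assumes "\<And>\<tau>. Im \<tau> > 0 \<Longrightarrow> U (\<tau> + of_real p) = U \<tau>" "Im \<tau> > 0"
  shows "U (\<tau> + of_int n * of_real p) = U \<tau>"
proof -
  have nat: "U (\<tau> + of_nat k * of_real p) = U \<tau>" if "Im \<tau> > 0" for k \<tau>
  proof (induction k)
    case (Suc k)
    have "U (\<tau> + of_nat (Suc k) * of_real p) = U ((\<tau> + of_nat k * of_real p) + of_real p)"
      by (simp add: algebra_simps)
    thus ?case using Suc assms(1)[of "\<tau> + of_nat k * of_real p"] that by simp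
  qed auto
  show ?thesis
  proof (cases "n \<ge> 0")
    case True
    thus ?thesis using nat[OF assms(2), of "nat n"] by simp
  next
    case False
    have "U (\<tau> + of_int n * of_real p + of_nat (nat (-n)) * of_real p) = U (\<tau> + of_int n * of_real p)"
      by (rule nat) (use assms(2) in simp)
    thus ?thesis using False by (simp add: algebra_simps)
  qed
qed

text \<open>
  Reduction to a fundamental domain: if \<open>\<bar>Re \<tau>\<bar> \<le> 1/2\<close> and \<open>Im \<tau> < 1/2\<close>, then \<open>-1/\<tau>\<close> at least doubles
  the imaginary part.
\<close>

lemma modular_reduction:
  fixes U :: "complex \<Rightarrow> 'a"
  assumes T: "\<And>\<tau>. Im \<tau> > 0 \<Longrightarrow> U (\<tau> + 1) = U \<tau>"
    and S: "\<And>\<tau>. Im \<tau> > 0 \<Longrightarrow> U (-1 / \<tau>) = U \<tau>"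
    and \<tau>: "Im \<tau> > 0"
  obtains \<tau>' where "\<bar>Re \<tau>'\<bar> \<le> 1 / 2" "Im \<tau>' \<ge> 1 / 2" "U \<tau>' = U \<tau>"
proof -
  have translate: "\<exists>\<tau>'. \<bar>Re \<tau>'\<bar> \<le> 1 / 2 \<and> Im \<tau>' = Im \<tau> \<and> U \<tau>' = U \<tau>" if "Im \<tau> > 0" for \<tau>
  proof -
    define \<tau>' where "\<tau>' = \<tau> + of_int (- round (Re \<tau>)) * of_real 1"
    have "U \<tau>' = U \<tau>"
      unfolding \<tau>'_def by (rule integer_translation_invariant) (use T that in auto)
    moreover have "\<bar>Re \<tau>'\<bar> \<le> 1 / 2"
      using of_int_round_abs_le[of "Re \<tau>"] by (simp add: \<tau>'_def abs_minus_commute)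
    ultimately show ?thesis by (intro exI[of _ \<tau>']) (simp add: \<tau>'_def)
  qed
  have main: "\<exists>\<tau>'. \<bar>Re \<tau>'\<bar> \<le> 1 / 2 \<and> Im \<tau>' \<ge> 1 / 2 \<and> U \<tau>' = U \<tau>" if "Im \<tau> \<ge> (1 / 2) ^ Suc n" for n \<tau>
    using that
  proof (induction n arbitrary: \<tau>)
    case 0
    thus ?case using translate[of \<tau>] by auto
  next
    case (Suc n)
    have "Im \<tau> > 0" using Suc.prems by (rule less_le_trans[rotated]) simp
    then obtain \<tau>1 where \<tau>1: "\<bar>Re \<tau>1\<bar> \<le> 1 / 2" "Im \<tau>1 = Im \<tau>" "U \<tau>1 = U \<tau>"
      using translate by blast
    show ?case
    proof (cases "Im \<tau> \<ge> 1 / 2")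
      case True
      thus ?thesis using \<tau>1 by auto
    next
      case False
      have pos: "Im \<tau>1 > 0" using \<tau>1 \<open>Im \<tau> > 0\<close> by simp
      have "(Re \<tau>1)\<^sup>2 \<le> (1 / 2)\<^sup>2" using \<tau>1(1) by (metis abs_ge_zero power2_abs power_mono)
      moreover have "(Im \<tau>1)\<^sup>2 \<le> (1 / 2)\<^sup>2" using False \<tau>1(2) pos by (intro power_mono) auto
      ultimately have "(norm \<tau>1)\<^sup>2 \<le> 1 / 2" unfolding cmod_power2 by (simp add: power2_eq_square)
      moreover have "(norm \<tau>1)\<^sup>2 > 0" using pos by auto
      ultimately have "Im \<tau>1 / (1 / 2) \<le> Im \<tau>1 / (norm \<tau>1)\<^sup>2"
        using pos by (intro divide_left_mono) auto
      hence "Im (-1 / \<tau>1) \<ge> (1 / 2) ^ Suc n"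
      proof -
        have "2 * Im \<tau>1 \<le> Im \<tau>1 / (norm \<tau>1)\<^sup>2" using \<open>Im \<tau>1 / (1 / 2) \<le> _\<close> by simp
        moreover have "(1 / 2) ^ Suc n \<le> 2 * Im \<tau>1" using Suc.prems \<tau>1(2) by simp
        ultimately show ?thesis unfolding Im_neg_inverse(1)[OF pos] by linarith
      qed
      from Suc.IH[OF this] show ?thesis using S[OF pos] \<tau>1(3) by metis
    qed
  qed
  obtain n where "(1 / 2 :: real) ^ n < Im \<tau>" using real_arch_pow_inv[OF \<tau>, of "1 / 2"] by auto
  hence "(1 / 2) ^ Suc n \<le> Im \<tau>" by (simp add: field_simps)
  from main[OF this] show ?thesis using that by blast
qed

text \<open>
  The maximum of \<open>\<bar>K\<bar>\<close> over the three cosets of the theta group is invariant under the whole modular group,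
  so decay at both cusps makes it attain a maximum; then \<open>K\<close> is constant by the maximum modulus principle.
\<close>

lemma theta_invariant_decaying_imp_zero:
  fixes K :: "complex \<Rightarrow> complex"
  assumes holo: "K holomorphic_on upper_half_plane"
    and T: "\<And>\<tau>. Im \<tau> > 0 \<Longrightarrow> norm (K (\<tau> + 2)) = norm (K \<tau>)"
    and S: "\<And>\<tau>. Im \<tau> > 0 \<Longrightarrow> norm (K (-1 / \<tau>)) = norm (K \<tau>)"
    and cusp_infinity: "\<And>\<epsilon>. \<epsilon> > 0 \<Longrightarrow> \<exists>Y. \<forall>\<tau>. Im \<tau> \<ge> Y \<longrightarrow> norm (K \<tau>) < \<epsilon>"
    and cusp_1: "\<And>\<epsilon>. \<epsilon> > 0 \<Longrightarrow> \<exists>Y. \<forall>z. Im z \<ge> Y \<longrightarrow> norm (K (1 - 1 / z)) < \<epsilon>"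
    and \<tau>: "Im \<tau> > 0"
  shows "K \<tau> = 0"
proof (rule ccontr)
  assume "K \<tau> \<noteq> 0"
  define U where "U = (\<lambda>\<tau>. max (norm (K \<tau>)) (max (norm (K (\<tau> + 1))) (norm (K (1 - 1 / \<tau>)))))"
  have Im1: "Im (1 - 1 / w) > 0" if "Im w > 0" for w using Im_neg_inverse(2)[OF that] by simp
  have U_T: "U (w + 1) = U w" if w: "Im w > 0" for w
  proof -
    have w0: "w \<noteq> 0" "w + 1 \<noteq> 0" using w by (auto simp: complex_eq_iff)
    define v where "v = -1 - 1 / w"
    have v: "Im v > 0" using Im_neg_inverse(2)[OF w] by (simp add: v_def)
    have "v = - (w + 1) / w" using w0 by (simp add: v_def field_simps)
    moreover have "v \<noteq> 0" using v by auto
    ultimately have "1 - 1 / (w + 1) = -1 / v" using w0 by (simp add: divide_simps mult.commute)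
    hence "norm (K (1 - 1 / (w + 1))) = norm (K (v + 2))" using S[OF v] T[OF v] by simp
    also have "v + 2 = 1 - 1 / w" by (simp add: v_def)
    finally have "norm (K (1 - 1 / (w + 1))) = norm (K (1 - 1 / w))" .
    moreover have "norm (K (w + 1 + 1)) = norm (K w)" using T[OF w] by (simp add: add.assoc)
    ultimately show ?thesis by (simp add: U_def max.commute max.left_commute)
  qed
  have U_S: "U (-1 / w) = U w" if w: "Im w > 0" for w
  proof -
    have "-1 / w + 1 = 1 - 1 / w" by simp
    moreover have "1 - 1 / (-1 / w) = w + 1" using w by auto
    ultimately show ?thesis unfolding U_def using S[OF w] by (simp only: max.commute max.left_commute)
  qed
  define u where "u = U \<tau>"
  have "u > 0" using \<open>K \<tau> \<noteq> 0\<close> by (simp add: u_def U_def less_max_iff_disj)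
  from cusp_infinity[OF this] obtain Y1 where Y1: "\<And>w. Im w \<ge> Y1 \<Longrightarrow> norm (K w) < u" by blast
  from cusp_1[OF \<open>u > 0\<close>] obtain Y2 where Y2: "\<And>w. Im w \<ge> Y2 \<Longrightarrow> norm (K (1 - 1 / w)) < u" by blast
  define Y where "Y = max Y1 Y2"
  have U_less: "U w < u" if "Im w \<ge> Y" for w
    using Y1[of w] Y1[of "w + 1"] Y2[of w] that by (simp add: U_def Y_def)
  define C where "C = cbox (Complex (-1/2) (1/2)) (Complex (1/2) Y)"
  have mem_C: "w \<in> C \<longleftrightarrow> \<bar>Re w\<bar> \<le> 1 / 2 \<and> 1 / 2 \<le> Im w \<and> Im w \<le> Y" for w
    by (auto simp: C_def in_cbox_complex_iff)
  obtain \<tau>0 where \<tau>0: "\<bar>Re \<tau>0\<bar> \<le> 1 / 2" "Im \<tau>0 \<ge> 1 / 2" "U \<tau>0 = u"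
    unfolding u_def by (rule modular_reduction[of U, OF U_T U_S \<tau>])
  have \<tau>0_C: "\<tau>0 \<in> C" using \<tau>0 U_less[of \<tau>0] by (cases "Im \<tau>0 \<ge> Y") (auto simp: mem_C)
  have "continuous_on C U"
  proof -
    have C_H: "C \<subseteq> upper_half_plane" by (auto simp: mem_C upper_half_plane_def)
    have "continuous_on C K"
      by (rule holomorphic_on_imp_continuous_on[OF holomorphic_on_subset[OF holo C_H]])
    moreover have "(K \<circ> (\<lambda>w. w + 1)) holomorphic_on C"
    proof (rule holomorphic_on_compose_gen[OF _ holo])
      show "(\<lambda>w. w + 1) holomorphic_on C" by (intro holomorphic_intros)
      show "(\<lambda>w. w + 1) ` C \<subseteq> upper_half_plane" by (auto simp: mem_C upper_half_plane_def)
    qed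
    moreover have "(K \<circ> (\<lambda>w. 1 - 1 / w)) holomorphic_on C"
    proof (rule holomorphic_on_compose_gen[OF _ holo])
      show "(\<lambda>w. 1 - 1 / w) holomorphic_on C"
        by (intro holomorphic_intros) (auto simp: mem_C)
      show "(\<lambda>w. 1 - 1 / w) ` C \<subseteq> upper_half_plane"
        using Im1 by (force simp: mem_C upper_half_plane_def)
    qed
    ultimately have "continuous_on C K" "continuous_on C (\<lambda>w. K (w + 1))" "continuous_on C (\<lambda>w. K (1 - 1 / w))"
      using holomorphic_on_imp_continuous_on unfolding o_def by blast+
    thus ?thesis unfolding U_def by (intro continuous_on_max continuous_on_norm)
  qed
  moreover have "compact C" "C \<noteq> {}" using \<tau>0_C by (auto simp: C_def)
  ultimately obtain w where w: "w \<in> C" "\<And>v. v \<in> C \<Longrightarrow> U v \<le> U w"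
    using continuous_attains_sup[of C U] by auto
  have "u \<le> U w" using w(2)[OF \<tau>0_C] \<tau>0(3) by simp
  have U_max: "U v \<le> U w" if v: "Im v > 0" for v
  proof -
    obtain v' where v': "\<bar>Re v'\<bar> \<le> 1 / 2" "Im v' \<ge> 1 / 2" "U v' = U v"
      by (rule modular_reduction[of U, OF U_T U_S v])
    show ?thesis
    proof (cases "Im v' \<le> Y")
      case True
      thus ?thesis using w(2)[of v'] v' by (simp add: mem_C)
    next
      case False
      thus ?thesis using U_less[of v'] v' \<open>u \<le> U w\<close> by simp
    qed
  qed
  have K_le: "norm (K v) \<le> U w" if "Im v > 0" for v
    using U_max[OF that] by (simp add: U_def)
  have Im_w: "Im w > 0" using w(1) by (simp add: mem_C)
  have "\<exists>v. Im v > 0 \<and> norm (K v) = U w"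
  proof -
    have "U w = norm (K w) \<or> U w = norm (K (w + 1)) \<or> U w = norm (K (1 - 1 / w))"
      by (auto simp: U_def max_def)
    thus ?thesis
    proof (elim disjE)
      assume "U w = norm (K (w + 1))"
      thus ?thesis using Im_w by (intro exI[of _ "w + 1"]) simp
    next
      assume "U w = norm (K (1 - 1 / w))"
      thus ?thesis using Im1[OF Im_w] by (intro exI[of _ "1 - 1 / w"]) simp
    qed (use Im_w in auto)
  qed
  then obtain v where v: "Im v > 0" "norm (K v) = U w" by blast
  have "K constant_on upper_half_plane"
    by (rule maximum_modulus_principle[OF holo open_upper_half_plane connected_upper_half_plane open_upper_half_plane order_refl, of v])
       (use v K_le in \<open>auto simp: upper_half_plane_def\<close>)
  then obtain c where c: "\<And>v. Im v > 0 \<Longrightarrow> K v = c" by (auto simp: constant_on_def upper_half_plane_def)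
  have "norm c < u" using Y1[of "\<i> * of_real (max Y1 1)"] c[of "\<i> * of_real (max Y1 1)"] by simp
  moreover have "norm c = U w" using c[OF v(1)] v(2) by simp
  ultimately show False using \<open>u \<le> U w\<close> by simp
qed

text \<open>
  A bounded periodic function is a bounded function of \<open>q = exp (\<pi> \<i> \<tau>)\<close> near \<open>q = 0\<close>, so the singularity
  there is removable.
\<close>

lemma bounded_periodic_limit:
  fixes G :: "complex \<Rightarrow> complex"
  assumes holo: "G holomorphic_on upper_half_plane"
    and per: "\<And>\<tau>. Im \<tau> > 0 \<Longrightarrow> G (\<tau> + 2) = G \<tau>"
    and bdd: "\<And>\<tau>. Im \<tau> \<ge> Y \<Longrightarrow> norm (G \<tau>) \<le> B" and Y: "Y > 0"
  obtains c C where "C > 0" "\<And>\<tau>. Im \<tau> \<ge> Y + 1 \<Longrightarrow> norm (G \<tau> - c) \<le> C * exp (- pi * Im \<tau>)"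
proof -
  define r where "r = exp (- pi * Y)"
  define h where "h = (\<lambda>q. G (Ln q / (of_real pi * \<i>)))"
  have Im_Ln: "Im (Ln q / (of_real pi * \<i>)) = - ln (norm q) / pi" if "q \<noteq> 0" for q
    using that by (simp add: Im_divide power2_eq_square)
  have Im_ge: "Im (Ln q / (of_real pi * \<i>)) \<ge> Y" if "q \<noteq> 0" "norm q \<le> r" for q
  proof -
    have "ln (norm q) \<le> ln r" using that by (subst ln_le_cancel_iff) (auto simp: r_def)
    hence "ln (norm q) \<le> - pi * Y" by (simp add: r_def)
    thus ?thesis unfolding Im_Ln[OF that(1)] by (simp add: field_simps)
  qed
  have G_eq: "G w = h (exp (of_real pi * \<i> * w))" if w: "Im w > 0" for w
  proof -
    define q where "q = exp (of_real pi * \<i> * w)"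
    have "exp (Ln q) = exp (of_real pi * \<i> * w)" by (simp add: q_def)
    then obtain n :: int where "Ln q = of_real pi * \<i> * w + of_int (2 * n) * of_real pi * \<i>"
      by (auto simp: exp_eq)
    hence "Ln q / (of_real pi * \<i>) = w + of_int n * of_real 2" by (simp add: field_simps)
    hence "h q = G (w + of_int n * of_real 2)" by (simp add: h_def)
    also have "\<dots> = G w" by (rule integer_translation_invariant) (use per w in auto)
    finally show ?thesis by (simp add: q_def)
  qed
  have h_holo: "h holomorphic_on ball 0 r - {0}"
  proof -
    have "h field_differentiable (at q0)" if q0: "q0 \<in> ball 0 r - {0}" for q0
    proof -
      \<comment> \<open>A branch of the logarithm near \<open>q0\<close>, where the principal branch may have its cut.\<close>
      define L where "L = (\<lambda>q. (Ln (q / q0) + Ln q0) / (of_real pi * \<i>))"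
      have L_exp: "exp (of_real pi * \<i> * L q) = q" if "q \<noteq> 0" for q
        using that q0 by (simp add: L_def exp_add)
      have ImL: "Im (L q) = - ln (norm q) / pi" if "q \<noteq> 0" for q
        using that q0 by (simp add: L_def Im_divide power2_eq_square norm_divide ln_div)
      define V' where "V' = ball q0 (min (norm q0) (r - norm q0))"
      have V'_q: "q \<noteq> 0" "norm q < r" "q / q0 \<notin> \<real>\<^sub>\<le>\<^sub>0" if "q \<in> V'" for q
      proof -
        have d: "norm (q0 - q) < norm q0" "norm (q0 - q) < r - norm q0" using that by (auto simp: V'_def dist_norm)
        show "q \<noteq> 0" using d by auto
        show "norm q < r" using d norm_triangle_ineq[of q0 "q - q0"] by (simp add: norm_minus_commute)
        show "q / q0 \<notin> \<real>\<^sub>\<le>\<^sub>0"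
        proof
          assume "q / q0 \<in> \<real>\<^sub>\<le>\<^sub>0"
          then obtain t where t: "q / q0 = of_real t" "t \<le> 0" by (auto elim: nonpos_Reals_cases)
          hence "q0 - q = of_real (1 - t) * q0" using q0 by (simp add: field_simps)
          hence "norm (q0 - q) = norm (complex_of_real (1 - t)) * norm q0" by (simp only: norm_mult)
          also have "norm (complex_of_real (1 - t)) = 1 - t" unfolding norm_of_real using t by simp
          finally have "norm (q0 - q) = (1 - t) * norm q0" .
          moreover have "1 * norm q0 \<le> (1 - t) * norm q0" using t by (intro mult_right_mono) auto
          ultimately show False using d by simp
        qed
      qed
      have ImL_pos: "Im (L q) > 0" if "q \<in> V'" for q
      proof -
        have "ln (norm q) < ln r"
          using V'_q[OF that] by (subst ln_less_cancel_iff) (auto simp: r_def)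
        also have "\<dots> < 0" using Y by (simp add: r_def)
        finally show ?thesis using ImL[OF V'_q(1)[OF that]] by (simp add: divide_neg_pos)
      qed
      have "(G \<circ> L) holomorphic_on V'"
      proof (rule holomorphic_on_compose_gen[OF _ holo])
        show "L holomorphic_on V'"
          unfolding L_def using V'_q q0 by (intro holomorphic_intros) auto
        show "L ` V' \<subseteq> upper_half_plane" using ImL_pos by (auto simp: upper_half_plane_def)
      qed
      hence "h holomorphic_on V'"
      proof (rule holomorphic_transform)
        fix q assume q: "q \<in> V'"
        show "(G \<circ> L) q = h q" using G_eq[OF ImL_pos[OF q]] L_exp[OF V'_q(1)[OF q]] by simp
      qed
      moreover have "q0 \<in> V'" using q0 by (simp add: V'_def)
      ultimately show ?thesis
        using holomorphic_on_imp_differentiable_at[of h V' q0] by (simp add: V'_def)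
    qed
    thus ?thesis by (simp add: holomorphic_on_def field_differentiable_at_within)
  qed
  have "r > 0" by (simp add: r_def)
  have "\<exists>g. g holomorphic_on ball 0 r \<and> (\<forall>z\<in>ball 0 r - {0}. g z = h z)"
  proof (subst holomorphic_on_extend_bounded[OF h_holo])
    show "0 \<in> interior (ball 0 r)" using \<open>r > 0\<close> by simp
    have "eventually (\<lambda>z. z \<in> ball 0 r - {0}) (at (0::complex))"
      using \<open>r > 0\<close> by (intro eventually_at_in_open) auto
    hence "eventually (\<lambda>z. norm (h z) \<le> B) (at 0)"
      by eventually_elim (auto simp: h_def intro!: bdd Im_ge)
    thus "\<exists>B. \<forall>\<^sub>F z in at 0. norm (h z) \<le> B" by blast
  qed
  then obtain g where g: "g holomorphic_on ball 0 r" "\<And>z. z \<in> ball 0 r - {0} \<Longrightarrow> g z = h z" by blast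
  define r' where "r' = exp (- pi * (Y + 1))"
  have r': "r' < r" "r' > 0" by (auto simp: r_def r'_def)
  have sub: "cball 0 r' \<subseteq> ball (0::complex) r" using r' by auto
  have "continuous_on (cball 0 r') (deriv g)"
    by (rule holomorphic_on_imp_continuous_on[OF holomorphic_on_subset[OF holomorphic_deriv[OF g(1) open_ball] sub]])
  hence "bounded (deriv g ` cball 0 r')"
    by (intro compact_imp_bounded compact_continuous_image) auto
  then obtain C where C: "C > 0" "\<And>z. z \<in> cball 0 r' \<Longrightarrow> norm (deriv g z) \<le> C"
    by (auto simp: bounded_pos)
  show ?thesis
  proof (rule that[of C "g 0"])
    fix w assume w: "Im w \<ge> Y + 1"
    define q where "q = exp (of_real pi * \<i> * w)"
    have nq: "norm q = exp (- pi * Im w)" by (simp add: q_def)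
    hence "norm q \<le> r'" using w by (simp add: r'_def)
    have "norm (g q - g 0) \<le> C * norm (q - 0)"
    proof (rule field_differentiable_bound[of "cball 0 r'" g "deriv g"])
      show "(g has_field_derivative deriv g z) (at z within cball 0 r')" if "z \<in> cball 0 r'" for z
        using holomorphic_derivI[OF g(1) open_ball, of z] that sub has_field_derivative_at_within by blast
    qed (use C \<open>norm q \<le> r'\<close> r' in auto)
    moreover have "g q = G w"
    proof -
      have "q \<in> ball 0 r - {0}" using \<open>norm q \<le> r'\<close> r' by (auto simp: q_def)
      thus ?thesis using g(2) G_eq[of w] w Y by (simp add: q_def)
    qed
    ultimately show "norm (G w - g 0) \<le> C * exp (- pi * Im w)" using nq by simp
  qed (use C in auto)
qed

text \<open>
  Multiples of powers of \<open>F\<close> are subtracted, starting with the fastest growing term.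
\<close>

lemma polynomial_principal_part:
  fixes F G :: "complex \<Rightarrow> complex"
  assumes F: "F holomorphic_on upper_half_plane" "\<And>\<tau>. Im \<tau> > 0 \<Longrightarrow> F (\<tau> + 2) = F \<tau>"
      "\<And>\<tau>. Im \<tau> > 0 \<Longrightarrow> F \<tau> \<noteq> 0"
    and F_growth: "m > 0" "\<And>\<tau>. Im \<tau> \<ge> 1 \<Longrightarrow> m * exp (pi * Im \<tau>) \<le> norm (F \<tau>) \<and> norm (F \<tau>) \<le> M * exp (pi * Im \<tau>)"
    and G: "G holomorphic_on upper_half_plane" "\<And>\<tau>. Im \<tau> > 0 \<Longrightarrow> G (\<tau> + 2) = G \<tau>"
    and G_growth: "Y \<ge> 1" "\<And>\<tau>. Im \<tau> \<ge> Y \<Longrightarrow> norm (G \<tau>) \<le> C * exp (pi * real D * Im \<tau>)"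
  shows "\<exists>p Y' C'. degree p \<le> D \<and> (\<forall>\<tau>. Im \<tau> \<ge> Y' \<longrightarrow> norm (G \<tau> - poly p (F \<tau>)) \<le> C' * exp (- pi * Im \<tau>))"
  using G G_growth
proof (induction D arbitrary: G Y C)
  case (0 G Y C)
  have bdd: "norm (G \<tau>) \<le> C" if "Im \<tau> \<ge> Y" for \<tau> using 0(4)[OF that] by simp
  have "Y > 0" using 0(3) by simp
  obtain c C' where "C' > 0" "\<And>\<tau>. Im \<tau> \<ge> Y + 1 \<Longrightarrow> norm (G \<tau> - c) \<le> C' * exp (- pi * Im \<tau>)"
    by (rule bounded_periodic_limit[OF 0(1,2) bdd \<open>Y > 0\<close>], assumption, assumption) (rule that)
  thus ?case by (intro exI[of _ "[:c:]"] exI[of _ "Y + 1"] exI[of _ C']) auto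
next
  case (Suc D G Y C)
  have quot_holo: "(\<lambda>\<tau>. G \<tau> / F \<tau> ^ Suc D) holomorphic_on upper_half_plane"
    using F Suc.prems by (intro holomorphic_intros) (auto simp: upper_half_plane_def)
  have quot_bdd: "norm (G \<tau> / F \<tau> ^ Suc D) \<le> C / m ^ Suc D" if \<tau>: "Im \<tau> \<ge> Y" for \<tau>
  proof -
    have "norm (G \<tau>) \<le> C * exp (pi * real (Suc D) * Im \<tau>)" using Suc.prems(4)[OF \<tau>] .
    also have "exp (pi * real (Suc D) * Im \<tau>) = exp (pi * Im \<tau>) ^ Suc D"
      unfolding exp_of_nat_mult[symmetric] by (simp add: mult_ac)
    finally have 1: "norm (G \<tau>) \<le> C * exp (pi * Im \<tau>) ^ Suc D" .
    have 2: "(m * exp (pi * Im \<tau>)) ^ Suc D \<le> norm (F \<tau>) ^ Suc D"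
      using F_growth \<tau> Suc.prems(3) by (intro power_mono) auto
    have "norm (G \<tau>) / norm (F \<tau>) ^ Suc D \<le> (C * exp (pi * Im \<tau>) ^ Suc D) / (m * exp (pi * Im \<tau>)) ^ Suc D"
      by (intro frac_le[OF order_trans[OF norm_ge_zero 1] 1 _ 2]) (use F_growth(1) in auto)
    also have "\<dots> = C / m ^ Suc D" using F_growth(1) unfolding power_mult_distrib by (simp del: power_Suc)
    finally show ?thesis by (simp only: norm_divide norm_power)
  qed
  have quot_per: "G (\<tau> + 2) / F (\<tau> + 2) ^ Suc D = G \<tau> / F \<tau> ^ Suc D" if "Im \<tau> > 0" for \<tau>
    by (simp only: F(2)[OF that] Suc.prems(2)[OF that])
  have "Y > 0" using Suc.prems(3) by simp
  obtain c C1 where c: "C1 > 0" "\<And>\<tau>. Im \<tau> \<ge> Y + 1 \<Longrightarrow> norm (G \<tau> / F \<tau> ^ Suc D - c) \<le> C1 * exp (- pi * Im \<tau>)"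
    by (rule bounded_periodic_limit[OF quot_holo quot_per quot_bdd \<open>Y > 0\<close>], assumption, assumption) (rule that)
  define G1 where "G1 = (\<lambda>\<tau>. G \<tau> - c * F \<tau> ^ Suc D)"
  have "\<exists>p Y' C'. degree p \<le> D \<and> (\<forall>\<tau>. Im \<tau> \<ge> Y' \<longrightarrow> norm (G1 \<tau> - poly p (F \<tau>)) \<le> C' * exp (- pi * Im \<tau>))"
  proof (rule Suc.IH[of G1 "Y + 1" "C1 * M ^ Suc D"])
    show "G1 holomorphic_on upper_half_plane" unfolding G1_def
      using F Suc.prems by (intro holomorphic_intros)
    show "G1 (\<tau> + 2) = G1 \<tau>" if "Im \<tau> > 0" for \<tau>
      using F(2) Suc.prems(2) that by (simp add: G1_def)
    fix \<tau> assume \<tau>: "Im \<tau> \<ge> Y + 1"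
    have Fnz: "F \<tau> \<noteq> 0" using F(3)[of \<tau>] \<tau> Suc.prems(3) by simp
    have "norm (G1 \<tau>) = norm (G \<tau> / F \<tau> ^ Suc D - c) * norm (F \<tau>) ^ Suc D"
      unfolding norm_power[symmetric] norm_mult[symmetric] using Fnz by (simp only: G1_def left_diff_distrib) simp
    also have "\<dots> \<le> C1 * exp (- pi * Im \<tau>) * (M * exp (pi * Im \<tau>)) ^ Suc D"
      using c F_growth \<tau> Suc.prems(3) by (intro mult_mono power_mono) auto
    also have "\<dots> = C1 * M ^ Suc D * (exp (- pi * Im \<tau>) * exp (pi * Im \<tau>) ^ Suc D)"
      by (simp add: power_mult_distrib)
    also have "exp (- pi * Im \<tau>) * exp (pi * Im \<tau>) ^ Suc D = exp (pi * real D * Im \<tau>)"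
      unfolding exp_of_nat_mult[symmetric] exp_add[symmetric] by (simp add: algebra_simps)
    finally show "norm (G1 \<tau>) \<le> C1 * M ^ Suc D * exp (pi * real D * Im \<tau>)" .
  qed (use Suc.prems in auto)
  then obtain p Y' C' where p: "degree p \<le> D" "\<And>\<tau>. Im \<tau> \<ge> Y' \<Longrightarrow> norm (G1 \<tau> - poly p (F \<tau>)) \<le> C' * exp (- pi * Im \<tau>)"
    by blast
  show ?case
  proof (intro exI conjI allI impI)
    show "degree (monom c (Suc D) + p) \<le> Suc D"
      using p(1) degree_monom_le[of c "Suc D"] by (intro degree_add_le) auto
    show "norm (G \<tau> - poly (monom c (Suc D) + p) (F \<tau>)) \<le> C' * exp (- pi * Im \<tau>)" if "Im \<tau> \<ge> Y'" for \<tau>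
      using p(2)[OF that] by (simp add: G1_def poly_monom diff_diff_eq)
  qed
qed

lemma exp_decay_imp_small:
  fixes g :: "complex \<Rightarrow> real"
  assumes "a > 0" "\<And>\<tau>. Im \<tau> \<ge> Y \<Longrightarrow> g \<tau> \<le> A * exp (- a * Im \<tau>)" "\<epsilon> > 0"
  shows "\<exists>Y. \<forall>\<tau>. Im \<tau> \<ge> Y \<longrightarrow> g \<tau> < \<epsilon>"
proof -
  define B where "B = max A 1"
  have B: "B > 0" "A \<le> B" by (auto simp: B_def)
  show ?thesis
  proof (intro exI[of _ "max Y ((ln (B / \<epsilon>) + 1) / a)"] allI impI)
    fix \<tau> :: complex assume \<tau>: "Im \<tau> \<ge> max Y ((ln (B / \<epsilon>) + 1) / a)"
    hence "ln (B / \<epsilon>) + 1 \<le> a * Im \<tau>" using assms(1) by (simp add: field_simps)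
    hence "- a * Im \<tau> < ln (\<epsilon> / B)" using B assms(3) by (simp add: ln_div)
    hence "exp (- a * Im \<tau>) < exp (ln (\<epsilon> / B))" by (simp only: exp_less_cancel_iff)
    also have "\<dots> = \<epsilon> / B" using B assms(3) by simp
    finally have "B * exp (- a * Im \<tau>) < \<epsilon>" using B by (simp add: field_simps)
    moreover have "g \<tau> \<le> A * exp (- a * Im \<tau>)" using assms(2)[of \<tau>] \<tau> by simp
    moreover have "A * exp (- a * Im \<tau>) \<le> B * exp (- a * Im \<tau>)" using B by (intro mult_right_mono) auto
    ultimately show "g \<tau> < \<epsilon>" by linarith
  qed
qed

lemma poly_bounded_on_ball:
  fixes p :: "complex poly"
  obtains B where "B > 0" "\<And>x. norm x \<le> r \<Longrightarrow> norm (poly p x) \<le> B"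
proof -
  have "bounded (poly p ` cball 0 r)"
    by (intro compact_imp_bounded compact_continuous_image continuous_intros) auto
  thus ?thesis using that by (auto simp: bounded_pos)
qed

text \<open>
  After division by a power \<open>f\<^sup>r\<close> with \<open>r < 24\<close> the function is invariant under the theta group, and
  \<open>F = f\<^sup>2\<^sup>4\<close> has a simple pole at \<open>\<infinity>\<close> and a simple zero at the cusp \<open>1\<close>. Subtracting the polynomial
  in \<open>F\<close> with the same principal part at \<open>\<infinity>\<close> leaves a function \<open>H\<close> with a zero at \<open>\<infinity>\<close> and a pole of
  order at most \<open>23/24\<close> at \<open>1\<close>, so that \<open>H\<^sup>4\<^sup>8 F\<^sup>4\<^sup>7\<close> vanishes at both cusps.
\<close>

theorem weber_f_invariant_imp_poly:
  assumes holo: "G holomorphic_on upper_half_plane"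
    and S: "\<And>\<tau>. Im \<tau> > 0 \<Longrightarrow> G (-1 / \<tau>) = G \<tau>"
    and T: "\<And>\<tau>. Im \<tau> > 0 \<Longrightarrow> G (\<tau> + 2) = zeta24 j * G \<tau>"
    and growth: "\<And>\<tau>. Im \<tau> \<ge> 1 \<Longrightarrow> norm (G \<tau>) \<le> C * exp (pi * real D * Im \<tau>)"
    and cusp: "\<And>z. Im z \<ge> 1 \<Longrightarrow> norm (G (1 - 1 / z)) \<le> B"
  obtains p where "degree p \<le> 24 + 24 * D" "\<And>\<tau>. Im \<tau> > 0 \<Longrightarrow> G \<tau> = poly p (weber_f \<tau>)"
proof -
  define r where "r = nat (j mod 24)"
  have r: "r \<le> 23" "int r = j mod 24" by (auto simp: r_def)
  define F where "F = (\<lambda>\<tau>. weber_f \<tau> ^ 24)"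
  define G1 where "G1 = (\<lambda>\<tau>. G \<tau> / weber_f \<tau> ^ r)"
  obtain m M where mM: "m > 0" "M > 0" "\<And>\<tau>. Im \<tau> \<ge> 1 \<Longrightarrow> m * exp (pi * Im \<tau> / 24) \<le> norm (weber_f \<tau>) \<and>
          norm (weber_f \<tau>) \<le> M * exp (pi * Im \<tau> / 24)"
    using weber_f_growth[of 1] by (metis zero_less_one)
  obtain m1 M1 where mM1: "m1 > 0" "M1 > 0" "\<And>z. Im z \<ge> 1 \<Longrightarrow> m1 * exp (- pi * Im z / 12) \<le> norm (weber_f (1 - 1 / z)) \<and>
          norm (weber_f (1 - 1 / z)) \<le> M1 * exp (- pi * Im z / 12)"
    using weber_f_decay_at_cusp_1[of 1] by (metis zero_less_one)
  have F_holo: "F holomorphic_on upper_half_plane"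
    unfolding F_def by (intro holomorphic_intros holomorphic_weber_f)
  have fT: "weber_f (\<tau> + 2) = zeta24 1 * weber_f \<tau>" if "Im \<tau> > 0" for \<tau>
    using weber_f_plus_even[OF that, of 1] by simp
  have F_T: "F (\<tau> + 2) = F \<tau>" if "Im \<tau> > 0" for \<tau>
    using zeta24_mult_24[of 1] by (simp add: F_def fT[OF that] power_mult_distrib zeta24_power)
  have F_S: "F (-1 / \<tau>) = F \<tau>" if "Im \<tau> > 0" for \<tau>
    by (simp only: F_def weber_f_neg_inverse[OF that])
  have F_nz: "F \<tau> \<noteq> 0" if "Im \<tau> > 0" for \<tau>
    using weber_f_nonzero[OF that] by (simp add: F_def)
  have exp24: "exp (x / 24) ^ 24 = exp x" for x :: real
    unfolding exp_of_nat_mult[symmetric] by simp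
  have F_growth: "m ^ 24 * exp (pi * Im \<tau>) \<le> norm (F \<tau>) \<and> norm (F \<tau>) \<le> M ^ 24 * exp (pi * Im \<tau>)" if "Im \<tau> \<ge> 1" for \<tau>
  proof -
    have "(m * exp (pi * Im \<tau> / 24)) ^ 24 \<le> norm (weber_f \<tau>) ^ 24"
      "norm (weber_f \<tau>) ^ 24 \<le> (M * exp (pi * Im \<tau> / 24)) ^ 24"
      using mM(3)[OF that] mM(1,2) by (auto intro!: power_mono)
    thus ?thesis by (simp only: F_def norm_power power_mult_distrib exp24 simp_thms)
  qed
  have G1_holo: "G1 holomorphic_on upper_half_plane"
    unfolding G1_def using weber_f_nonzero
    by (intro holomorphic_intros holo holomorphic_weber_f) (auto simp: upper_half_plane_def)
  have G1_T: "G1 (\<tau> + 2) = G1 \<tau>" if "Im \<tau> > 0" for \<tau>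
  proof -
    have "zeta24 j = zeta24 1 ^ r" using zeta24_mod[of j] by (simp add: zeta24_power r)
    thus ?thesis by (simp add: G1_def T[OF that] fT[OF that] power_mult_distrib)
  qed
  have G1_S: "G1 (-1 / \<tau>) = G1 \<tau>" if "Im \<tau> > 0" for \<tau>
    by (simp only: G1_def weber_f_neg_inverse[OF that] S[OF that])
  have G1_growth: "norm (G1 \<tau>) \<le> C / m ^ r * exp (pi * real D * Im \<tau>)" if "Im \<tau> \<ge> 1" for \<tau>
  proof -
    have "m * 1 \<le> m * exp (pi * Im \<tau> / 24)" using mM(1) that by (intro mult_left_mono) auto
    hence "m \<le> norm (weber_f \<tau>)" using mM(3)[OF that] by linarith
    hence 1: "m ^ r \<le> norm (weber_f \<tau>) ^ r" using mM(1) by (intro power_mono) auto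
    have "norm (G \<tau>) / norm (weber_f \<tau>) ^ r \<le> (C * exp (pi * real D * Im \<tau>)) / m ^ r"
      by (intro frac_le[OF order_trans[OF norm_ge_zero growth[OF that]] growth[OF that] _ 1]) (use mM(1) in auto)
    thus ?thesis by (simp add: G1_def norm_divide norm_power)
  qed
  have "\<exists>p Y' C'. degree p \<le> D \<and> (\<forall>\<tau>. Im \<tau> \<ge> Y' \<longrightarrow> norm (G1 \<tau> - poly p (F \<tau>)) \<le> C' * exp (- pi * Im \<tau>))"
    by (rule polynomial_principal_part[OF F_holo F_T F_nz _ F_growth G1_holo G1_T order_refl G1_growth])
       (use mM(1) in auto)
  then obtain p Y' C' where p: "degree p \<le> D"
    "\<And>\<tau>. Im \<tau> \<ge> Y' \<Longrightarrow> norm (G1 \<tau> - poly p (F \<tau>)) \<le> C' * exp (- pi * Im \<tau>)" by blast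
  define H where "H = (\<lambda>\<tau>. G1 \<tau> - poly p (F \<tau>))"
  define K where "K = (\<lambda>\<tau>. H \<tau> ^ 48 * F \<tau> ^ 47)"
  have K0: "K \<tau> = 0" if "Im \<tau> > 0" for \<tau>
  proof (rule theta_invariant_decaying_imp_zero[of K, OF _ _ _ _ _ that])
    have "(poly p \<circ> F) holomorphic_on upper_half_plane"
      by (rule holomorphic_on_compose[OF F_holo holomorphic_on_subset[of _ UNIV]]) (auto intro!: holomorphic_intros)
    thus "K holomorphic_on upper_half_plane" unfolding K_def H_def o_def
      by (intro holomorphic_intros F_holo G1_holo)
    show "norm (K (\<tau> + 2)) = norm (K \<tau>)" if "Im \<tau> > 0" for \<tau>
      by (simp only: K_def H_def F_T[OF that] G1_T[OF that])
    show "norm (K (-1 / \<tau>)) = norm (K \<tau>)" if "Im \<tau> > 0" for \<tau>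
      by (simp only: K_def H_def F_S[OF that] G1_S[OF that])
  next
    fix \<epsilon> :: real assume \<epsilon>: "\<epsilon> > 0"
    have decay: "norm (K \<tau>) \<le> C' ^ 48 * (M ^ 24) ^ 47 * exp (- pi * Im \<tau>)" if \<tau>: "Im \<tau> \<ge> max Y' 1" for \<tau>
    proof -
      have "norm (K \<tau>) = norm (H \<tau>) ^ 48 * norm (F \<tau>) ^ 47"
        by (simp only: K_def norm_mult norm_power)
      also have "\<dots> \<le> (C' * exp (- pi * Im \<tau>)) ^ 48 * (M ^ 24 * exp (pi * Im \<tau>)) ^ 47"
        using p(2)[of \<tau>] F_growth[of \<tau>] \<tau> unfolding H_def by (intro mult_mono power_mono) auto
      also have "\<dots> = C' ^ 48 * (M ^ 24) ^ 47 * (exp (- pi * Im \<tau>) ^ 48 * exp (pi * Im \<tau>) ^ 47)"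
        unfolding power_mult_distrib by (simp only: mult_ac)
      also have "exp (- pi * Im \<tau>) ^ 48 * exp (pi * Im \<tau>) ^ 47 = exp (- pi * Im \<tau>)"
        unfolding exp_of_nat_mult[symmetric] exp_add[symmetric] by simp
      finally show ?thesis .
    qed
    show "\<exists>Y. \<forall>\<tau>. Im \<tau> \<ge> Y \<longrightarrow> norm (K \<tau>) < \<epsilon>"
      by (rule exp_decay_imp_small[OF pi_gt_zero decay \<epsilon>])
    define R where "R = M1 ^ 24"
    obtain Bp where Bp: "Bp > 0" "\<And>x. norm x \<le> R \<Longrightarrow> norm (poly p x) \<le> Bp"
      using poly_bounded_on_ball[of R p] by blast
    define A where "A = B / min 1 m1 ^ r + Bp"
    \<comment> \<open>With \<open>t = exp (\<pi> Im z / 12)\<close>, \<open>H\<close> is at most of order \<open>t\<^sup>2\<^sup>3\<close> and \<open>F\<close> of order \<open>t\<^sup>-\<^sup>2\<^sup>4\<close>, and \<open>48 * 23 - 47 * 24 = -24\<close>.\<close>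
    have decay1: "norm (K (1 - 1 / z)) \<le> A ^ 48 * R ^ 47 * exp (- (2 * pi) * Im z)" if z: "Im z \<ge> 1" for z
    proof -
      define t where "t = exp (pi * Im z / 12)"
      have t: "t \<ge> 1" using z by (simp add: t_def)
      have t_inv: "exp (- pi * Im z / 12) = 1 / t" by (simp add: t_def exp_minus field_simps)
      have lower: "m1 / t \<le> norm (weber_f (1 - 1 / z))" and upper: "norm (weber_f (1 - 1 / z)) \<le> M1 / t"
        using mM1(3)[OF z] unfolding t_inv by simp_all
      have F_le: "norm (F (1 - 1 / z)) \<le> R / t ^ 24"
        unfolding F_def norm_power R_def power_divide[symmetric] using upper by (intro power_mono) auto
      have "R / t ^ 24 \<le> R / 1"
        using t mM1(2) by (intro divide_left_mono) (auto simp: R_def)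
      hence pF: "norm (poly p (F (1 - 1 / z))) \<le> Bp" using F_le by (intro Bp) simp
      have "B \<ge> 0" using cusp[OF z] norm_ge_zero order_trans by blast
      have G1_le: "norm (G1 (1 - 1 / z)) \<le> B / min 1 m1 ^ r * t ^ 23"
      proof -
        have pos: "min 1 m1 / t > 0" using t mM1(1) by auto
        have le: "(min 1 m1 / t) ^ r \<le> norm (weber_f (1 - 1 / z)) ^ r"
          using lower pos t mM1(1) by (intro power_mono) (auto simp: divide_right_mono intro: order_trans[rotated])
        have "norm (G1 (1 - 1 / z)) = norm (G (1 - 1 / z)) / norm (weber_f (1 - 1 / z)) ^ r"
          by (simp add: G1_def norm_divide norm_power)
        also have "\<dots> \<le> B / (min 1 m1 / t) ^ r"
          using pos by (intro frac_le[OF \<open>B \<ge> 0\<close> cusp[OF z] _ le]) auto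
        also have "\<dots> = B / min 1 m1 ^ r * t ^ r" by (simp add: power_divide)
        also have "\<dots> \<le> B / min 1 m1 ^ r * t ^ 23"
          using t r(1) \<open>B \<ge> 0\<close> mM1(1) by (intro mult_left_mono power_increasing) auto
        finally show ?thesis .
      qed
      have "norm (H (1 - 1 / z)) \<le> B / min 1 m1 ^ r * t ^ 23 + Bp * 1"
        unfolding H_def using norm_triangle_ineq4[of "G1 (1 - 1 / z)" "poly p (F (1 - 1 / z))"] G1_le pF by linarith
      also have "\<dots> \<le> B / min 1 m1 ^ r * t ^ 23 + Bp * t ^ 23"
        using Bp(1) t by (intro add_left_mono mult_left_mono) auto
      finally have H_le: "norm (H (1 - 1 / z)) \<le> A * t ^ 23" by (simp add: A_def algebra_simps)
      have "norm (K (1 - 1 / z)) = norm (H (1 - 1 / z)) ^ 48 * norm (F (1 - 1 / z)) ^ 47"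
        by (simp only: K_def norm_mult norm_power)
      also have "\<dots> \<le> (A * t ^ 23) ^ 48 * (R / t ^ 24) ^ 47"
        using H_le F_le by (intro mult_mono power_mono) (auto intro: order_trans[OF norm_ge_zero] zero_le_power)
      also have "\<dots> = A ^ 48 * R ^ 47 * (t ^ 1104 / t ^ 1128)"
        unfolding power_mult_distrib power_divide power_mult[symmetric] by (simp del: power_Suc)
      also have "t ^ 1104 / t ^ 1128 = 1 / t ^ 24"
        using t power_add[of t 1104 24] by (simp add: field_simps)
      also have "\<dots> = exp (- (2 * pi) * Im z)"
      proof -
        have "t ^ 24 = exp (2 * pi * Im z)" unfolding t_def exp_of_nat_mult[symmetric] by simp
        thus ?thesis by (simp add: exp_minus field_simps)
      qed
      finally show ?thesis .
    qed
    show "\<exists>Y. \<forall>z. Im z \<ge> Y \<longrightarrow> norm (K (1 - 1 / z)) < \<epsilon>"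
      by (rule exp_decay_imp_small[of "2 * pi", OF _ decay1 \<epsilon>]) simp
  qed
  have G_eq: "G \<tau> = poly (monom 1 r * pcompose p (monom 1 24)) (weber_f \<tau>)" if "Im \<tau> > 0" for \<tau>
  proof -
    have "H \<tau> = 0" using K0[OF that] F_nz[OF that] by (simp add: K_def)
    hence "G \<tau> = weber_f \<tau> ^ r * poly p (F \<tau>)"
      using weber_f_nonzero[OF that] by (simp add: H_def G1_def field_simps)
    thus ?thesis by (simp add: poly_pcompose poly_monom F_def)
  qed
  show ?thesis
  proof (rule that[OF _ G_eq])
    have "degree (monom 1 r * pcompose p (monom (1::complex) 24)) \<le> degree (monom (1::complex) r) + degree (pcompose p (monom 1 24))"
      by (rule degree_mult_le)
    also have "\<dots> \<le> 24 + D * 24"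
      using r(1) p(1) by (simp add: degree_monom_eq degree_pcompose)
    finally show "degree (monom 1 r * pcompose p (monom (1::complex) 24)) \<le> 24 + 24 * D" by simp
  qed
qed

section \<open>Conjugates and rows modulo \<open>N\<close>\<close>

text \<open>
  The value \<open>0\<close> outside the half-plane makes equality of functions mean equality on the half-plane, so
  that the set of conjugates lists each of them once.
\<close>

definition conj_fun :: "nat \<Rightarrow> int \<Rightarrow> int \<Rightarrow> int \<Rightarrow> int \<Rightarrow> complex \<Rightarrow> complex" where
  "conj_fun N a b c d = (\<lambda>\<tau>. if Im \<tau> > 0 then weber_f (of_nat N * mob a b c d \<tau>) else 0)"

definition conjugates :: "nat \<Rightarrow> (complex \<Rightarrow> complex) set" where
  "conjugates N = {conj_fun N a b c d | a b c d. weber_group a b c d}"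

lemma conjugatesE:
  assumes "g \<in> conjugates N"
  obtains a b c d where "weber_group a b c d" "theta a b c d" "g = conj_fun N a b c d"
  using assms by (auto simp: conjugates_def weber_group_def)

lemma conj_fun_holomorphic:
  assumes "theta a b c d" "N > 0"
  shows "conj_fun N a b c d holomorphic_on upper_half_plane"
proof -
  have nz: "c \<noteq> 0 \<or> d \<noteq> 0" using assms by (auto simp: theta_def)
  have "(weber_f \<circ> (\<lambda>\<tau>. of_nat N * mob a b c d \<tau>)) holomorphic_on upper_half_plane"
  proof (rule holomorphic_on_compose_gen[OF _ holomorphic_weber_f])
    show "(\<lambda>\<tau>. of_nat N * mob a b c d \<tau>) holomorphic_on upper_half_plane"
      unfolding mob_def using linear_nonzero[OF _ nz]
      by (intro holomorphic_intros) (auto simp: upper_half_plane_def)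
    show "(\<lambda>\<tau>. of_nat N * mob a b c d \<tau>) ` upper_half_plane \<subseteq> upper_half_plane"
      using Im_mob_theta(2)[OF _ assms(1)] assms(2) by (auto simp: upper_half_plane_def)
  qed
  thus ?thesis
    by (rule holomorphic_transform) (auto simp: conj_fun_def upper_half_plane_def)
qed

lemma conjugates_holomorphic:
  assumes "g \<in> conjugates N" "N > 0"
  shows "g holomorphic_on upper_half_plane"
  using conjugatesE[OF assms(1)] conj_fun_holomorphic[OF _ assms(2)] by metis

lemma conjugates_off: "g \<in> conjugates N \<Longrightarrow> \<not> Im \<tau> > 0 \<Longrightarrow> g \<tau> = 0"
  by (auto simp: conjugates_def conj_fun_def)

text \<open>
  Up to roots of unity a conjugate is determined by the bottom row modulo \<open>N\<close>, as a point of the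
  projective line: proportional rows give proportional functions (\<open>has_row_equiv\<close>), and rows of the same
  function are proportional (\<open>has_row_unique\<close>).
\<close>

definition has_row :: "nat \<Rightarrow> (complex \<Rightarrow> complex) \<Rightarrow> int \<Rightarrow> int \<Rightarrow> bool" where
  "has_row N g x y \<longleftrightarrow> (\<exists>a b c d. weber_group a b c d \<and> [c = x] (mod int N) \<and> [d = y] (mod int N) \<and>
     g = conj_fun N a b c d)"

lemma cross_cong:
  assumes "[c = x] (mod m)" "[d = y] (mod m)" "[c' = x'] (mod m)" "[d' = y'] (mod (m::int))"
  shows "m dvd c * d' - d * c' \<longleftrightarrow> m dvd x * y' - y * x'"
proof -
  have "[c * d' - d * c' = x * y' - y * x'] (mod m)"
    by (intro cong_diff cong_mult assms)
  thus ?thesis by (rule cong_dvd_iff)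
qed

lemma has_row_equiv:
  assumes "has_row N g x y" "has_row N g' x' y'" "odd N" "int N dvd x * y' - y * x'"
  obtains k where "g = (\<lambda>\<tau>. zeta24 k * g' \<tau>)"
proof -
  obtain a b c d where 1: "weber_group a b c d" "[c = x] (mod int N)" "[d = y] (mod int N)" "g = conj_fun N a b c d"
    using assms(1) by (auto simp: has_row_def)
  obtain a' b' c' d' where 2: "weber_group a' b' c' d'" "[c' = x'] (mod int N)" "[d' = y'] (mod int N)" "g' = conj_fun N a' b' c' d'"
    using assms(2) by (auto simp: has_row_def)
  have "int N dvd c * d' - d * c'" using cross_cong[OF 1(2,3) 2(2,3)] assms(4) by simp
  moreover have "theta a b c d" "theta a' b' c' d'" using 1 2 by (auto simp: weber_group_def)
  ultimately obtain k where "\<And>\<tau>. Im \<tau> > 0 \<Longrightarrow>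
     weber_f (of_nat N * mob a b c d \<tau>) = zeta24 k * weber_f (of_nat N * mob a' b' c' d' \<tau>)"
    using level_equiv_theta[of a b c d a' b' c' d' N] assms(3) by metis
  hence "g = (\<lambda>\<tau>. zeta24 k * g' \<tau>)" unfolding 1(4) 2(4) by (auto simp: conj_fun_def fun_eq_iff)
  thus ?thesis by (rule that)
qed

lemma has_row_unique:
  assumes "has_row N g x y" "has_row N g x' y'" "odd N"
  shows "int N dvd x * y' - y * x'"
proof -
  obtain a b c d where 1: "weber_group a b c d" "[c = x] (mod int N)" "[d = y] (mod int N)" "g = conj_fun N a b c d"
    using assms(1) by (auto simp: has_row_def)
  obtain a' b' c' d' where 2: "weber_group a' b' c' d'" "[c' = x'] (mod int N)" "[d' = y'] (mod int N)" "g = conj_fun N a' b' c' d'"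
    using assms(2) by (auto simp: has_row_def)
  have th: "theta a b c d" "theta a' b' c' d'" using 1 2 by (auto simp: weber_group_def)
  have "weber_f (of_nat N * mob a b c d \<tau>) = weber_f (of_nat N * mob a' b' c' d' \<tau>)" if "Im \<tau> > 0" for \<tau>
    using fun_cong[OF trans[OF 1(4)[symmetric] 2(4)], of \<tau>] that by (simp add: conj_fun_def)
  hence "int N dvd c * d' - d * c'" using level_equiv_converse[OF th assms(3)] by simp
  thus ?thesis using cross_cong[OF 1(2,3) 2(2,3)] by simp
qed

lemma has_row_conjugates: "has_row N g x y \<Longrightarrow> g \<in> conjugates N"
  by (auto simp: has_row_def conjugates_def)

definition prim_rows :: "nat \<Rightarrow> (int \<times> int) set" where
  "prim_rows N = {(x, y) \<in> {0..<int N} \<times> {0..<int N}. gcd (gcd x y) (int N) = 1}"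

lemma finite_prim_rows: "finite (prim_rows N)"
  by (rule finite_subset[of _ "{0..<int N} \<times> {0..<int N}"]) (auto simp: prim_rows_def)

lemma conjugates_has_row:
  assumes "g \<in> conjugates N" "N > 0"
  obtains v where "v \<in> prim_rows N" "has_row N g (fst v) (snd v)"
proof -
  obtain a b c d where g: "weber_group a b c d" "theta a b c d" "g = conj_fun N a b c d"
    using conjugatesE[OF assms(1)] by blast
  define v where "v = (c mod int N, d mod int N)"
  have "gcd (gcd (c mod int N) (d mod int N)) (int N) = gcd (gcd c d) (int N)"
    by (metis gcd.assoc gcd.commute gcd_red_int)
  also have "\<dots> = 1" using theta_coprime(1)[OF g(2)] by (simp add: coprime_iff_gcd_eq_1)
  finally have "v \<in> prim_rows N" using assms(2) by (simp add: prim_rows_def v_def)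
  moreover have "has_row N g (fst v) (snd v)"
    unfolding has_row_def v_def using g by (intro exI[of _ a] exI[of _ b] exI[of _ c] exI[of _ d]) (simp add: cong_def)
  ultimately show ?thesis by (rule that)
qed

text \<open>
  A row modulo \<open>N\<close> lifts to a coprime one of odd sum: make \<open>c\<close> even and add the multiple \<open>t N\<close> to \<open>y\<close>, where
  \<open>t\<close> is the product of the primes dividing \<open>c\<close> but not \<open>y\<close>.
\<close>

lemma lift_row:
  assumes "gcd (gcd x y) (int N) = 1" "odd N"
  obtains c d where "coprime c d" "odd (c + d)" "[c = x] (mod int N)" "[d = y] (mod int N)"
proof -
  have N: "N > 0" using \<open>odd N\<close> by (auto intro: Nat.gr0I)
  define c where "c = (if even (x mod int N) then x mod int N + 2 * int N else x mod int N + int N)"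
  have c: "even c" "c > 0" "[c = x] (mod int N)"
    using assms(2) N by (auto simp: c_def cong_def intro: add_nonneg_pos)
  define t where "t = \<Prod>{p \<in> prime_factors c. \<not> p dvd y}"
  define d where "d = y + t * int N"
  have "coprime c d"
  proof (rule ccontr)
    assume "\<not> coprime c d"
    hence "\<not> is_unit (gcd c d)" by (simp add: coprime_iff_gcd_eq_1 is_unit_gcd)
    moreover have "gcd c d \<noteq> 0" using c by simp
    ultimately obtain p where p: "prime p" "p dvd gcd c d"
      using prime_divisor_exists by blast
    hence pc: "p dvd c" "p dvd d" by auto
    have pf: "p \<in> prime_factors c" using p pc c by (simp add: prime_factors_dvd)
    show False
    proof (cases "p dvd y")
      case True
      hence "p dvd t * int N" using pc(2) by (simp add: d_def dvd_add_right_iff)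
      hence "p dvd t \<or> p dvd int N" using p(1) by (simp add: prime_dvd_mult_iff)
      moreover have "\<not> p dvd int N"
      proof
        assume "p dvd int N"
        hence "p dvd x" using pc(1) cong_dvd_iff[OF cong_dvd_modulus[OF c(3)]] by blast
        hence "p dvd gcd (gcd x y) (int N)" using True \<open>p dvd int N\<close> by simp
        thus False using assms(1) p(1) not_prime_unit[of p] by simp
      qed
      moreover have "\<not> p dvd t"
      proof
        assume "p dvd t"
        then obtain q where q: "q \<in> prime_factors c" "\<not> q dvd y" "p dvd q"
          unfolding t_def using prime_dvd_prod_iff[of "{p \<in> prime_factors c. \<not> p dvd y}" p "\<lambda>x. x"] p(1) by auto
        hence "p = q" using p(1) by (metis in_prime_factors_imp_prime primes_dvd_imp_eq)
        thus False using q True by simp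
      qed
      ultimately show False by blast
    next
      case False
      hence "p dvd t" unfolding t_def using pf by (intro dvd_prodI) auto
      hence "p dvd y" using pc(2) by (simp add: d_def dvd_add_left_iff)
      thus False using False by simp
    qed
  qed
  moreover have "odd (c + d)" using \<open>coprime c d\<close> c(1) by (metis coprime_common_divisor even_add odd_one)
  moreover have "[d = y] (mod int N)" by (simp add: d_def cong_def)
  ultimately show ?thesis using that c(3) by blast
qed

lemma prim_rows_has_row:
  assumes "v \<in> prim_rows N" "odd N"
  obtains g where "g \<in> conjugates N" "has_row N g (fst v) (snd v)"
proof -
  obtain x y where v: "v = (x, y)" by (cases v)
  hence "gcd (gcd x y) (int N) = 1" using assms(1) by (auto simp: prim_rows_def)
  then obtain c d where cd: "coprime c d" "odd (c + d)" "[c = x] (mod int N)" "[d = y] (mod int N)"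
    using lift_row[OF _ assms(2)] by metis
  obtain a b where "theta a b c d" using theta_bottom_row[OF cd(1,2)] .
  then obtain n where "weber_group (a + 2 * n * c) (b + 2 * n * d) c d"
    using theta_shift_weber_group by blast
  hence "has_row N (conj_fun N (a + 2 * n * c) (b + 2 * n * d) c d) x y"
    using cd unfolding has_row_def by blast
  thus ?thesis using that has_row_conjugates v by auto
qed

lemma finite_conjugates_of_row:
  assumes "odd N"
  shows "finite {g. \<exists>g' x' y'. has_row N g x' y' \<and> has_row N g' x y \<and> int N dvd x' * y - y' * x}" (is "finite ?A")
    and "card {g. \<exists>g' x' y'. has_row N g x' y' \<and> has_row N g' x y \<and> int N dvd x' * y - y' * x} \<le> 24"
proof -
  have "\<exists>g0. ?A \<subseteq> (\<lambda>z \<tau>. z * g0 \<tau>) ` range zeta24"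
  proof (cases "?A = {}")
    case False
    then obtain g0 where g0: "has_row N g0 x y" by blast
    have "?A \<subseteq> (\<lambda>z \<tau>. z * g0 \<tau>) ` range zeta24"
    proof
      fix g assume "g \<in> ?A"
      then obtain x' y' where "has_row N g x' y'" "int N dvd x' * y - y' * x" by blast
      then obtain k where "g = (\<lambda>\<tau>. zeta24 k * g0 \<tau>)" using has_row_equiv g0 assms by metis
      thus "g \<in> (\<lambda>z \<tau>. z * g0 \<tau>) ` range zeta24" by blast
    qed
    thus ?thesis by blast
  qed auto
  then obtain g0 where g0: "?A \<subseteq> (\<lambda>z \<tau>. z * g0 \<tau>) ` range zeta24" by blast
  show "finite ?A" by (rule finite_subset[OF g0]) (use finite_range_zeta24 in auto)
  have "card ?A \<le> card ((\<lambda>z \<tau>. z * g0 \<tau>) ` range zeta24)"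
    by (rule card_mono[OF _ g0]) (use finite_range_zeta24 in auto)
  also have "\<dots> \<le> card (range zeta24)" by (rule card_image_le) (rule finite_range_zeta24)
  finally show "card ?A \<le> 24" using finite_range_zeta24(2) by linarith
qed

lemma finite_conjugates:
  assumes "odd N"
  shows "finite (conjugates N)"
proof (rule finite_subset)
  have N: "N > 0" using \<open>odd N\<close> by (auto intro: Nat.gr0I)
  show "conjugates N \<subseteq> (\<Union>v\<in>prim_rows N. {g. \<exists>g' x' y'. has_row N g x' y' \<and> has_row N g' (fst v) (snd v) \<and>
        int N dvd x' * snd v - y' * fst v})"
  proof
    fix g assume "g \<in> conjugates N"
    from conjugates_has_row[OF this N] obtain v where "v \<in> prim_rows N" "has_row N g (fst v) (snd v)" .
    thus "g \<in> (\<Union>v\<in>prim_rows N. {g. \<exists>g' x' y'. has_row N g x' y' \<and> has_row N g' (fst v) (snd v) \<and>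
        int N dvd x' * snd v - y' * fst v})"
      by (intro UN_I[of v] CollectI exI[of _ g] exI[of _ "fst v"] exI[of _ "snd v"]) auto
  qed
qed (use finite_prim_rows finite_conjugates_of_row(1)[OF assms] in auto)

lemma card_coprime_residues:
  assumes N: "N > 0"
  shows "card {k \<in> {0..<int N}. coprime k (int N)} = totient N"
proof -
  have "{k \<in> {0..<int N}. coprime k (int N)} = int ` {k \<in> {0..<N}. coprime k N}"
  proof safe
    fix k assume "k \<in> {0..<int N}" "coprime k (int N)"
    thus "k \<in> int ` {k \<in> {0..<N}. coprime k N}"
      by (intro image_eqI[of _ _ "nat k"]) (auto simp: nat_less_iff simp flip: coprime_int_iff)
  qed auto
  hence "card {k \<in> {0..<int N}. coprime k (int N)} = card {k \<in> {0..<N}. coprime k N}" by (simp add: card_image)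
  also have "\<dots> = totient N"
  proof (cases "N = 1")
    case True
    hence "{k \<in> {0..<N}. coprime k N} = {0}" by auto
    thus ?thesis using True by simp
  next
    case False
    have "{k \<in> {0..<N}. coprime k N} = totatives N"
      using False N by (auto simp: totatives_def intro!: Nat.gr0I le_neq_trans)
    thus ?thesis by (simp add: totient_def)
  qed
  finally show ?thesis .
qed

text \<open>
  The rows proportional to \<open>(x, y)\<close> are its multiples by units: if \<open>p x + q y\<close> is \<open>1\<close> modulo \<open>N\<close>, then the
  multiplier that gives \<open>(x', y')\<close> is \<open>p x' + q y'\<close>.
\<close>

lemma card_row_class:
  assumes v: "(x, y) \<in> prim_rows N" and N: "N > 0"
  shows "card {(x', y') \<in> prim_rows N. int N dvd x' * y - y' * x} = totient N"
proof -
  have "gcd (gcd x y) (int N) = 1" using v by (simp add: prim_rows_def)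
  moreover obtain s t where "s * x + t * y = gcd x y" using bezout_int by blast
  moreover obtain u w where "u * gcd x y + w * int N = gcd (gcd x y) (int N)" using bezout_int by blast
  ultimately have bez: "u * (s * x + t * y) + w * int N = 1" by simp
  define p q where "p = u * s" "q = u * t"
  have pq: "[p * x + q * y = 1] (mod int N)"
  proof -
    have "(p * x + q * y) - 1 = int N * (- w)" using bez by (simp add: p_q_def algebra_simps)
    thus ?thesis unfolding cong_iff_dvd_diff by simp
  qed
  define A where "A = {(x', y') \<in> prim_rows N. int N dvd x' * y - y' * x}"
  define B where "B = {k \<in> {0..<int N}. coprime k (int N)}"
  have "bij_betw (\<lambda>k. (k * x mod int N, k * y mod int N)) B A"
  proof (rule bij_betwI[where g = "\<lambda>(x', y'). (p * x' + q * y') mod int N"])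
    show "(\<lambda>k. (k * x mod int N, k * y mod int N)) \<in> B \<rightarrow> A"
    proof
      fix k assume k: "k \<in> B"
      have "gcd (gcd (k * x mod int N) (k * y mod int N)) (int N) = gcd (gcd (k * x) (k * y)) (int N)"
        by (metis gcd.assoc gcd.commute gcd_red_int)
      also have "gcd (k * x) (k * y) = \<bar>k\<bar> * gcd x y" by (simp add: gcd_mult_distrib_int)
      also have "gcd (\<bar>k\<bar> * gcd x y) (int N) = 1"
        using k \<open>gcd (gcd x y) (int N) = 1\<close> by (auto simp: B_def simp flip: coprime_iff_gcd_eq_1)
      finally have "gcd (gcd (k * x mod int N) (k * y mod int N)) (int N) = 1" .
      moreover have "[(k * x mod int N) * y - (k * y mod int N) * x = (k * x) * y - (k * y) * x] (mod int N)"
        by (intro cong_diff cong_mult cong_refl) (auto simp: cong_def)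
      hence "int N dvd (k * x mod int N) * y - (k * y mod int N) * x"
        by (simp add: cong_0_iff[symmetric] mult_ac)
      ultimately show "(k * x mod int N, k * y mod int N) \<in> A"
        using N by (simp add: A_def prim_rows_def)
    qed
    show "(\<lambda>(x', y'). (p * x' + q * y') mod int N) \<in> A \<rightarrow> B"
    proof safe
      fix x' y' assume xy: "(x', y') \<in> A"
      hence cr: "int N dvd x' * y - y' * x" and g1: "gcd (gcd x' y') (int N) = 1"
        by (auto simp: A_def prim_rows_def)
      define k where "k = p * x' + q * y'"
      have "[k * x = x'] (mod int N)" "[k * y = y'] (mod int N)"
      proof -
        have "k * x - x' = x' * (p * x + q * y - 1) - q * (x' * y - y' * x)" by (simp add: k_def algebra_simps)
        thus "[k * x = x'] (mod int N)" unfolding cong_iff_dvd_diff using cr pq unfolding cong_iff_dvd_diff by simp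
        have "k * y - y' = y' * (p * x + q * y - 1) + p * (x' * y - y' * x)" by (simp add: k_def algebra_simps)
        thus "[k * y = y'] (mod int N)" unfolding cong_iff_dvd_diff using cr pq unfolding cong_iff_dvd_diff by simp
      qed
      have "coprime k (int N)"
      proof (rule coprimeI)
        fix e assume e: "e dvd k" "e dvd int N"
        have "e dvd x'" using e \<open>[k * x = x'] (mod int N)\<close> by (metis cong_dvd_iff cong_dvd_modulus dvd_mult2)
        moreover have "e dvd y'" using e \<open>[k * y = y'] (mod int N)\<close> by (metis cong_dvd_iff cong_dvd_modulus dvd_mult2)
        ultimately have "e dvd gcd (gcd x' y') (int N)" using e by simp
        thus "is_unit e" using g1 by simp
      qed
      thus "(p * x' + q * y') mod int N \<in> B" using N by (simp add: B_def k_def)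
    qed
    fix k assume k: "k \<in> B"
    have "[p * (k * x mod int N) + q * (k * y mod int N) = p * (k * x) + q * (k * y)] (mod int N)"
      by (intro cong_add cong_mult cong_refl) (auto simp: cong_def)
    also have "p * (k * x) + q * (k * y) = k * (p * x + q * y)" by (simp add: algebra_simps)
    also have "[k * (p * x + q * y) = k * 1] (mod int N)" by (intro cong_mult cong_refl pq)
    finally have "(p * (k * x mod int N) + q * (k * y mod int N)) mod int N = k mod int N"
      unfolding cong_def mult_1_right .
    also have "\<dots> = k" using k by (simp add: B_def)
    finally show "(case (k * x mod int N, k * y mod int N) of (x', y') \<Rightarrow> (p * x' + q * y') mod int N) = k"
      by (simp only: prod.case)
  next
    fix v assume v: "v \<in> A"
    obtain x' y' where v': "v = (x', y')" by (cases v)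
    hence cr: "int N dvd x' * y - y' * x" and rng: "x' \<in> {0..<int N}" "y' \<in> {0..<int N}"
      using v by (auto simp: A_def prim_rows_def)
    define k where "k = p * x' + q * y'"
    have "k * x - x' = x' * (p * x + q * y - 1) - q * (x' * y - y' * x)" by (simp add: k_def algebra_simps)
    hence "[k * x = x'] (mod int N)" unfolding cong_iff_dvd_diff using cr pq unfolding cong_iff_dvd_diff by simp
    hence "k * x mod int N = x'" using rng unfolding cong_def by simp
    hence 1: "(k mod int N) * x mod int N = x'" by (simp only: mod_mult_left_eq)
    have "k * y - y' = y' * (p * x + q * y - 1) + p * (x' * y - y' * x)" by (simp add: k_def algebra_simps)
    hence "[k * y = y'] (mod int N)" unfolding cong_iff_dvd_diff using cr pq unfolding cong_iff_dvd_diff by simp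
    hence "k * y mod int N = y'" using rng unfolding cong_def by simp
    hence 2: "(k mod int N) * y mod int N = y'" by (simp only: mod_mult_left_eq)
    show "((case v of (x', y') \<Rightarrow> (p * x' + q * y') mod int N) * x mod int N,
           (case v of (x', y') \<Rightarrow> (p * x' + q * y') mod int N) * y mod int N) = v"
      unfolding v' prod.case k_def[symmetric] 1 2 ..
  qed
  hence "card A = card B" by (rule bij_betw_same_card[symmetric])
  also have "card B = totient N" unfolding B_def by (rule card_coprime_residues[OF N])
  finally show ?thesis by (simp add: A_def)
qed

text \<open>
  Double counting of the pairs of a conjugate and a row proportional to one of its rows.
\<close>

lemma card_conjugates_le:
  assumes "odd N"
  shows "card (conjugates N) * totient N \<le> 24 * card (prim_rows N)"
proof -
  have N: "N > 0" using \<open>odd N\<close> by (auto intro: Nat.gr0I)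
  have "\<forall>g\<in>conjugates N. \<exists>v. v \<in> prim_rows N \<and> has_row N g (fst v) (snd v)"
    using conjugates_has_row[OF _ N] by metis
  then obtain R where R: "\<And>g. g \<in> conjugates N \<Longrightarrow> R g \<in> prim_rows N \<and> has_row N g (fst (R g)) (snd (R g))"
    by metis
  define E where "E = {(g, v). g \<in> conjugates N \<and> v \<in> prim_rows N \<and> int N dvd fst v * snd (R g) - snd v * fst (R g)}"
  have fin: "finite (conjugates N)" by (rule finite_conjugates[OF assms])
  have "card E = (\<Sum>g\<in>conjugates N. card {v \<in> prim_rows N. int N dvd fst v * snd (R g) - snd v * fst (R g)})"
  proof -
    have "E = (SIGMA g:conjugates N. {v \<in> prim_rows N. int N dvd fst v * snd (R g) - snd v * fst (R g)})"
      by (auto simp: E_def)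
    thus ?thesis using fin finite_prim_rows by (simp add: card_SigmaI)
  qed
  also have "\<dots> = (\<Sum>g\<in>conjugates N. totient N)"
  proof (rule sum.cong[OF refl])
    fix g assume "g \<in> conjugates N"
    thus "card {v \<in> prim_rows N. int N dvd fst v * snd (R g) - snd v * fst (R g)} = totient N"
      using card_row_class[of "fst (R g)" "snd (R g)" N] R N by (simp add: case_prod_unfold)
  qed
  finally have 1: "card E = card (conjugates N) * totient N" by simp
  have "card E \<le> (\<Sum>v\<in>prim_rows N. 24)"
  proof -
    define F where "F = (\<lambda>v. {g \<in> conjugates N. int N dvd fst v * snd (R g) - snd v * fst (R g)})"
    have "E = prod.swap ` (SIGMA v:prim_rows N. F v)" by (auto simp: E_def F_def)
    hence "card E = card (SIGMA v:prim_rows N. F v)" by (simp add: card_image)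
    also have "\<dots> = (\<Sum>v\<in>prim_rows N. card (F v))"
      using fin finite_prim_rows by (simp add: card_SigmaI F_def)
    also have "\<dots> \<le> (\<Sum>v\<in>prim_rows N. 24)"
    proof (rule sum_mono)
      fix v assume "v \<in> prim_rows N"
      then obtain g' where "has_row N g' (fst v) (snd v)" using prim_rows_has_row assms by metis
      have "F v \<subseteq> {g. \<exists>g' x' y'. has_row N g x' y' \<and> has_row N g' (fst v) (snd v) \<and> int N dvd x' * snd v - y' * fst v}"
      proof
        fix g assume g: "g \<in> F v"
        hence "int N dvd - (fst v * snd (R g) - snd v * fst (R g))" unfolding dvd_minus_iff by (simp add: F_def)
        hence "int N dvd fst (R g) * snd v - snd (R g) * fst v" by (simp add: mult.commute)
        thus "g \<in> {g. \<exists>g' x' y'. has_row N g x' y' \<and> has_row N g' (fst v) (snd v) \<and> int N dvd x' * snd v - y' * fst v}"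
          using R[of g] g \<open>has_row N g' (fst v) (snd v)\<close> by (auto simp: F_def)
      qed
      from card_mono[OF finite_conjugates_of_row(1)[OF assms] this] finite_conjugates_of_row(2)[OF assms, of "fst v" "snd v"]
      show "card (F v) \<le> 24" by linarith
    qed
    finally show ?thesis .
  qed
  thus ?thesis using 1 by simp
qed

text \<open>
  Select a conjugate for each row; the rows that select the same one are proportional.
\<close>

lemma sum_conjugates_ge:
  fixes L :: "(complex \<Rightarrow> complex) \<Rightarrow> real"
  assumes "odd N" "\<And>g. L g \<ge> 0"
    and l: "\<And>v g. v \<in> prim_rows N \<Longrightarrow> has_row N g (fst v) (snd v) \<Longrightarrow> l v \<le> L g"
  shows "(\<Sum>v\<in>prim_rows N. l v) \<le> totient N * (\<Sum>g\<in>conjugates N. L g)"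
proof -
  have N: "N > 0" using \<open>odd N\<close> by (auto intro: Nat.gr0I)
  have "\<forall>v\<in>prim_rows N. \<exists>g. g \<in> conjugates N \<and> has_row N g (fst v) (snd v)"
    using prim_rows_has_row[OF _ assms(1)] by metis
  then obtain G where G: "\<And>v. v \<in> prim_rows N \<Longrightarrow> G v \<in> conjugates N \<and> has_row N (G v) (fst v) (snd v)"
    by metis
  have fin: "finite (conjugates N)" by (rule finite_conjugates[OF assms(1)])
  have "(\<Sum>v\<in>prim_rows N. l v) \<le> (\<Sum>v\<in>prim_rows N. L (G v))"
    by (intro sum_mono l) (use G in auto)
  also have "\<dots> = (\<Sum>g\<in>conjugates N. \<Sum>v\<in>{v \<in> prim_rows N. G v = g}. L (G v))"
    by (rule sum.group[OF finite_prim_rows fin, symmetric]) (use G in auto)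
  also have "\<dots> = (\<Sum>g\<in>conjugates N. card {v \<in> prim_rows N. G v = g} * L g)"
    by (intro sum.cong refl) simp
  also have "\<dots> \<le> (\<Sum>g\<in>conjugates N. totient N * L g)"
  proof (intro sum_mono mult_right_mono assms(2))
    fix g assume "g \<in> conjugates N"
    show "real (card {v \<in> prim_rows N. G v = g}) \<le> real (totient N)"
    proof (cases "{v \<in> prim_rows N. G v = g} = {}")
      case False
      then obtain w where w: "w \<in> prim_rows N" "G w = g" by blast
      have "{v \<in> prim_rows N. G v = g} \<subseteq> {(x', y') \<in> prim_rows N. int N dvd x' * snd w - y' * fst w}"
      proof safe
        fix x' y' assume v: "(x', y') \<in> prim_rows N" "g = G (x', y')"
        have "has_row N g x' y'" "has_row N g (fst w) (snd w)"
          using G[OF v(1)] G[OF w(1)] v(2) w(2) by simp_all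
        thus "int N dvd x' * snd w - y' * fst w" by (rule has_row_unique[OF _ _ assms(1)])
      qed
      hence "card {v \<in> prim_rows N. G v = g} \<le> card {(x', y') \<in> prim_rows N. int N dvd x' * snd w - y' * fst w}"
        by (rule card_mono[rotated]) (rule finite_subset[OF _ finite_prim_rows], blast)
      thus ?thesis using card_row_class[of "fst w" "snd w" N] w N by simp
    qed (simp only: card.empty of_nat_0 of_nat_0_le_iff)
  qed
  finally show ?thesis by (simp add: sum_distrib_left)
qed

section \<open>The modular polynomial as a product over conjugates\<close>

definition conj_poly :: "nat \<Rightarrow> complex \<Rightarrow> complex poly" where
  "conj_poly N \<tau> = (\<Prod>g\<in>conjugates N. [:- g \<tau>, 1:])"

lemma monic_prod_linear:
  fixes x :: "'b \<Rightarrow> complex"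
  assumes "finite A"
  shows "degree (\<Prod>g\<in>A. [:- x g, 1:]) = card A" "coeff (\<Prod>g\<in>A. [:- x g, 1:]) (card A) = 1"
proof -
  have "degree (\<Prod>g\<in>A. [:- x g, 1:]) = card A \<and> coeff (\<Prod>g\<in>A. [:- x g, 1:]) (card A) = 1"
    using assms
  proof (induction A rule: finite_induct)
    case (insert a A)
    define q where "q = (\<Prod>g\<in>A. [:- x g, 1:])"
    have q: "degree q = card A" "coeff q (card A) = 1" using insert.IH by (simp_all add: q_def)
    hence "q \<noteq> 0" by auto
    have eq: "(\<Prod>g\<in>insert a A. [:- x g, 1:]) = [:- x a, 1:] * q"
      using insert.hyps by (simp add: q_def)
    have deg: "degree ([:- x a, 1:] * q) = Suc (card A)"
      using \<open>q \<noteq> 0\<close> q(1) by (subst degree_mult_eq) auto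
    have "lead_coeff ([:- x a, 1:] * q) = 1"
      using q by (simp only: lead_coeff_mult) simp
    thus ?case unfolding eq using deg insert.hyps by simp
  qed auto
  thus "degree (\<Prod>g\<in>A. [:- x g, 1:]) = card A" "coeff (\<Prod>g\<in>A. [:- x g, 1:]) (card A) = 1" by auto
qed

lemma coeff_prod_linear_scale:
  fixes x :: "'b \<Rightarrow> complex"
  assumes "finite A" "i \<le> card A"
  shows "coeff (\<Prod>g\<in>A. [:- (c * x g), 1:]) i = c ^ (card A - i) * coeff (\<Prod>g\<in>A. [:- x g, 1:]) i"
  using assms
proof (induction A arbitrary: i rule: finite_induct)
  case (insert a A)
  have eq: "(\<Prod>g\<in>insert a A. [:- y g, 1:]) = smult (- y a) (\<Prod>g\<in>A. [:- y g, 1:]) + pCons 0 (\<Prod>g\<in>A. [:- y g, 1:])" for y :: "'b \<Rightarrow> complex"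
    using insert.hyps by simp
  show ?case
  proof (cases "i = Suc (card A)")
    case True
    have "coeff (\<Prod>g\<in>insert a A. [:- y g, 1:]) i = 1" for y :: "'b \<Rightarrow> complex"
      using monic_prod_linear(2)[of "insert a A" y] insert.hyps True by simp
    from this[of "\<lambda>g. c * x g"] this[of x] show ?thesis using insert.hyps True by simp
  next
    case False
    hence i: "i \<le> card A" using insert.prems insert.hyps by simp
    show ?thesis
    proof (cases i)
      case 0
      thus ?thesis unfolding eq using insert.IH[OF i] insert.hyps by simp
    next
      case (Suc j)
      hence "card A - j = Suc (card A - i)" using i by simp
      thus ?thesis unfolding eq using insert.IH[OF i] insert.IH[of j] insert.hyps Suc i
        by (simp add: algebra_simps Suc_diff_le)
    qed
  qed
qed auto

lemma coeff_prod_linear_bound: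
  fixes x :: "'b \<Rightarrow> complex"
  assumes "finite A" "\<And>g. g \<in> A \<Longrightarrow> norm (x g) \<le> B"  "B \<ge> 0"
  shows "norm (coeff (\<Prod>g\<in>A. [:- x g, 1:]) i) \<le> (1 + B) ^ card A"
  using assms(1,2)
proof (induction A arbitrary: i rule: finite_induct)
  case (insert a A)
  define q where "q = (\<Prod>g\<in>A. [:- x g, 1:])"
  have eq: "(\<Prod>g\<in>insert a A. [:- x g, 1:]) = smult (- x a) q + pCons 0 q"
    using insert.hyps by (simp add: q_def)
  have IH: "norm (coeff q j) \<le> (1 + B) ^ card A" for j
    using insert.IH insert.prems by (simp add: q_def)
  have "norm (coeff (smult (- x a) q + pCons 0 q) i) \<le> norm (x a) * norm (coeff q i) + norm (coeff (pCons 0 q) i)"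
    using norm_triangle_ineq[of "coeff (smult (- x a) q) i" "coeff (pCons 0 q) i"] by (simp add: norm_mult)
  also have "\<dots> \<le> B * (1 + B) ^ card A + (1 + B) ^ card A"
  proof (intro add_mono mult_mono IH)
    show "norm (coeff (pCons 0 q) i) \<le> (1 + B) ^ card A"
      using IH assms(3) by (cases i) auto
  qed (use insert.prems assms(3) in auto)
  also have "\<dots> = (1 + B) ^ card (insert a A)" using insert.hyps by (simp add: algebra_simps)
  finally show ?case unfolding eq .
qed auto

lemma coeff_prod_linear_holomorphic:
  assumes "finite A" "\<And>g. g \<in> A \<Longrightarrow> g holomorphic_on S"
  shows "(\<lambda>\<tau>. coeff (\<Prod>g\<in>A. [:- g \<tau>, 1:]) i) holomorphic_on S"
  using assms
proof (induction A arbitrary: i rule: finite_induct)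
  case (insert a A)
  have eq: "(\<Prod>g\<in>insert a A. [:- g \<tau>, 1:]) = smult (- a \<tau>) (\<Prod>g\<in>A. [:- g \<tau>, 1:]) + pCons 0 (\<Prod>g\<in>A. [:- g \<tau>, 1:])" for \<tau>
    using insert.hyps by simp
  have h: "a holomorphic_on S" "\<And>i. (\<lambda>\<tau>. coeff (\<Prod>g\<in>A. [:- g \<tau>, 1:]) i) holomorphic_on S"
    using insert by auto
  show ?case unfolding eq by (cases i) (auto intro!: holomorphic_intros h)
qed auto

lemma conjugates_compose:
  assumes "weber_group a b c d" "g \<in> conjugates N"
  shows "(\<lambda>\<tau>. if Im \<tau> > 0 then g (mob a b c d \<tau>) else 0) \<in> conjugates N"
proof -
  obtain a' b' c' d' where g: "weber_group a' b' c' d'" "g = conj_fun N a' b' c' d'"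
    using conjugatesE[OF assms(2)] by metis
  have th: "theta a b c d" using assms by (simp add: weber_group_def)
  hence nz: "c \<noteq> 0 \<or> d \<noteq> 0" by (auto simp: theta_def)
  have "(\<lambda>\<tau>. if Im \<tau> > 0 then g (mob a b c d \<tau>) else 0) =
        conj_fun N (a' * a + b' * c) (a' * b + b' * d) (c' * a + d' * c) (c' * b + d' * d)"
    using Im_mob_theta(2)[OF _ th] mob_mob[OF _ nz] by (auto simp: g(2) conj_fun_def fun_eq_iff)
  thus ?thesis using weber_group_mult[OF g(1) assms(1)] by (auto simp: conjugates_def)
qed

lemma prod_linear_reindex:
  assumes fin: "finite A" and inj: "inj_on \<Phi> A" and im: "\<Phi> ` A \<subseteq> A"
    and eq: "\<And>g. g \<in> A \<Longrightarrow> x g = y (\<Phi> g)"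
  shows "(\<Prod>g\<in>A. [:- x g, 1:]) = (\<Prod>g\<in>A. [:- y g, 1 :: complex:])"
proof -
  have "\<Phi> ` A = A" using fin inj im by (simp add: endo_inj_surj)
  have "(\<Prod>g\<in>A. [:- x g, 1:]) = (\<Prod>g\<in>A. [:- y (\<Phi> g), 1:])" using eq by simp
  also have "\<dots> = (\<Prod>g\<in>\<Phi> ` A. [:- y g, 1:])" using inj by (simp add: prod.reindex)
  finally show ?thesis using \<open>\<Phi> ` A = A\<close> by simp
qed

lemma conj_poly_neg_inverse:
  assumes "odd N" "Im \<tau> > 0"
  shows "conj_poly N (-1 / \<tau>) = conj_poly N \<tau>"
proof -
  have S: "weber_group 0 (-1) 1 0"
    using weber_f_neg_inverse by (simp add: weber_group_def theta_def mob_def)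
  define \<Phi> where "\<Phi> = (\<lambda>g::complex \<Rightarrow> complex. (\<lambda>\<tau>. if Im \<tau> > 0 then g (-1 / \<tau>) else 0))"
  have mobS: "mob 0 (-1) 1 0 w = -1 / w" for w by (simp add: mob_def)
  show ?thesis unfolding conj_poly_def
  proof (rule prod_linear_reindex[of _ \<Phi>])
    show "finite (conjugates N)" by (rule finite_conjugates[OF assms(1)])
    show "\<Phi> ` conjugates N \<subseteq> conjugates N"
      using conjugates_compose[OF S, unfolded mobS] unfolding \<Phi>_def by blast
    show "g (-1 / \<tau>) = \<Phi> g \<tau>" for g using assms(2) by (simp add: \<Phi>_def)
    show "inj_on \<Phi> (conjugates N)"
    proof
      fix g h assume gh: "g \<in> conjugates N" "h \<in> conjugates N" "\<Phi> g = \<Phi> h"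
      show "g = h"
      proof
        fix w show "g w = h w"
        proof (cases "Im w > 0")
          case True
          hence "\<Phi> g (-1 / w) = g w" "\<Phi> h (-1 / w) = h w"
            using Im_neg_inverse(2)[OF True] by (auto simp: \<Phi>_def)
          thus ?thesis using gh(3) by metis
        next
          case False
          thus ?thesis using conjugates_off[OF gh(1)] conjugates_off[OF gh(2)] by simp
        qed
      qed
    qed
  qed
qed

text \<open>
  The translation by \<open>2\<close> does not fix \<open>f\<close>, but it normalizes the group of \<open>f\<close>. Undoing it after the
  application of a group element costs the constant factor.
\<close>

lemma conjugates_plus_2:
  assumes "g \<in> conjugates N" "N > 0"
  shows "(\<lambda>\<tau>. if Im \<tau> > 0 then zeta24 (- int N) * g (\<tau> + 2) else 0) \<in> conjugates N"
proof -
  obtain a b c d where g: "weber_group a b c d" "theta a b c d" "g = conj_fun N a b c d"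
    using conjugatesE[OF assms(1)] by metis
  define a' b' c' d' where "a' = a - 2 * c" "b' = 2 * a + b - 2 * (2 * c + d)" "c' = c" "d' = 2 * c + d"
  note defs = a'_b'_c'_d'_def
  have "theta (a * 1 + b * 0) (a * 2 + b * 1) (c * 1 + d * 0) (c * 2 + d * 1)"
    by (rule theta_mult[OF g(2)]) (simp add: theta_def)
  hence th1: "theta a (2 * a + b) c (2 * c + d)" by (simp add: mult.commute)
  have th': "theta a' b' c' d'"
    using theta_shift[OF th1, of "-1"] by (simp add: defs algebra_simps)
  have nz: "c \<noteq> 0 \<or> 2 * c + d \<noteq> 0" using th1 by (auto simp: theta_def)
  have key: "mob a b c d (\<tau> + 2) = mob a' b' c' d' \<tau> + 2" if \<tau>: "Im \<tau> > 0" for \<tau>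
  proof -
    have "mob a b c d (\<tau> + 2) = mob a (2 * a + b) c (2 * c + d) \<tau>" by (simp add: mob_def algebra_simps)
    also have "\<dots> = mob a' b' c' d' \<tau> + 2"
      using mob_shift[OF \<tau> nz, of a "-2" "2 * a + b"] by (simp add: defs algebra_simps)
    finally show ?thesis .
  qed
  have Im': "Im (mob a' b' c' d' \<tau>) > 0" if "Im \<tau> > 0" for \<tau> by (rule Im_mob_theta(2)[OF that th'])
  have "weber_group a' b' c' d'"
    unfolding weber_group_def
  proof (intro conjI th' allI impI)
    fix \<tau> :: complex assume \<tau>: "Im \<tau> > 0"
    have "zeta24 1 * weber_f (mob a' b' c' d' \<tau>) = weber_f (mob a b c d (\<tau> + 2))"
      using weber_f_plus_even[OF Im'[OF \<tau>], of 1] by (simp add: key \<tau>)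
    also have "\<dots> = weber_f (\<tau> + 2)" using g(1) \<tau> by (simp add: weber_group_def)
    also have "\<dots> = zeta24 1 * weber_f \<tau>" using weber_f_plus_even[OF \<tau>, of 1] by simp
    finally show "weber_f (mob a' b' c' d' \<tau>) = weber_f \<tau>" by simp
  qed
  moreover have "(\<lambda>\<tau>. if Im \<tau> > 0 then zeta24 (- int N) * g (\<tau> + 2) else 0) = conj_fun N a' b' c' d'"
  proof
    fix \<tau> show "(if Im \<tau> > 0 then zeta24 (- int N) * g (\<tau> + 2) else 0) = conj_fun N a' b' c' d' \<tau>"
    proof (cases "Im \<tau> > 0")
      case True
      have "of_nat N * mob a b c d (\<tau> + 2) = of_nat N * mob a' b' c' d' \<tau> + of_int (2 * int N)"
        by (simp add: key True algebra_simps)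
      moreover have "Im (of_nat N * mob a' b' c' d' \<tau>) > 0" using Im'[OF True] assms(2) by simp
      ultimately have "weber_f (of_nat N * mob a b c d (\<tau> + 2)) = zeta24 (int N) * weber_f (of_nat N * mob a' b' c' d' \<tau>)"
        by (simp only: weber_f_plus_even)
      thus ?thesis using True by (simp add: g(3) conj_fun_def zeta24_minus)
    qed (simp add: conj_fun_def)
  qed
  ultimately show ?thesis by (auto simp: conjugates_def)
qed

lemma conj_poly_plus_2:
  assumes "odd N" "Im \<tau> > 0" "i \<le> card (conjugates N)"
  shows "coeff (conj_poly N (\<tau> + 2)) i = zeta24 (int N * int (card (conjugates N) - i)) * coeff (conj_poly N \<tau>) i"
proof -
  have N: "N > 0" using \<open>odd N\<close> by (auto intro: Nat.gr0I)
  have fin: "finite (conjugates N)" by (rule finite_conjugates[OF assms(1)])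
  define \<Phi> where "\<Phi> = (\<lambda>g::complex \<Rightarrow> complex. (\<lambda>\<tau>. if Im \<tau> > 0 then zeta24 (- int N) * g (\<tau> + 2) else 0))"
  have "conj_poly N (\<tau> + 2) = (\<Prod>g\<in>conjugates N. [:- (zeta24 (int N) * g \<tau>), 1:])"
    unfolding conj_poly_def
  proof (rule prod_linear_reindex[OF fin, of \<Phi>])
    show "\<Phi> ` conjugates N \<subseteq> conjugates N"
      using conjugates_plus_2[OF _ N] by (auto simp: \<Phi>_def)
    show "g (\<tau> + 2) = zeta24 (int N) * \<Phi> g \<tau>" for g
      using assms(2) by (simp add: \<Phi>_def zeta24_minus)
    show "inj_on \<Phi> (conjugates N)"
    proof
      fix g h assume gh: "g \<in> conjugates N" "h \<in> conjugates N" "\<Phi> g = \<Phi> h"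
      show "g = h"
      proof
        fix w show "g w = h w"
        proof (cases "Im w > 0")
          case True
          have "\<Phi> g (w - 2) = \<Phi> h (w - 2)" using gh(3) by simp
          thus ?thesis using True by (simp add: \<Phi>_def)
        next
          case False
          thus ?thesis using conjugates_off[OF gh(1)] conjugates_off[OF gh(2)] by simp
        qed
      qed
    qed
  qed
  thus ?thesis
    using coeff_prod_linear_scale[OF fin assms(3), of "zeta24 (int N)" "\<lambda>g. g \<tau>"]
    by (simp add: conj_poly_def zeta24_power mult.commute)
qed

text \<open>
  The coefficient of \<open>X\<^sup>i\<close> is homogeneous in the conjugates, so the common factor that the translation by
  \<open>2\<close> produces comes out as a power.
\<close>

lemma conj_poly_coeff_is_poly:
  assumes N: "odd N" and i: "i \<le> card (conjugates N)"
  obtains p where "degree p \<le> 24 + 24 * (N * card (conjugates N))"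
    "\<And>\<tau>. Im \<tau> > 0 \<Longrightarrow> coeff (conj_poly N \<tau>) i = poly p (weber_f \<tau>)"
proof -
  have N0: "N > 0" using N by (auto intro: Nat.gr0I)
  define n where "n = card (conjugates N)"
  have fin: "finite (conjugates N)" by (rule finite_conjugates[OF N])
  obtain C where C: "C > 0" "\<And>\<alpha> \<beta> \<gamma> \<delta> \<tau>. theta \<alpha> \<beta> \<gamma> \<delta> \<Longrightarrow> Im \<tau> \<ge> 1 \<Longrightarrow>
      norm (weber_f (of_nat N * mob \<alpha> \<beta> \<gamma> \<delta> \<tau>)) \<le> C * exp (pi * real N / 24 * Im \<tau>)"
    "\<And>\<alpha> \<beta> \<gamma> \<delta> z. theta \<alpha> \<beta> \<gamma> \<delta> \<Longrightarrow> Im z \<ge> 1 \<Longrightarrow>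
      norm (weber_f (of_nat N * mob \<alpha> \<beta> \<gamma> \<delta> (1 - 1 / z))) \<le> C"
    by (rule level_growth[OF N]) (rule that, assumption+)
  have g1: "norm (g \<tau>) \<le> C * exp (pi * real N / 24 * Im \<tau>)" if g: "g \<in> conjugates N" "Im \<tau> \<ge> 1" for g \<tau>
  proof -
    obtain a b c d where "theta a b c d" "g = conj_fun N a b c d"
      by (rule conjugatesE[OF g(1)]) (rule that)
    thus ?thesis using C(2)[of a b c d \<tau>] g(2) by (simp add: conj_fun_def)
  qed
  have g2: "norm (g (1 - 1 / z)) \<le> C" if g: "g \<in> conjugates N" "Im z \<ge> 1" for g z
  proof -
    obtain a b c d where "theta a b c d" "g = conj_fun N a b c d"
      by (rule conjugatesE[OF g(1)]) (rule that)
    thus ?thesis using less_imp_le[OF C(1)] C(3)[of a b c d z] g(2) by (simp only: conj_fun_def split: if_splits) simp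
  qed
  show ?thesis
  proof (rule weber_f_invariant_imp_poly[of "\<lambda>\<tau>. coeff (conj_poly N \<tau>) i" "int N * int (n - i)" "(1 + C) ^ n" "N * n" "(1 + C) ^ n"])
    show "(\<lambda>\<tau>. coeff (conj_poly N \<tau>) i) holomorphic_on upper_half_plane"
      unfolding conj_poly_def by (rule coeff_prod_linear_holomorphic[OF fin]) (rule conjugates_holomorphic[OF _ N0])
    show "coeff (conj_poly N (-1 / \<tau>)) i = coeff (conj_poly N \<tau>) i" if "Im \<tau> > 0" for \<tau>
      by (simp only: conj_poly_neg_inverse[OF N that])
    show "coeff (conj_poly N (\<tau> + 2)) i = zeta24 (int N * int (n - i)) * coeff (conj_poly N \<tau>) i" if "Im \<tau> > 0" for \<tau>
      unfolding n_def by (rule conj_poly_plus_2[OF N that i])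
    show "norm (coeff (conj_poly N (1 - 1 / z)) i) \<le> (1 + C) ^ n" if "Im z \<ge> 1" for z
      unfolding conj_poly_def n_def using that C(1) by (intro coeff_prod_linear_bound[OF fin] g2) simp_all
    show "norm (coeff (conj_poly N \<tau>) i) \<le> (1 + C) ^ n * exp (pi * real (N * n) * Im \<tau>)" if \<tau>: "Im \<tau> \<ge> 1" for \<tau>
    proof -
      define E where "E = exp (pi * real N * Im \<tau>)"
      have "pi * real N / 24 * Im \<tau> \<le> pi * real N * Im \<tau>" using \<tau> by (intro mult_right_mono) auto
      hence le: "exp (pi * real N / 24 * Im \<tau>) \<le> E" by (simp add: E_def)
      have E1: "E \<ge> 1" using \<tau> by (simp add: E_def)
      have "norm (coeff (conj_poly N \<tau>) i) \<le> (1 + C * E) ^ n"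
        unfolding conj_poly_def n_def
      proof (rule coeff_prod_linear_bound[OF fin])
        fix g assume "g \<in> conjugates N"
        from g1[OF this \<tau>] have "norm (g \<tau>) \<le> C * exp (pi * real N / 24 * Im \<tau>)" .
        also have "\<dots> \<le> C * E" using le C(1) by (intro mult_left_mono) auto
        finally show "norm (g \<tau>) \<le> C * E" .
      qed (use C(1) E1 in auto)
      also have "\<dots> \<le> ((1 + C) * E) ^ n"
        using E1 C(1) by (intro power_mono) (auto simp: algebra_simps)
      also have "\<dots> = (1 + C) ^ n * exp (pi * real (N * n) * Im \<tau>)"
        unfolding power_mult_distrib E_def exp_of_nat_mult[symmetric] by (simp add: mult_ac)
      finally show ?thesis .
    qed
  next
    fix p assume "degree p \<le> 24 + 24 * (N * n)" "\<And>\<tau>. Im \<tau> > 0 \<Longrightarrow> coeff (conj_poly N \<tau>) i = poly p (weber_f \<tau>)"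
    thus ?thesis using that unfolding n_def by blast
  qed
qed

lemma conj_poly_lift:
  assumes N: "odd N"
  obtains P where "lead_coeff P = 1" "degree P = card (conjugates N)"
    "\<And>\<tau> i. Im \<tau> > 0 \<Longrightarrow> poly (coeff P i) (weber_f \<tau>) = coeff (conj_poly N \<tau>) i"
    "\<And>i. degree (coeff P i) \<le> 24 + 24 * (N * card (conjugates N))"
proof -
  define n where "n = card (conjugates N)"
  have fin: "finite (conjugates N)" by (rule finite_conjugates[OF N])
  have "\<forall>i. \<exists>p. i \<le> n \<longrightarrow> degree p \<le> 24 + 24 * (N * n) \<and> (\<forall>\<tau>. Im \<tau> > 0 \<longrightarrow> coeff (conj_poly N \<tau>) i = poly p (weber_f \<tau>))"
    using conj_poly_coeff_is_poly[OF N] unfolding n_def by metis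
  then obtain p where p: "\<And>i. i \<le> n \<Longrightarrow> degree (p i) \<le> 24 + 24 * (N * n)"
    "\<And>i \<tau>. i \<le> n \<Longrightarrow> Im \<tau> > 0 \<Longrightarrow> coeff (conj_poly N \<tau>) i = poly (p i) (weber_f \<tau>)" by metis
  define P where "P = (\<Sum>i<n. monom (p i) i) + monom 1 n"
  have coeff_P: "coeff P i = (if i < n then p i else if i = n then 1 else 0)" for i
    by (auto simp: P_def coeff_sum)
  have degP: "degree P = n"
    by (rule antisym[OF degree_le le_degree]) (auto simp: coeff_P)
  have mono: "degree (conj_poly N \<tau>) = n" "coeff (conj_poly N \<tau>) n = 1" for \<tau>
    unfolding n_def conj_poly_def using monic_prod_linear[OF fin, of "\<lambda>g. g \<tau>"] by auto
  show ?thesis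
  proof (rule that[of P])
    show "lead_coeff P = 1" "degree P = card (conjugates N)" using degP by (simp_all add: coeff_P n_def)
    show "degree (coeff P i) \<le> 24 + 24 * (N * card (conjugates N))" for i
      using p(1)[of i] by (auto simp: coeff_P n_def)
    fix \<tau> i assume \<tau>: "Im \<tau> > 0"
    show "poly (coeff P i) (weber_f \<tau>) = coeff (conj_poly N \<tau>) i"
      using p(2)[of i \<tau>] \<tau> mono[of \<tau>] coeff_eq_0[of "conj_poly N \<tau>" i] by (auto simp: coeff_P)
  qed
qed

section \<open>Minimality and uniqueness\<close>

lemma fsigma_upper_half_plane: "fsigma upper_half_plane"
proof -
  obtain K :: "nat \<Rightarrow> complex set" where K: "\<And>n. compact (K n)" "upper_half_plane = (\<Union>n. K n)"
    using open_Union_compact_subsets[OF open_upper_half_plane] by metis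
  show ?thesis unfolding K(2) by (intro fsigma.intros compact_imp_closed K(1))
qed

lemma uncountable_upper_half_plane: "uncountable upper_half_plane"
proof -
  have "ball \<i> 1 \<subseteq> upper_half_plane"
  proof
    fix z assume "z \<in> ball \<i> 1"
    hence "norm (\<i> - z) < 1" by (simp add: dist_norm)
    hence "\<bar>Im (\<i> - z)\<bar> < 1" using abs_Im_le_cmod[of "\<i> - z"] by linarith
    thus "z \<in> upper_half_plane" by (simp add: upper_half_plane_def)
  qed
  thus ?thesis using uncountable_ball[of 1 \<i>] countable_subset by auto
qed

text \<open>
  An annihilating polynomial over the field generated by \<open>f\<close> also annihilates all the conjugates,
  because its coefficients are invariant under the group of \<open>f\<close>.
\<close>

lemma monic_annihilator_conjugates:
  assumes N: "odd N" and ann: "monic_annihilator (rational_functions_in weber_f) (\<lambda>\<tau>. weber_f (of_nat N * \<tau>)) d c"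
  obtains Z where "countable Z" "\<And>\<tau> g. Im \<tau> > 0 \<Longrightarrow> \<tau> \<notin> Z \<Longrightarrow> g \<in> conjugates N \<Longrightarrow>
     g \<tau> ^ d + (\<Sum>i<d. c i \<tau> * g \<tau> ^ i) = 0"
proof -
  define x where "x = (\<lambda>\<tau>. weber_f (of_nat N * \<tau>))"
  define B where "B = {\<tau>. \<not> (x \<tau> ^ d + (\<Sum>i<d. c i \<tau> * x \<tau> ^ i) = 0)}"
  have "B sparse_in upper_half_plane"
    using ann by (simp add: monic_annihilator_def eventually_cosparse B_def x_def)
  hence B: "countable (upper_half_plane \<inter> B)"
    by (rule sparse_imp_countable[OF open_upper_half_plane])
  have c_inv: "c i (mob p q r s \<tau>) = c i \<tau>" if "i < d" "weber_group p q r s" "Im \<tau> > 0" for i p q r s \<tau>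
  proof -
    have "c i \<in> rational_functions_in weber_f" using ann that(1) by (simp add: monic_annihilator_def)
    then obtain P Q where "c i = (\<lambda>\<tau>. poly P (weber_f \<tau>) / poly Q (weber_f \<tau>))"
      by (auto simp: rational_functions_in_def)
    thus ?thesis using that(2,3) by (simp add: weber_group_def)
  qed
  have "\<exists>Z. countable Z \<and> (\<forall>\<tau>. Im \<tau> > 0 \<longrightarrow> \<tau> \<notin> Z \<longrightarrow> g \<tau> ^ d + (\<Sum>i<d. c i \<tau> * g \<tau> ^ i) = 0)"
    if g: "g \<in> conjugates N" for g
  proof -
    obtain p q r s where \<gamma>: "weber_group p q r s" "theta p q r s" "g = conj_fun N p q r s"
      using conjugatesE[OF g] by metis
    define Z where "Z = (\<lambda>w. mob s (-q) (-r) p w) ` (upper_half_plane \<inter> B)"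
    have "g \<tau> ^ d + (\<Sum>i<d. c i \<tau> * g \<tau> ^ i) = 0" if \<tau>: "Im \<tau> > 0" "\<tau> \<notin> Z" for \<tau>
    proof -
      define w where "w = mob p q r s \<tau>"
      have w: "Im w > 0" unfolding w_def by (rule Im_mob_theta(2)[OF \<tau>(1) \<gamma>(2)])
      have "mob s (-q) (-r) p w = \<tau>" unfolding w_def by (rule mob_inverse(2)[OF \<tau>(1) \<gamma>(2)])
      hence "w \<notin> B" using \<tau>(2) w by (force simp: Z_def upper_half_plane_def)
      hence "x w ^ d + (\<Sum>i<d. c i w * x w ^ i) = 0" by (simp add: B_def)
      moreover have "x w = g \<tau>" using \<tau>(1) by (simp add: x_def w_def \<gamma>(3) conj_fun_def)
      moreover have "(\<Sum>i<d. c i w * x w ^ i) = (\<Sum>i<d. c i \<tau> * x w ^ i)"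
        unfolding w_def using c_inv[OF _ \<gamma>(1) \<tau>(1)] by (intro sum.cong) auto
      ultimately show ?thesis by simp
    qed
    moreover have "countable Z" using B by (simp add: Z_def)
    ultimately show ?thesis by blast
  qed
  then obtain Z where Z: "\<And>g. g \<in> conjugates N \<Longrightarrow> countable (Z g)"
    "\<And>g \<tau>. g \<in> conjugates N \<Longrightarrow> Im \<tau> > 0 \<Longrightarrow> \<tau> \<notin> Z g \<Longrightarrow> g \<tau> ^ d + (\<Sum>i<d. c i \<tau> * g \<tau> ^ i) = 0"
    by metis
  show ?thesis
  proof (rule that[of "\<Union>g\<in>conjugates N. Z g"])
    show "countable (\<Union>g\<in>conjugates N. Z g)"
      using Z(1) finite_conjugates[OF N] by (intro countable_UN) (auto simp: countable_finite)
  qed (use Z(2) in blast)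
qed

text \<open>
  Distinct holomorphic functions agree only on a countable set, and the half-plane is uncountable. The
  exceptional sets in this part are all countable, which makes them harmless.
\<close>

lemma conjugates_distinct_values:
  assumes N: "odd N"
  obtains Z where "countable Z" "\<And>\<tau>. Im \<tau> > 0 \<Longrightarrow> \<tau> \<notin> Z \<Longrightarrow> inj_on (\<lambda>g. g \<tau>) (conjugates N)"
proof -
  have N0: "N > 0" using N by (auto intro: Nat.gr0I)
  define E where "E = (\<lambda>g h::complex \<Rightarrow> complex. {\<tau>\<in>upper_half_plane. g \<tau> = h \<tau>})"
  have cnt: "countable (E g h)" if "g \<in> conjugates N" "h \<in> conjugates N" "g \<noteq> h" for g h
  proof (rule ccontr)
    assume "uncountable (E g h)"
    hence "upper_half_plane \<subseteq> E g h"
      unfolding E_def using conjugates_holomorphic[OF _ N0] that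
      by (intro holomorphic_countable_equal open_upper_half_plane connected_upper_half_plane fsigma_upper_half_plane) auto
    hence "g \<tau> = h \<tau>" for \<tau>
      using conjugates_off[OF that(1), of \<tau>] conjugates_off[OF that(2), of \<tau>]
      by (cases "Im \<tau> > 0") (auto simp: E_def upper_half_plane_def)
    thus False using that(3) by auto
  qed
  define Z where "Z = (\<Union>g\<in>conjugates N. \<Union>h\<in>conjugates N - {g}. E g h)"
  show ?thesis
  proof (rule that[of Z])
    show "countable Z" unfolding Z_def using finite_conjugates[OF N] cnt
      by (intro countable_UN) (auto simp: countable_finite)
    fix \<tau> assume \<tau>: "Im \<tau> > 0" "\<tau> \<notin> Z"
    show "inj_on (\<lambda>g. g \<tau>) (conjugates N)"
    proof (rule inj_onI, rule ccontr)
      fix g h assume "g \<in> conjugates N" "h \<in> conjugates N" "g \<tau> = h \<tau>" "g \<noteq> h"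
      hence "\<tau> \<in> Z" using \<tau>(1) by (auto simp: Z_def E_def upper_half_plane_def)
      thus False using \<tau>(2) by contradiction
    qed
  qed
qed

definition specialized_annihilator :: "nat \<Rightarrow> (nat \<Rightarrow> complex \<Rightarrow> complex) \<Rightarrow> complex \<Rightarrow> complex poly" where
  "specialized_annihilator d c \<tau> = (\<Sum>i<d. monom (c i \<tau>) i) + monom 1 d"

lemma coeff_specialized_annihilator:
  "coeff (specialized_annihilator d c \<tau>) i = (if i < d then c i \<tau> else if i = d then 1 else 0)"
  by (auto simp: specialized_annihilator_def coeff_sum)

lemma degree_specialized_annihilator: "degree (specialized_annihilator d c \<tau>) = d"
  by (rule antisym[OF degree_le le_degree]) (auto simp: coeff_specialized_annihilator)

lemma poly_specialized_annihilator:
  "poly (specialized_annihilator d c \<tau>) z = z ^ d + (\<Sum>i<d. c i \<tau> * z ^ i)"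
  by (simp add: specialized_annihilator_def poly_sum poly_monom)

text \<open>
  At almost every point the values of the conjugates are distinct roots of the annihilator.
\<close>

lemma annihilator_degree_ge:
  assumes N: "odd N" and ann: "monic_annihilator (rational_functions_in weber_f) (\<lambda>\<tau>. weber_f (of_nat N * \<tau>)) d c"
  shows "card (conjugates N) \<le> d"
    and "d = card (conjugates N) \<Longrightarrow> \<exists>Z. countable Z \<and> (\<forall>\<tau>. Im \<tau> > 0 \<longrightarrow> \<tau> \<notin> Z \<longrightarrow> specialized_annihilator d c \<tau> = conj_poly N \<tau>)"
proof -
  have fin: "finite (conjugates N)" by (rule finite_conjugates[OF N])
  obtain Z1 where Z1: "countable Z1" "\<And>\<tau> g. Im \<tau> > 0 \<Longrightarrow> \<tau> \<notin> Z1 \<Longrightarrow> g \<in> conjugates N \<Longrightarrow>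
     g \<tau> ^ d + (\<Sum>i<d. c i \<tau> * g \<tau> ^ i) = 0"
    by (rule monic_annihilator_conjugates[OF N ann]) blast
  obtain Z2 where Z2: "countable Z2" "\<And>\<tau>. Im \<tau> > 0 \<Longrightarrow> \<tau> \<notin> Z2 \<Longrightarrow> inj_on (\<lambda>g. g \<tau>) (conjugates N)"
    by (rule conjugates_distinct_values[OF N]) blast
  have roots: "poly (specialized_annihilator d c \<tau>) z = 0"
    if "Im \<tau> > 0" "\<tau> \<notin> Z1" "z \<in> (\<lambda>g. g \<tau>) ` conjugates N" for \<tau> z
    using Z1(2)[OF that(1,2)] that(3) by (auto simp: poly_specialized_annihilator)
  have card: "card ((\<lambda>g. g \<tau>) ` conjugates N) = card (conjugates N)" if "Im \<tau> > 0" "\<tau> \<notin> Z2" for \<tau>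
    by (rule card_image[OF Z2(2)[OF that]])
  show "card (conjugates N) \<le> d"
  proof -
    have "uncountable (upper_half_plane - (Z1 \<union> Z2))"
      using uncountable_upper_half_plane Z1(1) Z2(1) by (intro uncountable_minus_countable) auto
    then obtain \<tau> where \<tau>: "Im \<tau> > 0" "\<tau> \<notin> Z1" "\<tau> \<notin> Z2"
      by (metis Diff_iff UnI1 UnI2 countable_empty equals0I mem_Collect_eq upper_half_plane_def)
    define q where "q = specialized_annihilator d c \<tau>"
    have "coeff q d = 1" by (simp add: q_def coeff_specialized_annihilator)
    hence q0: "q \<noteq> 0" by auto
    have "card ((\<lambda>g. g \<tau>) ` conjugates N) \<le> card {z. poly q z = 0}"
      using roots[OF \<tau>(1,2)] poly_roots_finite[OF q0] by (intro card_mono) (auto simp: q_def)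
    also have "\<dots> \<le> degree q" by (rule card_poly_roots_bound[OF q0])
    also have "degree q = d" by (simp add: q_def degree_specialized_annihilator)
    finally show ?thesis using card[OF \<tau>(1,3)] by simp
  qed
  assume d: "d = card (conjugates N)"
  have "specialized_annihilator d c \<tau> = conj_poly N \<tau>" if \<tau>: "Im \<tau> > 0" "\<tau> \<notin> Z1 \<union> Z2" for \<tau>
  proof (rule poly_eqI_degree_lead_coeff[where n = d and A = "(\<lambda>g. g \<tau>) ` conjugates N"])
    have mono: "degree (conj_poly N \<tau>) = d" "coeff (conj_poly N \<tau>) d = 1"
      unfolding d conj_poly_def using monic_prod_linear[OF fin, of "\<lambda>g. g \<tau>"] by auto
    show "coeff (specialized_annihilator d c \<tau>) d = coeff (conj_poly N \<tau>) d"
      by (simp add: mono coeff_specialized_annihilator)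
    show "card ((\<lambda>g. g \<tau>) ` conjugates N) \<ge> d" using card \<tau> d by simp
    show "degree (specialized_annihilator d c \<tau>) \<le> d" "degree (conj_poly N \<tau>) \<le> d"
      by (simp_all add: mono degree_specialized_annihilator)
    fix z assume z: "z \<in> (\<lambda>g. g \<tau>) ` conjugates N"
    have "poly (conj_poly N \<tau>) z = 0"
      using z fin by (auto simp: conj_poly_def poly_prod)
    thus "poly (specialized_annihilator d c \<tau>) z = poly (conj_poly N \<tau>) z"
      using roots[OF \<tau>(1) _ z] \<tau>(2) by simp
  qed
  thus "\<exists>Z. countable Z \<and> (\<forall>\<tau>. Im \<tau> > 0 \<longrightarrow> \<tau> \<notin> Z \<longrightarrow> specialized_annihilator d c \<tau> = conj_poly N \<tau>)"
    using Z1(1) Z2(1) by (intro exI[of _ "Z1 \<union> Z2"]) auto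
qed

lemma weber_f_not_constant: "\<not> weber_f constant_on upper_half_plane"
proof
  assume "weber_f constant_on upper_half_plane"
  then obtain c where c: "\<And>\<tau>. Im \<tau> > 0 \<Longrightarrow> weber_f \<tau> = c" by (auto simp: constant_on_def upper_half_plane_def)
  have "zeta24 1 * weber_f \<i> = weber_f \<i>" using weber_f_plus_even[of \<i> 1] c[of "\<i> + 2"] c[of \<i>] by simp
  hence "zeta24 1 = 1" using weber_f_nonzero[of \<i>] by simp
  moreover have "sin (pi / 12) \<noteq> 0" using sin_gt_zero[of "pi / 12"] by simp
  ultimately show False by (auto simp: zeta24_def complex_eq_iff Im_exp)
qed

lemma poly_weber_f_eqI:
  assumes "countable Z" "\<And>\<tau>. Im \<tau> > 0 \<Longrightarrow> \<tau> \<notin> Z \<Longrightarrow> poly p (weber_f \<tau>) = poly q (weber_f \<tau>)"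
  shows "p = q"
proof (rule ccontr)
  assume "p \<noteq> q"
  hence fin: "finite {z. poly (p - q) z = 0}" by (intro poly_roots_finite) auto
  have "countable {\<tau>\<in>upper_half_plane. weber_f \<tau> - z = 0}" for z
  proof (rule holomorphic_countable_zeros[OF _ open_upper_half_plane connected_upper_half_plane fsigma_upper_half_plane])
    show "(\<lambda>\<tau>. weber_f \<tau> - z) holomorphic_on upper_half_plane"
      by (intro holomorphic_intros holomorphic_weber_f)
    show "\<not> (\<lambda>\<tau>. weber_f \<tau> - z) constant_on upper_half_plane"
    proof
      assume "(\<lambda>\<tau>. weber_f \<tau> - z) constant_on upper_half_plane"
      then obtain c where "\<And>\<tau>. \<tau> \<in> upper_half_plane \<Longrightarrow> weber_f \<tau> - z = c" by (auto simp: constant_on_def)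
      hence "weber_f constant_on upper_half_plane"
        unfolding constant_on_def by (intro exI[of _ "c + z"]) (metis diff_add_cancel)
      thus False using weber_f_not_constant by contradiction
    qed
  qed
  hence "countable (Z \<union> (\<Union>z\<in>{z. poly (p - q) z = 0}. {\<tau>\<in>upper_half_plane. weber_f \<tau> - z = 0}))"
    using fin assms(1) by (intro countable_Un countable_UN) (auto simp: countable_finite)
  moreover have "upper_half_plane \<subseteq> Z \<union> (\<Union>z\<in>{z. poly (p - q) z = 0}. {\<tau>\<in>upper_half_plane. weber_f \<tau> - z = 0})"
    using assms(2) by (auto simp: upper_half_plane_def)
  ultimately show False using uncountable_upper_half_plane countable_subset by blast
qed

text \<open>
  The product over the conjugates, written in terms of \<open>f\<close>, is an annihilator of the least possible degree.
  A second one of this degree has the same roots at almost every point, and a polynomial in \<open>f\<close> determines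
  its coefficients.
\<close>

theorem weber_modular_polynomial_conjugates:
  assumes N: "odd N"
  shows "degree (weber_modular_polynomial N) = card (conjugates N)"
    and "Im \<tau> > 0 \<Longrightarrow> poly (coeff (weber_modular_polynomial N) i) (weber_f \<tau>) = coeff (conj_poly N \<tau>) i"
    and "degree (coeff (weber_modular_polynomial N) i) \<le> 24 + 24 * (N * card (conjugates N))"
    and "lead_coeff (weber_modular_polynomial N) = 1"
proof -
  have fin: "finite (conjugates N)" by (rule finite_conjugates[OF N])
  define n where "n = card (conjugates N)"
  obtain P where P: "lead_coeff P = 1" "degree P = n"
    "\<And>\<tau> i. Im \<tau> > 0 \<Longrightarrow> poly (coeff P i) (weber_f \<tau>) = coeff (conj_poly N \<tau>) i"
    "\<And>i. degree (coeff P i) \<le> 24 + 24 * (N * n)"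
    using conj_poly_lift[OF N] unfolding n_def by blast
  have "weber_group 1 0 0 1" by (simp add: weber_group_def theta_def mob_def)
  hence "conj_fun N 1 0 0 1 \<in> conjugates N" by (auto simp: conjugates_def)
  hence root: "poly (conj_poly N \<tau>) (weber_f (of_nat N * \<tau>)) = 0" if "Im \<tau> > 0" for \<tau>
    using fin that unfolding conj_poly_def poly_prod
    by (intro prod_zero bexI[of _ "conj_fun N 1 0 0 1"]) (auto simp: conj_fun_def mob_def)
  have ann: "monic_annihilator (rational_functions_in weber_f) (\<lambda>\<tau>. weber_f (of_nat N * \<tau>)) n (\<lambda>i \<tau>. poly (coeff P i) (weber_f \<tau>))"
    unfolding monic_annihilator_def
  proof (intro conjI allI impI)
    show "(\<lambda>\<tau>. poly (coeff P i) (weber_f \<tau>)) \<in> rational_functions_in weber_f" for i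
    proof -
      have "\<i> \<in> upper_half_plane" by (simp add: upper_half_plane_def)
      thus ?thesis unfolding rational_functions_in_def
        by (intro CollectI exI[of _ "coeff P i"] exI[of _ 1]) auto
    qed
    have "{\<tau>. \<not> (weber_f (of_nat N * \<tau>) ^ n + (\<Sum>i<n. poly (coeff P i) (weber_f \<tau>) * weber_f (of_nat N * \<tau>) ^ i) = 0)} \<inter> upper_half_plane = {}"
    proof safe
      fix \<tau> assume \<tau>: "\<tau> \<in> upper_half_plane"
        and ne: "weber_f (of_nat N * \<tau>) ^ n + (\<Sum>i<n. poly (coeff P i) (weber_f \<tau>) * weber_f (of_nat N * \<tau>) ^ i) \<noteq> 0"
      have \<tau>': "Im \<tau> > 0" using \<tau> by (simp add: upper_half_plane_def)
      have mono: "degree (conj_poly N \<tau>) = n" "coeff (conj_poly N \<tau>) n = 1"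
        unfolding n_def conj_poly_def using monic_prod_linear[OF fin, of "\<lambda>g. g \<tau>"] by auto
      have "poly (conj_poly N \<tau>) z = z ^ n + (\<Sum>i<n. coeff (conj_poly N \<tau>) i * z ^ i)" for z
        unfolding poly_altdef mono(1) lessThan_Suc_atMost[symmetric] by (simp add: mono(2))
      hence False using root[OF \<tau>'] ne P(3)[OF \<tau>'] by simp
      thus "\<tau> \<in> {}" ..
    qed
    hence *: "upper_half_plane \<subseteq> {\<tau>. weber_f (of_nat N * \<tau>) ^ n + (\<Sum>i<n. poly (coeff P i) (weber_f \<tau>) * weber_f (of_nat N * \<tau>) ^ i) = 0}"
      by blast
    show "\<forall>\<^sub>\<approx>\<tau>\<in>upper_half_plane. weber_f (of_nat N * \<tau>) ^ n + (\<Sum>i<n. poly (coeff P i) (weber_f \<tau>) * weber_f (of_nat N * \<tau>) ^ i) = 0"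
      by (rule eventually_mono[OF eventually_in_cosparse[OF order_refl open_upper_half_plane]]) (use * in blast)
  qed
  have isP: "is_weber_modular_polynomial N P"
    unfolding is_weber_modular_polynomial_def minimal_polynomial_def P(2)
    using P(1) ann annihilator_degree_ge(1)[OF N] by (auto simp: P(2) n_def)
  have uniq: "Q = P" if Q: "is_weber_modular_polynomial N Q" for Q
  proof -
    have Qann: "monic_annihilator (rational_functions_in weber_f) (\<lambda>\<tau>. weber_f (of_nat N * \<tau>)) (degree Q) (\<lambda>i \<tau>. poly (coeff Q i) (weber_f \<tau>))"
      and Qmin: "degree Q \<le> n" and Qlead: "lead_coeff Q = 1"
      using Q ann by (auto simp: is_weber_modular_polynomial_def minimal_polynomial_def)
    have degQ: "degree Q = n" using Qmin annihilator_degree_ge(1)[OF N Qann] by (simp add: n_def)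
    obtain Z where Z: "countable Z" "\<And>\<tau>. Im \<tau> > 0 \<Longrightarrow> \<tau> \<notin> Z \<Longrightarrow>
        specialized_annihilator (degree Q) (\<lambda>i \<tau>. poly (coeff Q i) (weber_f \<tau>)) \<tau> = conj_poly N \<tau>"
      using annihilator_degree_ge(2)[OF N Qann] degQ n_def by blast
    show "Q = P"
    proof (rule poly_eqI)
      fix i
      show "coeff Q i = coeff P i"
      proof (cases "i < n")
        case True
        show ?thesis
        proof (rule poly_weber_f_eqI[OF Z(1)])
          fix \<tau> assume "Im \<tau> > 0" "\<tau> \<notin> Z"
          thus "poly (coeff Q i) (weber_f \<tau>) = poly (coeff P i) (weber_f \<tau>)"
            using arg_cong[OF Z(2), of \<tau> "\<lambda>p. coeff p i"] P(3)[of \<tau> i] True degQ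
            by (simp add: coeff_specialized_annihilator)
        qed
      next
        case False
        thus ?thesis using P(1,2) degQ Qlead coeff_eq_0[of Q i] coeff_eq_0[of P i] by (cases "i = n") auto
      qed
    qed
  qed
  have eq: "weber_modular_polynomial N = P"
    unfolding weber_modular_polynomial_def using isP uniq by (rule the_equality)
  show "degree (weber_modular_polynomial N) = card (conjugates N)"
    "Im \<tau> > 0 \<Longrightarrow> poly (coeff (weber_modular_polynomial N) i) (weber_f \<tau>) = coeff (conj_poly N \<tau>) i"
    "degree (coeff (weber_modular_polynomial N) i) \<le> 24 + 24 * (N * card (conjugates N))"
    "lead_coeff (weber_modular_polynomial N) = 1"
    using P unfolding eq n_def by auto
qed

section \<open>Coefficients and roots\<close>

text \<open>
  A monic polynomial is not small everywhere on the unit circle: its reflection takes the value \<open>1\<close>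
  at the origin, so the maximum modulus principle applies.
\<close>

lemma monic_poly_large_on_circle:
  fixes q :: "complex poly"
  assumes "lead_coeff q = 1"
  obtains z where "norm z = 1" "norm (poly q z) \<ge> 1"
proof -
  define R where "R = reflect_poly q"
  have "q \<noteq> 0" using assms by auto
  have "sphere (0::complex) 1 \<noteq> {}" by simp
  moreover have "continuous_on (sphere 0 1) (\<lambda>z. norm (poly R z))" by (intro continuous_intros)
  ultimately obtain w where w: "w \<in> sphere 0 1" "\<And>z. z \<in> sphere 0 1 \<Longrightarrow> norm (poly R z) \<le> norm (poly R w)"
    using continuous_attains_sup[of "sphere 0 1" "\<lambda>z. norm (poly R z)"] by auto
  have "norm (poly R 0) \<le> norm (poly R w)"
  proof (rule maximum_modulus_frontier[of "poly R" "ball 0 1"])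
    show "poly R holomorphic_on interior (ball 0 1)" by (intro holomorphic_intros)
    show "continuous_on (closure (ball 0 1)) (poly R)" by (intro continuous_intros)
    show "norm (poly R z) \<le> norm (poly R w)" if "z \<in> frontier (ball 0 1)" for z
      using w(2)[of z] that by simp
  qed auto
  moreover have "poly R 0 = 1" using assms by (simp add: R_def poly_0_coeff_0)
  moreover have "norm (poly R w) = norm (poly q (inverse w))"
  proof -
    have "w \<noteq> 0" "norm w = 1" using w(1) by auto
    hence "poly R w = w ^ degree q * poly q (inverse w)" by (simp add: R_def poly_reflect_poly_nz)
    thus ?thesis using \<open>norm w = 1\<close> by (simp add: norm_mult norm_power)
  qed
  ultimately show ?thesis using that[of "inverse w"] w(1) by (simp add: norm_inverse)
qed

text \<open>
  This replaces Jensen's formula. Roots of modulus less than \<open>2\<close> contribute at most \<open>ln 2\<close> each. Some point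
  \<open>z\<close> of the unit circle has a distance product at least \<open>1\<close> from these, and its distance from any other
  root \<open>x\<close> is at least \<open>\<bar>x\<bar>/2\<close>; the value of the polynomial at \<open>z\<close> is bounded by the coefficients.
\<close>

lemma sum_ln_roots_le:
  fixes x :: "'b \<Rightarrow> complex"
  assumes fin: "finite A" and H: "H > 0" "\<And>i. i \<le> card A \<Longrightarrow> norm (coeff (\<Prod>g\<in>A. [:- x g, 1:]) i) \<le> H"
  shows "(\<Sum>g\<in>A. ln (max 1 (norm (x g)))) \<le> ln H + ln (real (card A) + 1) + real (card A) * ln 2"
proof -
  define S where "S = {g \<in> A. norm (x g) < 2}"
  define L where "L = {g \<in> A. norm (x g) \<ge> 2}"
  have A: "A = S \<union> L" "S \<inter> L = {}" and finSL: "finite S" "finite L" using fin by (auto simp: S_def L_def)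
  define q where "q = (\<Prod>g\<in>S. [:- x g, 1:])"
  define P where "P = (\<Prod>g\<in>A. [:- x g, 1:])"
  have "lead_coeff q = 1" using monic_prod_linear[OF finSL(1), of x] by (simp add: q_def)
  then obtain z where z: "norm z = 1" "norm (poly q z) \<ge> 1" by (rule monic_poly_large_on_circle)
  have degP: "degree P = card A" using monic_prod_linear[OF fin, of x] by (simp add: P_def)
  have "norm (poly P z) \<le> (\<Sum>i\<le>card A. norm (coeff P i * z ^ i))"
    unfolding poly_altdef degP by (rule norm_sum)
  also have "\<dots> \<le> (\<Sum>i\<le>card A. H)"
    by (intro sum_mono) (use H(2) z(1) in \<open>auto simp: norm_mult norm_power P_def\<close>)
  finally have upper: "norm (poly P z) \<le> (real (card A) + 1) * H" by (simp add: algebra_simps)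
  have "(\<Prod>g\<in>L. norm (x g) / 2) \<le> (\<Prod>g\<in>L. norm (z - x g))"
  proof (intro prod_mono conjI)
    fix g assume g: "g \<in> L"
    have "norm (x g) \<le> norm (z - x g) + norm z" using norm_triangle_ineq4[of z "z - x g"] by (simp add: add.commute)
    thus "norm (x g) / 2 \<le> norm (z - x g)" using g z(1) by (simp add: L_def)
  qed auto
  also have "\<dots> = 1 * norm (\<Prod>g\<in>L. z - x g)" by (simp add: prod_norm)
  also have "\<dots> \<le> norm (poly q z) * norm (\<Prod>g\<in>L. z - x g)" using z(2) by (intro mult_right_mono) auto
  also have "\<dots> = norm (poly P z)"
    unfolding P_def q_def A(1) using finSL A(2)
    by (simp add: prod.union_disjoint poly_prod norm_mult)
  also note upper
  finally have le: "(\<Prod>g\<in>L. norm (x g) / 2) \<le> (real (card A) + 1) * H" .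
  have pos: "(\<Prod>g\<in>L. norm (x g) / 2) > 0" by (intro prod_pos) (auto simp: L_def)
  have "(\<Sum>g\<in>L. ln (norm (x g) / 2)) = ln (\<Prod>g\<in>L. norm (x g) / 2)"
    using finSL by (subst ln_prod) (auto simp: L_def)
  also have "\<dots> \<le> ln ((real (card A) + 1) * H)" using le pos by (subst ln_le_cancel_iff) auto
  also have "\<dots> = ln H + ln (real (card A) + 1)" using H(1) by (simp add: ln_mult)
  finally have 1: "(\<Sum>g\<in>L. ln (norm (x g) / 2)) \<le> ln H + ln (real (card A) + 1)" .
  have "(\<Sum>g\<in>A. ln (max 1 (norm (x g)))) = (\<Sum>g\<in>S. ln (max 1 (norm (x g)))) + (\<Sum>g\<in>L. ln (max 1 (norm (x g))))"
    unfolding A(1) by (rule sum.union_disjoint) (use finSL A(2) in auto)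
  also have "\<dots> \<le> (\<Sum>g\<in>S. ln 2) + (\<Sum>g\<in>L. ln (norm (x g) / 2) + ln 2)"
  proof (intro add_mono sum_mono)
    show "ln (max 1 (norm (x g))) \<le> ln 2" if "g \<in> S" for g
      using that by (subst ln_le_cancel_iff) (auto simp: S_def)
    show "ln (max 1 (norm (x g))) \<le> ln (norm (x g) / 2) + ln 2" if "g \<in> L" for g
      using that by (simp add: L_def max_def ln_div)
  qed
  also have "\<dots> = (\<Sum>g\<in>L. ln (norm (x g) / 2)) + real (card A) * ln 2"
    using finSL A by (simp add: sum.distrib card_Un_disjoint algebra_simps)
  finally show ?thesis using 1 by linarith
qed

section \<open>A lattice sum over primitive vectors\<close>

text \<open>
  For \<open>\<tau> = 1 + \<i>/K\<close> the value at \<open>(n, m)\<close> is \<open>K\<^sup>2 \<bar>r \<tau> + s\<bar>\<^sup>2\<close> where \<open>r = m\<close> and \<open>s = n - m\<close>. The first coordinate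
  is \<open>r + s\<close>, whose parity decides whether a coprime \<open>(r, s)\<close> is the bottom row of an element of the theta group.
\<close>

definition quad_form :: "nat \<Rightarrow> int \<times> int \<Rightarrow> real" where
  "quad_form K w = (real K * of_int (fst w))\<^sup>2 + (of_int (snd w))\<^sup>2"

definition odd_vectors :: "nat \<Rightarrow> real \<Rightarrow> (int \<times> int) set" where
  "odd_vectors K R = {w. odd (fst w) \<and> quad_form K w < R}"

definition prim_vectors :: "nat \<Rightarrow> real \<Rightarrow> (int \<times> int) set" where
  "prim_vectors K R = {w. odd (fst w) \<and> coprime (fst w) (snd w) \<and> quad_form K w < R}"

lemma odd_vectors_bounds:
  assumes K: "K > 0"
  shows "odd_vectors K R \<subseteq> {- \<lfloor>sqrt R\<rfloor>..\<lfloor>sqrt R\<rfloor>} \<times> {- \<lfloor>sqrt R\<rfloor>..\<lfloor>sqrt R\<rfloor>}"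
    and "w \<in> odd_vectors K R \<Longrightarrow> 1 \<le> quad_form K w"
proof -
  have abs_le: "\<bar>x\<bar> \<le> \<lfloor>sqrt R\<rfloor>" if "(of_int x)\<^sup>2 \<le> R" for x :: int
  proof -
    have "\<bar>of_int x\<bar> \<le> sqrt R" using that by (intro real_le_rsqrt) simp
    hence "real_of_int \<bar>x\<bar> \<le> sqrt R" by simp
    thus ?thesis by (simp only: le_floor_iff)
  qed
  have K1: "(of_int x)\<^sup>2 \<le> (real K * of_int x)\<^sup>2" for x :: int
  proof -
    have "1 * (of_int x)\<^sup>2 \<le> (real K)\<^sup>2 * (of_int x)\<^sup>2" using K by (intro mult_right_mono) auto
    thus ?thesis by (simp add: power_mult_distrib)
  qed
  show "odd_vectors K R \<subseteq> {- \<lfloor>sqrt R\<rfloor>..\<lfloor>sqrt R\<rfloor>} \<times> {- \<lfloor>sqrt R\<rfloor>..\<lfloor>sqrt R\<rfloor>}"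
  proof
    fix w assume "w \<in> odd_vectors K R"
    hence Q: "(real K * of_int (fst w))\<^sup>2 + (of_int (snd w))\<^sup>2 < R" by (simp add: odd_vectors_def quad_form_def)
    have "\<bar>fst w\<bar> \<le> \<lfloor>sqrt R\<rfloor>" "\<bar>snd w\<bar> \<le> \<lfloor>sqrt R\<rfloor>"
    proof (rule_tac [!] abs_le)
      show "(real_of_int (snd w))\<^sup>2 \<le> R" using Q zero_le_power2[of "real K * of_int (fst w)"] by linarith
      show "(real_of_int (fst w))\<^sup>2 \<le> R" using Q K1[of "fst w"] zero_le_power2[of "real_of_int (snd w)"] by linarith
    qed
    thus "w \<in> {- \<lfloor>sqrt R\<rfloor>..\<lfloor>sqrt R\<rfloor>} \<times> {- \<lfloor>sqrt R\<rfloor>..\<lfloor>sqrt R\<rfloor>}" by (cases w) auto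
  qed
  assume "w \<in> odd_vectors K R"
  hence "fst w \<noteq> 0" by (auto simp: odd_vectors_def)
  hence "1 \<le> \<bar>fst w\<bar>" by linarith
  hence "(1::real) \<le> \<bar>of_int (fst w)\<bar>" by linarith
  hence "1 \<le> (of_int (fst w) :: real)\<^sup>2" by (metis one_le_power power2_abs)
  also have "\<dots> \<le> (real K * of_int (fst w))\<^sup>2" by (rule K1)
  also have "\<dots> \<le> quad_form K w" by (simp add: quad_form_def)
  finally show "1 \<le> quad_form K w" .
qed

lemma prim_subset_odd: "prim_vectors K R \<subseteq> odd_vectors K R"
  by (auto simp: prim_vectors_def odd_vectors_def)

lemma finite_odd_vectors: "K > 0 \<Longrightarrow> finite (odd_vectors K R)"
  by (rule finite_subset[OF odd_vectors_bounds(1)]) auto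

lemma finite_prim_vectors: "K > 0 \<Longrightarrow> finite (prim_vectors K R)"
  by (rule finite_subset[OF prim_subset_odd finite_odd_vectors])

lemma prim_vectors_empty:
  assumes "K > 0" "R \<le> 1"
  shows "prim_vectors K R = {}"
proof -
  have False if w: "w \<in> prim_vectors K R" for w
  proof -
    have "w \<in> odd_vectors K R" using w prim_subset_odd by blast
    from odd_vectors_bounds(2)[OF assms(1) this] have "1 \<le> quad_form K w" .
    moreover have "quad_form K w < R" using w by (simp add: prim_vectors_def)
    ultimately show False using assms(2) by linarith
  qed
  thus ?thesis by blast
qed

lemma card_prim_vectors_le:
  assumes "K > 0" "R \<ge> 1"
  shows "real (card (prim_vectors K R)) \<le> 9 * R"
proof -
  define s where "s = \<lfloor>sqrt R\<rfloor>"
  have s: "s \<ge> 1" "of_int s \<le> sqrt R" using assms(2) by (auto simp: s_def le_floor_iff)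
  have "card (prim_vectors K R) \<le> card ({-s..s} \<times> {-s..s})"
    unfolding s_def by (intro card_mono order_trans[OF prim_subset_odd odd_vectors_bounds(1)[OF assms(1)]]) auto
  also have "\<dots> = nat (2 * s + 1) * nat (2 * s + 1)" by (simp add: card_cartesian_product)
  finally have "real (card (prim_vectors K R)) \<le> real (nat (2 * s + 1) * nat (2 * s + 1))" by (rule of_nat_mono)
  also have "\<dots> = (2 * of_int s + 1) * (2 * of_int s + 1)" using s by simp
  also have "\<dots> \<le> (3 * sqrt R) * (3 * sqrt R)"
    using s assms(2) by (intro mult_mono) (auto intro: order_trans)
  also have "\<dots> = 9 * R" using assms(2) by simp
  finally show ?thesis .
qed

text \<open>
  Each vector with odd first coordinate is an odd multiple of a primitive one, and the sum of
  \<open>1/g\<^sup>2\<close> over all odd \<open>g\<close> is \<open>\<pi>\<^sup>2/8\<close>.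
\<close>

lemma odd_sum_le_prim_sum:
  assumes K: "K > 0"
  shows "(\<Sum>w\<in>odd_vectors K R. 1 / quad_form K w) \<le> pi\<^sup>2 / 8 * (\<Sum>w\<in>prim_vectors K R. 1 / quad_form K w)"
proof -
  define i where "i = (\<lambda>w::int \<times> int. (nat (gcd (fst w) (snd w) div 2), (fst w div gcd (fst w) (snd w), snd w div gcd (fst w) (snd w))))"
  define M where "M = Suc (Max (insert 0 (fst ` i ` odd_vectors K R)))"
  have props: "i w \<in> {..<M} \<times> prim_vectors K R"
      "1 / quad_form K w = 1 / (real (2 * fst (i w)) + 1)\<^sup>2 * (1 / quad_form K (snd (i w)))"
      "w = (int (2 * fst (i w) + 1) * fst (snd (i w)), int (2 * fst (i w) + 1) * snd (snd (i w)))"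
    if w: "w \<in> odd_vectors K R" for w
  proof -
    define g where "g = gcd (fst w) (snd w)"
    have "odd (fst w)" using w by (simp add: odd_vectors_def)
    hence "fst w \<noteq> 0" by auto
    hence g0: "g > 0" by (simp add: g_def)
    have "g dvd fst w" by (simp add: g_def)
    hence "odd g" using \<open>odd (fst w)\<close> by (metis dvd_trans)
    define u v where "u = fst w div g" "v = snd w div g"
    have w_eq: "fst w = g * u" "snd w = g * v" by (simp_all add: u_v_def g_def)
    have gk: "g = int (2 * nat (g div 2) + 1)" using \<open>odd g\<close> g0 by (auto elim!: oddE)
    have iw: "i w = (nat (g div 2), (u, v))" by (simp add: i_def g_def u_v_def)
    have cop: "coprime u v" unfolding u_v_def g_def using \<open>fst w \<noteq> 0\<close> by (intro div_gcd_coprime) simp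
    have "odd u" using \<open>odd (fst w)\<close> w_eq by simp
    have Q: "quad_form K w = (of_int g)\<^sup>2 * quad_form K (u, v)"
      by (simp add: quad_form_def w_eq power_mult_distrib algebra_simps)
    have "quad_form K (u, v) \<ge> 0" by (simp add: quad_form_def)
    moreover have "(1::real) \<le> (of_int g)\<^sup>2" using g0 by simp
    ultimately have "1 * quad_form K (u, v) \<le> quad_form K w" unfolding Q by (intro mult_right_mono) auto
    hence "quad_form K (u, v) < R" using w by (simp add: odd_vectors_def)
    hence "(u, v) \<in> prim_vectors K R" using cop \<open>odd u\<close> by (simp add: prim_vectors_def)
    moreover have "fst (i w) < M"
      unfolding M_def using finite_odd_vectors[OF K] w by (intro le_imp_less_Suc Max_ge) auto
    ultimately show "i w \<in> {..<M} \<times> prim_vectors K R" by (simp add: iw)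
    have "of_int g = real (2 * fst (i w)) + 1"
      by (subst gk) (simp add: iw)
    thus "1 / quad_form K w = 1 / (real (2 * fst (i w)) + 1)\<^sup>2 * (1 / quad_form K (snd (i w)))"
      unfolding Q by (simp add: iw)
    show "w = (int (2 * fst (i w) + 1) * fst (snd (i w)), int (2 * fst (i w) + 1) * snd (snd (i w)))"
      unfolding iw fst_conv snd_conv gk[symmetric] using w_eq by (simp add: prod_eq_iff)
  qed
  have inj: "inj_on i (odd_vectors K R)"
    by (rule inj_onI) (metis props(3))
  have "(\<Sum>w\<in>odd_vectors K R. 1 / quad_form K w) =
        (\<Sum>w\<in>odd_vectors K R. 1 / (real (2 * fst (i w)) + 1)\<^sup>2 * (1 / quad_form K (snd (i w))))"
    by (intro sum.cong refl props(2))
  also have "\<dots> = (\<Sum>p\<in>i ` odd_vectors K R. 1 / (real (2 * fst p) + 1)\<^sup>2 * (1 / quad_form K (snd p)))"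
    using inj by (simp add: sum.reindex)
  also have "\<dots> \<le> (\<Sum>p\<in>{..<M} \<times> prim_vectors K R. 1 / (real (2 * fst p) + 1)\<^sup>2 * (1 / quad_form K (snd p)))"
    by (intro sum_mono2 finite_cartesian_product finite_prim_vectors[OF K] image_subsetI props(1))
       (simp_all add: quad_form_def)
  also have "\<dots> = (\<Sum>k<M. 1 / (real (2 * k) + 1)\<^sup>2) * (\<Sum>w\<in>prim_vectors K R. 1 / quad_form K w)"
    by (simp add: sum_product sum.cartesian_product case_prod_unfold)
  also have "\<dots> \<le> pi\<^sup>2 / 8 * (\<Sum>w\<in>prim_vectors K R. 1 / quad_form K w)"
  proof (rule mult_right_mono)
    show "(\<Sum>k<M. 1 / (real (2 * k) + 1)\<^sup>2) \<le> pi\<^sup>2 / 8"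
      using sum_le_suminf[OF sums_summable[OF inverse_squares_parity_sums(2)], of "{..<M}"]
        sums_unique[OF inverse_squares_parity_sums(2)] by simp
    show "(\<Sum>w\<in>prim_vectors K R. 1 / quad_form K w) \<ge> 0"
      by (intro sum_nonneg) (simp add: quad_form_def)
  qed
  finally show ?thesis .
qed

text \<open>
  Comparison with the integral of \<open>1 / (a\<^sup>2 + x\<^sup>2)\<close>, an arctangent.
\<close>

lemma sum_inverse_quadratic_ge:
  fixes a :: real
  assumes a: "a > 0"
  shows "(\<Sum>j=1..J. 1 / (a\<^sup>2 + (real j)\<^sup>2)) \<ge> pi / (2 * a) - 1 / (real J + 1) - 1 / a\<^sup>2"
proof -
  have step: "arctan ((x + 1) / a) - arctan (x / a) \<le> a * (1 / (a\<^sup>2 + x\<^sup>2))" if x: "x > 0" for x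
  proof -
    have "\<exists>z>x. z < x + 1 \<and> arctan ((x + 1) / a) - arctan (x / a) = (x + 1 - x) * (inverse (1 + (z / a)\<^sup>2) * (1 / a))"
      by (rule MVT2) (auto intro!: derivative_eq_intros simp: a less_imp_neq[symmetric] field_simps)
    then obtain z where z: "z > x" and eq: "arctan ((x + 1) / a) - arctan (x / a) = inverse (1 + (z / a)\<^sup>2) * (1 / a)"
      by auto
    have "inverse (1 + (z / a)\<^sup>2) * (1 / a) = a / (a\<^sup>2 + z\<^sup>2)"
      using a by (simp add: field_simps power2_eq_square)
    also have "\<dots> \<le> a / (a\<^sup>2 + x\<^sup>2)"
      using a z x by (intro divide_left_mono add_left_mono power_mono mult_pos_pos add_pos_pos) auto
    finally show ?thesis unfolding eq by simp
  qed
  have tele: "arctan ((real J + 1) / a) - arctan (1 / a) \<le> a * (\<Sum>j=1..J. 1 / (a\<^sup>2 + (real j)\<^sup>2))"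
  proof (induction J)
    case (Suc J)
    have "arctan ((real (Suc J) + 1) / a) - arctan (real (Suc J) / a) \<le> a * (1 / (a\<^sup>2 + (real (Suc J))\<^sup>2))"
      using step[of "real (Suc J)"] by simp
    moreover have "real (Suc J) / a = (real J + 1) / a" by (simp add: add.commute)
    moreover have "(\<Sum>j=1..Suc J. 1 / (a\<^sup>2 + (real j)\<^sup>2)) = (\<Sum>j=1..J. 1 / (a\<^sup>2 + (real j)\<^sup>2)) + 1 / (a\<^sup>2 + (real (Suc J))\<^sup>2)"
      by simp
    ultimately show ?case using Suc by (simp only: distrib_left)
  qed simp
  have "arctan ((real J + 1) / a) = pi / 2 - arctan (a / (real J + 1))"
    using arctan_inverse[of "a / (real J + 1)"] a by (simp add: sgn_if)
  moreover have "arctan (a / (real J + 1)) \<le> a / (real J + 1)" "arctan (1 / a) \<le> 1 / a"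
    using a by (auto intro!: arctan_le_self)
  ultimately have "pi / 2 - a / (real J + 1) - 1 / a \<le> a * (\<Sum>j=1..J. 1 / (a\<^sup>2 + (real j)\<^sup>2))"
    using tele by linarith
  hence "(pi / 2 - a / (real J + 1) - 1 / a) / a \<le> (\<Sum>j=1..J. 1 / (a\<^sup>2 + (real j)\<^sup>2))"
    by (subst pos_divide_le_eq[OF a]) (simp only: mult.commute[of a])
  also have "(pi / 2 - a / (real J + 1) - 1 / a) / a = pi / (2 * a) - 1 / (real J + 1) - 1 / a\<^sup>2"
    using a by (simp add: diff_divide_distrib power2_eq_square)
  finally show ?thesis .
qed

lemma sum_odd_reciprocals_ge: "(\<Sum>i<I. 1 / real (2 * i + 1)) \<ge> ln (real (2 * I + 1)) / 2"
proof (induction I)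
  case (Suc I)
  have "ln (real (2 * Suc I + 1)) - ln (real (2 * I + 1)) = ln (1 + 2 / real (2 * I + 1))"
    by (subst ln_divide_pos[symmetric]) (auto simp: field_simps)
  also have "\<dots> \<le> 2 / real (2 * I + 1)" by (rule ln_add_one_self_le_self) simp
  finally have "ln (real (2 * Suc I + 1)) / 2 \<le> ln (real (2 * I + 1)) / 2 + 1 / real (2 * I + 1)" by linarith
  thus ?case using Suc by (simp only: sum.lessThan_Suc)
qed simp

text \<open>
  Restrict the sum to the vectors with \<open>\<bar>K n\<bar>\<close> and \<open>\<bar>m\<bar>\<close> at most \<open>\<surd>R/2\<close>. Summation over \<open>m\<close> leaves \<open>\<pi>/(K \<bar>n\<bar>)\<close> up to
  summable errors, and the odd numbers \<open>n\<close> below \<open>\<surd>R/(2K)\<close> contribute half a logarithm for each sign.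
\<close>

lemma odd_sum_ge:
  assumes K: "K > 0" and R: "R \<ge> 1"
  shows "(\<Sum>w\<in>odd_vectors K R. 1 / quad_form K w) \<ge> pi / (2 * real K) * ln R - 4 * (pi / (4 * real K) * ln (2 * real K) + 1 + pi\<^sup>2 / 8)"
proof -
  define M where "M = nat \<lfloor>sqrt R / 2\<rfloor>"
  define I where "I = (M div K + 1) div 2"
  have M: "real M \<le> sqrt R / 2" "sqrt R / 2 < real M + 1"
    using R by (auto simp: M_def) linarith+
  have M2: "(real m)\<^sup>2 \<le> R / 4" if "m \<le> M" for m
  proof -
    have "(real m)\<^sup>2 \<le> (sqrt R / 2)\<^sup>2" using that M(1) by (intro power_mono) auto
    thus ?thesis using R by (simp add: power_divide)
  qed
  have KI: "K * (2 * i + 1) \<le> M" if "i < I" for i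
  proof -
    have "2 * i + 1 \<le> M div K" using that by (simp add: I_def)
    hence "K * (2 * i + 1) \<le> K * (M div K)" by (rule mult_le_mono2)
    also have "\<dots> \<le> M" by simp
    finally show ?thesis .
  qed
  have I_ge: "2 * I + 1 \<ge> M div K + 1" by (simp add: I_def)
  have IM: "real I \<le> real M + 1"
  proof -
    have "I \<le> M div K + 1" by (simp add: I_def)
    also have "M div K \<le> M" by simp
    finally show ?thesis by simp
  qed
  define h where "h = (\<lambda>((s, t), (i, j)). (s * (2 * int i + 1), t * int j))"
  define D where "D = ({1, -1 :: int} \<times> {1, -1 :: int}) \<times> ({..<I} \<times> {1..M})"
  have quad_h: "quad_form K (h p) = (real K * real (2 * fst (snd p) + 1))\<^sup>2 + (real (snd (snd p)))\<^sup>2" if "p \<in> D" for p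
    using that by (auto simp: D_def h_def quad_form_def power_mult_distrib power2_eq_square algebra_simps)
  have sub: "h ` D \<subseteq> odd_vectors K R"
  proof
    fix w assume "w \<in> h ` D"
    then obtain p where p: "p \<in> D" "w = h p" by blast
    have "odd (fst w)" using p by (auto simp: D_def h_def)
    moreover have "quad_form K w < R"
    proof -
      have "K * (2 * fst (snd p) + 1) \<le> M" "snd (snd p) \<le> M" using p(1) KI by (auto simp: D_def)
      from M2[OF this(1)] M2[OF this(2)] show ?thesis
        unfolding p(2) quad_h[OF p(1)] of_nat_mult using R by linarith
    qed
    ultimately show "w \<in> odd_vectors K R" by (simp add: odd_vectors_def)
  qed
  have inj: "inj_on h D"
  proof (rule inj_onI)
    fix p q assume pq: "p \<in> D" "q \<in> D" "h p = h q"
    obtain s t i j where p: "p = ((s, t), (i, j))" by (metis prod.exhaust)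
    obtain s' t' i' j' where q: "q = ((s', t'), (i', j'))" by (metis prod.exhaust)
    show "p = q" using pq by (auto simp: D_def h_def p q)
  qed
  have "(\<Sum>p\<in>D. 1 / ((real K * real (2 * fst (snd p) + 1))\<^sup>2 + (real (snd (snd p)))\<^sup>2)) = (\<Sum>p\<in>D. 1 / quad_form K (h p))"
    using quad_h by simp
  also have "\<dots> = (\<Sum>w\<in>h ` D. 1 / quad_form K w)" using inj by (simp add: sum.reindex)
  also have "\<dots> \<le> (\<Sum>w\<in>odd_vectors K R. 1 / quad_form K w)"
    by (intro sum_mono2 finite_odd_vectors K sub) (simp add: quad_form_def)
  finally have main: "(\<Sum>p\<in>D. 1 / ((real K * real (2 * fst (snd p) + 1))\<^sup>2 + (real (snd (snd p)))\<^sup>2)) \<le> (\<Sum>w\<in>odd_vectors K R. 1 / quad_form K w)" .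
  have "(\<Sum>p\<in>D. 1 / ((real K * real (2 * fst (snd p) + 1))\<^sup>2 + (real (snd (snd p)))\<^sup>2)) =
        4 * (\<Sum>i<I. \<Sum>j=1..M. 1 / ((real K * real (2 * i + 1))\<^sup>2 + (real j)\<^sup>2))"
  proof -
    have "(\<Sum>p\<in>A \<times> B. f (snd p)) = real (card A) * (\<Sum>b\<in>B. f b)" for A :: "(int \<times> int) set" and B :: "(nat \<times> nat) set" and f :: "nat \<times> nat \<Rightarrow> real"
      by (subst sum.cartesian_product') simp
    note eq = this[where A = "{1, -1} \<times> {1, -1}" and B = "{..<I} \<times> {1..M}" and f = "\<lambda>b. 1 / ((real K * real (2 * fst b + 1))\<^sup>2 + (real (snd b))\<^sup>2)"]
    have "card ({1, -1 :: int} \<times> {1, -1 :: int}) = 4" by (simp add: card_cartesian_product)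
    thus ?thesis unfolding D_def eq by (simp only: sum.cartesian_product') simp
  qed
  moreover have "(\<Sum>i<I. \<Sum>j=1..M. 1 / ((real K * real (2 * i + 1))\<^sup>2 + (real j)\<^sup>2)) \<ge>
      pi / (8 * real K) * ln R - (pi / (4 * real K) * ln (2 * real K) + 1 + pi\<^sup>2 / 8)"
  proof -
    have "pi / (2 * real K) * (1 / real (2 * i + 1)) - 1 / (real M + 1) - 1 / (real (2 * i) + 1)\<^sup>2 \<le>
          (\<Sum>j=1..M. 1 / ((real K * real (2 * i + 1))\<^sup>2 + (real j)\<^sup>2))" for i
    proof -
      have "pi / (2 * (real K * real (2 * i + 1))) - 1 / (real M + 1) - 1 / (real K * real (2 * i + 1))\<^sup>2 \<le>
          (\<Sum>j=1..M. 1 / ((real K * real (2 * i + 1))\<^sup>2 + (real j)\<^sup>2))"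
        by (rule sum_inverse_quadratic_ge) (use K in auto)
      moreover have "1 / (real K * real (2 * i + 1))\<^sup>2 \<le> 1 / (real (2 * i) + 1)\<^sup>2"
      proof (rule divide_left_mono)
        have "1 * (real (2 * i) + 1) \<le> real K * real (2 * i + 1)" using K by (intro mult_mono) auto
        thus "(real (2 * i) + 1)\<^sup>2 \<le> (real K * real (2 * i + 1))\<^sup>2" by (intro power_mono) auto
        show "0 < (real K * real (2 * i + 1))\<^sup>2 * (real (2 * i) + 1)\<^sup>2" using K by (intro mult_pos_pos) auto
      qed simp
      moreover have "pi / (2 * (real K * real (2 * i + 1))) = pi / (2 * real K) * (1 / real (2 * i + 1))" by simp
      ultimately show ?thesis by linarith
    qed
    hence "(\<Sum>i<I. \<Sum>j=1..M. 1 / ((real K * real (2 * i + 1))\<^sup>2 + (real j)\<^sup>2)) \<ge>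
       (\<Sum>i<I. pi / (2 * real K) * (1 / real (2 * i + 1)) - 1 / (real M + 1) - 1 / (real (2 * i) + 1)\<^sup>2)"
      by (intro sum_mono)
    moreover have "(\<Sum>i<I. pi / (2 * real K) * (1 / real (2 * i + 1)) - 1 / (real M + 1) - 1 / (real (2 * i) + 1)\<^sup>2) =
       pi / (2 * real K) * (\<Sum>i<I. 1 / real (2 * i + 1)) - real I / (real M + 1) - (\<Sum>i<I. 1 / (real (2 * i) + 1)\<^sup>2)"
      by (simp add: sum_subtractf sum_distrib_left)
    moreover have "(\<Sum>i<I. 1 / (real (2 * i) + 1)\<^sup>2) \<le> pi\<^sup>2 / 8"
      using sum_le_suminf[OF sums_summable[OF inverse_squares_parity_sums(2)], of "{..<I}"]
        sums_unique[OF inverse_squares_parity_sums(2)] by simp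
    moreover have "real I / (real M + 1) \<le> 1" using IM by (simp add: field_simps)
    moreover have "pi / (2 * real K) * (\<Sum>i<I. 1 / real (2 * i + 1)) \<ge> pi / (8 * real K) * ln R - pi / (4 * real K) * ln (2 * real K)"
    proof -
      have "sqrt R / (2 * real K) \<le> real (2 * I + 1)"
      proof -
        have "M < K * (M div K + 1)" using K by (metis Suc_eq_plus1 dividend_less_times_div mult.commute mult_Suc_right add.commute)
        hence "M + 1 \<le> K * (2 * I + 1)" using mult_le_mono2[OF I_ge, of K] by linarith
        hence "real (M + 1) \<le> real (K * (2 * I + 1))" by (rule of_nat_mono)
        hence "sqrt R / 2 \<le> real K * real (2 * I + 1)" using M(2) by (simp only: of_nat_mult of_nat_add of_nat_1)
        thus ?thesis using K by (simp add: field_simps)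
      qed
      hence "ln (sqrt R / (2 * real K)) \<le> ln (real (2 * I + 1))"
        using K R by (subst ln_le_cancel_iff) auto
      also have "ln (sqrt R / (2 * real K)) = ln R / 2 - ln (2 * real K)"
        using K R by (simp add: ln_div ln_sqrt)
      finally have "(ln R / 2 - ln (2 * real K)) / 2 \<le> (\<Sum>i<I. 1 / real (2 * i + 1))"
      proof -
        have *: "x / 2 \<le> z" if "x \<le> y" "y / 2 \<le> z" for x y z :: real using that by linarith
        assume "ln R / 2 - ln (2 * real K) \<le> ln (real (2 * I + 1))"
        from this sum_odd_reciprocals_ge[of I] show ?thesis by (rule *)
      qed
      hence "pi / (2 * real K) * ((ln R / 2 - ln (2 * real K)) / 2) \<le> pi / (2 * real K) * (\<Sum>i<I. 1 / real (2 * i + 1))"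
        by (intro mult_left_mono) auto
      thus ?thesis by (simp add: algebra_simps diff_divide_distrib)
    qed
    ultimately show ?thesis by linarith
  qed
  ultimately show ?thesis using main by (simp add: algebra_simps)
qed

theorem prim_sum_ge:
  assumes K: "K > 0"
  obtains C where "C \<ge> 0" "\<And>R. R \<ge> 1 \<Longrightarrow> (\<Sum>w\<in>prim_vectors K R. 1 / quad_form K w) \<ge> 4 / (pi * real K) * ln R - C"
proof -
  define C0 where "C0 = 4 * (pi / (4 * real K) * ln (2 * real K) + 1 + pi\<^sup>2 / 8)"
  have C0: "C0 \<ge> 0" using K by (simp add: C0_def)
  show ?thesis
  proof (rule that[of "8 / pi\<^sup>2 * C0"])
    fix R :: real assume R: "R \<ge> 1"
    have "pi / (2 * real K) * ln R - C0 \<le> pi\<^sup>2 / 8 * (\<Sum>w\<in>prim_vectors K R. 1 / quad_form K w)"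
      using odd_sum_ge[OF K R] odd_sum_le_prim_sum[OF K, of R] unfolding C0_def by linarith
    hence "8 / pi\<^sup>2 * (pi / (2 * real K) * ln R - C0) \<le> 8 / pi\<^sup>2 * (pi\<^sup>2 / 8 * (\<Sum>w\<in>prim_vectors K R. 1 / quad_form K w))"
      by (intro mult_left_mono) auto
    also have "\<dots> = (\<Sum>w\<in>prim_vectors K R. 1 / quad_form K w)" by simp
    also have "8 / pi\<^sup>2 * (pi / (2 * real K) * ln R - C0) = 4 / (pi * real K) * ln R - 8 / pi\<^sup>2 * C0"
      by (simp add: right_diff_distrib power2_eq_square)
    finally show "(\<Sum>w\<in>prim_vectors K R. 1 / quad_form K w) \<ge> 4 / (pi * real K) * ln R - 8 / pi\<^sup>2 * C0" .
  qed (use C0 in simp)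
qed

section \<open>Divisor sums\<close>

text \<open>
  The number of rows modulo \<open>N\<close> whose first entry has the greatest common divisor \<open>d\<close> with \<open>N\<close>
  (\<open>sum_prim_rows_gcd\<close>).
\<close>

definition div_weight :: "nat \<Rightarrow> nat \<Rightarrow> real" where
  "div_weight N d = real (totient (N div d)) * real (totient d) * real (N div d)"

definition div_sum :: "nat \<Rightarrow> real" where
  "div_sum N = (\<Sum>d | d dvd N. div_weight N d)"

definition div_log_sum :: "nat \<Rightarrow> real" where
  "div_log_sum N = (\<Sum>d | d dvd N. div_weight N d * ln (real d))"

lemma bij_betw_divisors_coprime:
  assumes "coprime A B" "A > 0" "B > (0::nat)"
  shows "bij_betw (\<lambda>(a, b). a * b) ({a. a dvd A} \<times> {b. b dvd B}) {d. d dvd A * B}"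
proof (rule bij_betwI')
  fix p q assume pq: "p \<in> {a. a dvd A} \<times> {b. b dvd B}" "q \<in> {a. a dvd A} \<times> {b. b dvd B}"
  obtain a b a' b' where eqs: "p = (a, b)" "q = (a', b')" by (cases p, cases q)
  have d: "a dvd A" "b dvd B" "a' dvd A" "b' dvd B" using pq by (auto simp: eqs)
  have cop: "coprime a b'" "coprime a' b" using coprime_divisors[OF d(1,4) assms(1)] coprime_divisors[OF d(3,2) assms(1)] by auto
  have pos: "a > 0" "b > 0" "a' > 0" "b' > 0" using d assms by (auto intro: Nat.gr0I)
  have "a = a'" if "a * b = a' * b'"
  proof (rule dvd_antisym)
    show "a dvd a'" using that cop(1) by (metis coprime_dvd_mult_left_iff dvd_triv_left)
    show "a' dvd a" using that cop(2) by (metis coprime_dvd_mult_left_iff dvd_triv_left)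
  qed
  thus "((case p of (a, b) \<Rightarrow> a * b) = (case q of (a, b) \<Rightarrow> a * b)) = (p = q)"
    using pos by (auto simp: eqs)
next
  fix p assume "p \<in> {a. a dvd A} \<times> {b. b dvd B}"
  thus "(case p of (a, b) \<Rightarrow> a * b) \<in> {d. d dvd A * B}" by (auto intro: mult_dvd_mono)
next
  fix d assume "d \<in> {d. d dvd A * B}"
  hence "d dvd A * B" by simp
  then obtain x y where "d = x * y" "x dvd A" "y dvd B" by (rule dvd_productE)
  thus "\<exists>p\<in>{a. a dvd A} \<times> {b. b dvd B}. d = (case p of (a, b) \<Rightarrow> a * b)" by auto
qed

lemma div_weight_mult:
  assumes "coprime A B" "A > 0" "B > 0" "a dvd A" "b dvd B"
  shows "div_weight (A * B) (a * b) = div_weight A a * div_weight B b"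
proof -
  have "A * B div (a * b) = (A div a) * (B div b)" using assms(4,5) by (rule div_mult_div_if_dvd[symmetric])
  moreover have "coprime (A div a) (B div b)"
  proof (rule coprime_divisors[OF _ _ assms(1)])
    show "A div a dvd A" using dvd_div_mult_self[OF assms(4)] by (metis dvd_triv_left)
    show "B div b dvd B" using dvd_div_mult_self[OF assms(5)] by (metis dvd_triv_left)
  qed
  moreover have "coprime a b" by (rule coprime_divisors[OF assms(4,5,1)])
  ultimately show ?thesis by (simp add: div_weight_def totient_mult_coprime)
qed

lemma div_sums_mult:
  assumes "coprime A B" "A > 0" "B > 0"
  shows "div_sum (A * B) = div_sum A * div_sum B"
    and "div_log_sum (A * B) = div_log_sum A * div_sum B + div_sum A * div_log_sum B"
proof -
  note bij = bij_betw_divisors_coprime[OF assms]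
  have w: "div_weight (A * B) (fst p * snd p) = div_weight A (fst p) * div_weight B (snd p)"
    if "p \<in> {a. a dvd A} \<times> {b. b dvd B}" for p
    using that div_weight_mult[OF assms] by auto
  have "div_sum (A * B) = (\<Sum>p\<in>{a. a dvd A} \<times> {b. b dvd B}. div_weight (A * B) (fst p * snd p))"
    unfolding div_sum_def using sum.reindex_bij_betw[OF bij, of "div_weight (A * B)"]
    by (simp add: case_prod_unfold)
  also have "\<dots> = (\<Sum>p\<in>{a. a dvd A} \<times> {b. b dvd B}. div_weight A (fst p) * div_weight B (snd p))"
    by (intro sum.cong refl w)
  also have "\<dots> = div_sum A * div_sum B"
    by (simp add: div_sum_def sum_product sum.cartesian_product case_prod_unfold)
  finally show "div_sum (A * B) = div_sum A * div_sum B" .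
  have "div_log_sum (A * B) = (\<Sum>p\<in>{a. a dvd A} \<times> {b. b dvd B}. div_weight (A * B) (fst p * snd p) * ln (real (fst p * snd p)))"
    unfolding div_log_sum_def using sum.reindex_bij_betw[OF bij, of "\<lambda>d. div_weight (A * B) d * ln (real d)"]
    by (simp add: case_prod_unfold)
  also have "\<dots> = (\<Sum>p\<in>{a. a dvd A} \<times> {b. b dvd B}. (div_weight A (fst p) * ln (real (fst p))) * div_weight B (snd p) +
        div_weight A (fst p) * (div_weight B (snd p) * ln (real (snd p))))"
  proof (rule sum.cong[OF refl])
    fix p assume p: "p \<in> {a. a dvd A} \<times> {b. b dvd B}"
    hence "fst p > 0" "snd p > 0" using assms by (auto intro: Nat.gr0I)
    thus "div_weight (A * B) (fst p * snd p) * ln (real (fst p * snd p)) =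
        (div_weight A (fst p) * ln (real (fst p))) * div_weight B (snd p) +
        div_weight A (fst p) * (div_weight B (snd p) * ln (real (snd p)))"
      unfolding w[OF p] by (simp add: ln_mult algebra_simps)
  qed
  also have "\<dots> = div_log_sum A * div_sum B + div_sum A * div_log_sum B"
    by (simp add: div_log_sum_def div_sum_def sum_product sum.cartesian_product case_prod_unfold sum.distrib)
  finally show "div_log_sum (A * B) = div_log_sum A * div_sum B + div_sum A * div_log_sum B" .
qed

lemma dedekind_psi_mult:
  assumes "coprime A B" "A > 0" "B > 0"
  shows "dedekind_psi (A * B) = dedekind_psi A * dedekind_psi B"
proof -
  have "prime_factors A \<inter> prime_factors B = {}"
    using assms(1) by (auto simp: in_prime_factors_iff) (metis coprime_common_divisor not_prime_unit)
  thus ?thesis using assms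
    by (simp add: dedekind_psi_def prime_factors_product prod.union_disjoint)
qed

lemma lambda_mult:
  assumes "coprime A B" "A > 0" "B > 0"
  shows "lambda (A * B) = lambda A + lambda B"
proof -
  have disj: "prime_factors A \<inter> prime_factors B = {}"
    using assms(1) by (auto simp: in_prime_factors_iff) (metis coprime_common_divisor not_prime_unit)
  have mult: "multiplicity p (A * B) = multiplicity p A + multiplicity p B" if "prime p" for p
    using that assms by (intro prime_elem_multiplicity_mult_distrib) auto
  have A: "multiplicity p (A * B) = multiplicity p A" if p: "p \<in> prime_factors A" for p
  proof -
    have "\<not> p dvd B" using p disj assms(3) by (auto simp: in_prime_factors_iff)
    thus ?thesis using mult[of p] p by (simp add: not_dvd_imp_multiplicity_0 in_prime_factors_iff)
  qed
  have B: "multiplicity p (A * B) = multiplicity p B" if p: "p \<in> prime_factors B" for p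
  proof -
    have "\<not> p dvd A" using p disj assms(2) by (auto simp: in_prime_factors_iff)
    thus ?thesis using mult[of p] p by (simp add: not_dvd_imp_multiplicity_0 in_prime_factors_iff)
  qed
  have "prime_factors (A * B) = prime_factors A \<union> prime_factors B"
    using assms by (intro prime_factors_product) auto
  thus ?thesis unfolding lambda_def using disj A B by (simp add: sum.union_disjoint)
qed

lemma geometric_closed_forms:
  fixes x :: real
  shows "(x - 1) * (\<Sum>k=1..m. x ^ (m + 1 - k)) = x ^ (m + 1) - x"
    and "(x - 1)\<^sup>2 * (\<Sum>k=1..m. real k * x ^ (m + 1 - k)) = x ^ (m + 2) - (real m + 1) * x\<^sup>2 + real m * x"
proof -
  have rec1: "(\<Sum>k=1..Suc m. x ^ (Suc m + 1 - k)) = x * (\<Sum>k=1..m. x ^ (m + 1 - k)) + x" for m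
  proof -
    have "(\<Sum>k=1..m. x ^ (Suc m + 1 - k)) = (\<Sum>k=1..m. x * x ^ (m + 1 - k))"
      by (intro sum.cong refl) (auto simp: Suc_diff_le simp flip: power_Suc)
    thus ?thesis by (simp add: sum_distrib_left)
  qed
  have rec2: "(\<Sum>k=1..Suc m. real k * x ^ (Suc m + 1 - k)) = x * (\<Sum>k=1..m. real k * x ^ (m + 1 - k)) + (real m + 1) * x" for m
  proof -
    have "(\<Sum>k=1..m. real k * x ^ (Suc m + 1 - k)) = (\<Sum>k=1..m. x * (real k * x ^ (m + 1 - k)))"
    proof (intro sum.cong refl)
      fix k assume "k \<in> {1..m}"
      hence "Suc m + 1 - k = Suc (m + 1 - k)" by auto
      thus "real k * x ^ (Suc m + 1 - k) = x * (real k * x ^ (m + 1 - k))" by simp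
    qed
    thus ?thesis by (simp add: sum_distrib_left algebra_simps)
  qed
  show "(x - 1) * (\<Sum>k=1..m. x ^ (m + 1 - k)) = x ^ (m + 1) - x"
  proof (induction m)
    case (Suc m)
    have "(x - 1) * (\<Sum>k=1..Suc m. x ^ (Suc m + 1 - k)) = x * ((x - 1) * (\<Sum>k=1..m. x ^ (m + 1 - k))) + (x - 1) * x"
      unfolding rec1 by (simp add: algebra_simps)
    also have "\<dots> = x ^ (Suc m + 1) - x" unfolding Suc by (simp add: algebra_simps)
    finally show ?case .
  qed simp
  show "(x - 1)\<^sup>2 * (\<Sum>k=1..m. real k * x ^ (m + 1 - k)) = x ^ (m + 2) - (real m + 1) * x\<^sup>2 + real m * x"
  proof (induction m)
    case (Suc m)
    have "(x - 1)\<^sup>2 * (\<Sum>k=1..Suc m. real k * x ^ (Suc m + 1 - k)) =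
          x * ((x - 1)\<^sup>2 * (\<Sum>k=1..m. real k * x ^ (m + 1 - k))) + (x - 1)\<^sup>2 * (real m + 1) * x"
      unfolding rec2 by (simp add: algebra_simps)
    also have "\<dots> = x ^ (Suc m + 2) - (real (Suc m) + 1) * x\<^sup>2 + real (Suc m) * x"
      unfolding Suc by (simp add: algebra_simps power2_eq_square)
    finally show ?case .
  qed (simp add: power2_eq_square)
qed

text \<open>
  The weights at \<open>1\<close> and at \<open>p\<^sup>n\<close> do not fit the geometric pattern of the others and are split off.
\<close>

lemma prime_power_div_sums:
  fixes p m :: nat
  assumes p: "prime p"
  defines "n \<equiv> Suc m"
  shows "div_sum (p ^ n) = totient (p ^ n) * dedekind_psi (p ^ n)"
    and "div_log_sum (p ^ n) = totient (p ^ n) * dedekind_psi (p ^ n) * lambda (p ^ n)"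
proof -
  define x where "x = real p"
  have p2: "p \<ge> 2" using p by (rule prime_ge_2_nat)
  hence x: "x \<ge> 2" by (simp add: x_def)
  have tot: "real (totient (p ^ k)) = x ^ (k - 1) * (x - 1)" if "k > 0" for k
    using that p p2 by (simp add: totient_prime_power x_def of_nat_diff)
  have divs: "{d. d dvd p ^ n} = (\<lambda>k. p ^ k) ` {..n}"
    using p by (auto simp: divides_primepow_nat)
  have inj: "inj_on (\<lambda>k. p ^ k) {..n}" using p2 by (auto intro!: inj_onI)
  define W where "W = (\<lambda>k. div_weight (p ^ n) (p ^ k))"
  have diff: "p ^ n div p ^ k = p ^ (n - k)" if "k \<le> n" for k
    using that p2 by (simp add: power_diff)
  have W0: "W 0 = x ^ m * (x - 1) * x ^ n"
    using tot[of n] by (simp add: W_def div_weight_def n_def x_def)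
  have Wn: "W n = x ^ m * (x - 1)"
    using tot[of n] diff[of n] p2 by (simp add: W_def div_weight_def n_def)
  have Wk: "x * W k = (x - 1)\<^sup>2 * x ^ m * x ^ (m + 1 - k)" if k: "k \<in> {1..m}" for k
  proof -
    have "W k = (x ^ (n - k - 1) * (x - 1)) * (x ^ (k - 1) * (x - 1)) * x ^ (n - k)"
      using tot[of "n - k"] tot[of k] diff[of k] k by (simp add: W_def div_weight_def n_def x_def)
    hence "x * W k = (x - 1)\<^sup>2 * (x * (x ^ (n - k - 1) * x ^ (k - 1))) * x ^ (n - k)"
      by (simp add: power2_eq_square)
    also have "x * (x ^ (n - k - 1) * x ^ (k - 1)) = x ^ m"
    proof -
      have "Suc (n - k - 1 + (k - 1)) = m" using k by (auto simp: n_def)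
      thus ?thesis unfolding power_add[symmetric] power_Suc[symmetric] by simp
    qed
    finally show ?thesis by (simp add: n_def)
  qed
  have split: "(\<Sum>k\<le>n. f k) = f 0 + (\<Sum>k=1..m. f k) + f n" for f :: "nat \<Rightarrow> real"
  proof -
    have "{..n} = {0} \<union> {1..m} \<union> {n}" by (auto simp: n_def)
    thus ?thesis by (simp add: n_def add.assoc)
  qed
  have "div_sum (p ^ n) = (\<Sum>k\<le>n. W k)"
    unfolding div_sum_def divs W_def using inj by (simp add: sum.reindex)
  hence "x * div_sum (p ^ n) = x * W 0 + (\<Sum>k=1..m. x * W k) + x * W n"
    by (simp add: split algebra_simps sum_distrib_left)
  also have "(\<Sum>k=1..m. x * W k) = (x - 1) * x ^ m * ((x - 1) * (\<Sum>k=1..m. x ^ (m + 1 - k)))"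
    using Wk by (simp add: sum_distrib_left power2_eq_square mult_ac)
  also have "\<dots> = (x - 1) * x ^ m * (x ^ (m + 1) - x)" by (simp only: geometric_closed_forms)
  also have "x * W 0 + (x - 1) * x ^ m * (x ^ (m + 1) - x) + x * W n = x * (x ^ m * (x - 1) * (x ^ m * (x + 1)))"
    unfolding W0 Wn unfolding n_def by (simp add: algebra_simps)
  finally have S: "div_sum (p ^ n) = x ^ m * (x - 1) * (x ^ m * (x + 1))" using x by simp
  have psi: "dedekind_psi (p ^ n) = x ^ m * (x + 1)"
  proof -
    have "prime_factors (p ^ n) = {p}"
      using p prime_factors_power[of n p] by (simp add: n_def prime_prime_factors del: power_Suc)
    thus ?thesis using x by (simp add: dedekind_psi_def n_def x_def field_simps)
  qed
  have totn: "real (totient (p ^ n)) = x ^ m * (x - 1)" using tot[of n] by (simp add: n_def)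
  show "div_sum (p ^ n) = totient (p ^ n) * dedekind_psi (p ^ n)" unfolding S psi totn ..
  have lam: "lambda (p ^ n) = (x ^ n - 1) / (x ^ m * (x\<^sup>2 - 1)) * ln x"
  proof -
    have "prime_factors (p ^ n) = {p}"
      using p prime_factors_power[of n p] by (simp add: n_def prime_prime_factors del: power_Suc)
    moreover have "multiplicity p (p ^ n) = n" using p by simp
    ultimately show ?thesis by (simp add: lambda_def x_def n_def)
  qed
  have "div_log_sum (p ^ n) = (\<Sum>k\<le>n. W k * ln (real (p ^ k)))"
    unfolding div_log_sum_def divs W_def using inj by (simp add: sum.reindex)
  also have "\<dots> = (\<Sum>k\<le>n. real k * W k) * ln x"
    unfolding sum_distrib_right
  proof (rule sum.cong[OF refl])
    fix k
    show "W k * ln (real (p ^ k)) = real k * W k * ln x" using p2 by (simp add: ln_realpow x_def)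
  qed
  finally have "x * div_log_sum (p ^ n) = (x * (real 0 * W 0) + (\<Sum>k=1..m. real k * (x * W k)) + x * (real n * W n)) * ln x"
    by (simp add: split algebra_simps sum_distrib_left)
  also have "(\<Sum>k=1..m. real k * (x * W k)) = x ^ m * ((x - 1)\<^sup>2 * (\<Sum>k=1..m. real k * x ^ (m + 1 - k)))"
    using Wk by (simp add: sum_distrib_left mult_ac)
  also have "\<dots> = x ^ m * (x ^ (m + 2) - (real m + 1) * x\<^sup>2 + real m * x)" by (simp only: geometric_closed_forms)
  also have "(x * (real 0 * W 0) + x ^ m * (x ^ (m + 2) - (real m + 1) * x\<^sup>2 + real m * x) + x * (real n * W n)) * ln x
      = x * (x ^ m * (x ^ n - 1) * ln x)"
    unfolding Wn unfolding n_def by (simp add: algebra_simps power2_eq_square)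
  finally have L: "div_log_sum (p ^ n) = x ^ m * (x ^ n - 1) * ln x" using x by simp
  have "x\<^sup>2 - 1 = (x - 1) * (x + 1)" by (simp add: algebra_simps power2_eq_square)
  moreover have "x\<^sup>2 - 1 \<noteq> 0" using x power_mono[of 2 x 2] by auto
  ultimately show "div_log_sum (p ^ n) = totient (p ^ n) * dedekind_psi (p ^ n) * lambda (p ^ n)"
    unfolding L psi totn lam using x by (simp add: field_simps)
qed

text \<open>
  Thus \<open>lambda N\<close> is the mean of \<open>ln d\<close> over the rows, where \<open>d\<close> belongs to the first entry.
  Both sides behave in the same way under products
  of coprime factors, which leaves prime powers.
\<close>

lemma div_sum_values:
  assumes "N > 0"
  shows "div_sum N = totient N * dedekind_psi N \<and> div_log_sum N = totient N * dedekind_psi N * lambda N"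
  using assms
proof (induction N rule: less_induct)
  case (less N)
  show ?case
  proof (cases "N = 1")
    case True
    thus ?thesis by (simp add: div_sum_def div_log_sum_def div_weight_def dedekind_psi_def lambda_def)
  next
    case False
    then obtain p where p: "prime p" "p dvd N" using prime_factor_nat by blast
    define n where "n = multiplicity p N"
    have "N \<noteq> 0" "\<not> is_unit p" using less.prems p(1) not_prime_unit[of p] by auto
    from multiplicity_decompose'[OF this] obtain m where m: "N = p ^ n * m" "\<not> p dvd m"
      unfolding n_def by blast
    have "n > 0" using p less.prems by (simp add: n_def prime_multiplicity_gt_zero_iff)
    then obtain k where k: "n = Suc k" by (cases n) auto
    have m0: "m > 0" using m less.prems by (auto intro: Nat.gr0I)
    have cop: "coprime (p ^ n) m" using p(1) m(2) by (simp add: prime_imp_coprime)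
    have pn: "p ^ n > 0" using p(1) by (simp add: prime_gt_0_nat)
    have "p ^ n > 1" using prime_gt_1_nat[OF p(1)] \<open>n > 0\<close> by (rule one_less_power)
    hence "m < N" using m0 m(1) by simp
    note IH = less.IH[OF this m0]
    note pp = prime_power_div_sums[OF p(1), of k, folded k]
    show ?thesis
      unfolding m(1) div_sums_mult[OF cop pn m0] dedekind_psi_mult[OF cop pn m0] lambda_mult[OF cop pn m0]
        totient_mult_coprime[OF cop] using IH pp by (simp add: algebra_simps)
  qed
qed

section \<open>Counting rows by their greatest common divisor\<close>

lemma card_coprime_multiple_range:
  assumes "G > 0"
  shows "card {y \<in> {0..<int (G * t)}. coprime y (int G)} = t * totient G"
proof (induction t)
  case (Suc t)
  have eq: "{y \<in> {0..<int (G * Suc t)}. coprime y (int G)} =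
        {y \<in> {0..<int (G * t)}. coprime y (int G)} \<union> (\<lambda>y. int (G * t) + y) ` {y \<in> {0..<int G}. coprime y (int G)}"
  proof safe
    fix y assume y: "y \<in> {0..<int (G * Suc t)}" "coprime y (int G)"
      "y \<notin> (\<lambda>y. int (G * t) + y) ` {y \<in> {0..<int G}. coprime y (int G)}"
    show "y \<in> {0..<int (G * t)}"
    proof (rule ccontr)
      assume "y \<notin> {0..<int (G * t)}"
      hence "y - int (G * t) \<in> {0..<int G}" using y(1) by (auto simp: algebra_simps)
      moreover have "gcd (y - int (G * t)) (int G) = gcd y (int G)"
        using gcd_add_mult[of "int G" "- int t" y] by (simp add: gcd.commute algebra_simps)
      hence "coprime (y - int (G * t)) (int G)" using y(2) by (simp add: coprime_iff_gcd_eq_1)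
      ultimately have "y \<in> (\<lambda>y. int (G * t) + y) ` {y \<in> {0..<int G}. coprime y (int G)}"
        by (intro image_eqI[of _ _ "y - int (G * t)"]) simp_all
      thus False using y(3) by contradiction
    qed
  next
    fix y assume "y \<in> {0..<int (G * t)}"
    thus "y \<in> {0..<int (G * Suc t)}" by (auto simp: algebra_simps)
  next
    fix y assume y: "y \<in> {0..<int G}" "coprime y (int G)"
    show "int (G * t) + y \<in> {0..<int (G * Suc t)}" using y by (auto simp: algebra_simps)
    have "gcd (int (G * t) + y) (int G) = gcd y (int G)"
      using gcd_add_mult[of "int G" "int t" y] by (simp add: gcd.commute algebra_simps)
    thus "coprime (int (G * t) + y) (int G)" using y(2) by (simp add: coprime_iff_gcd_eq_1)
  qed
  have "card {y \<in> {0..<int (G * Suc t)}. coprime y (int G)} = card {y \<in> {0..<int (G * t)}. coprime y (int G)} + card ((\<lambda>y. int (G * t) + y) ` {y \<in> {0..<int G}. coprime y (int G)})"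
    unfolding eq
  proof (rule card_Un_disjoint)
    show "finite {y \<in> {0..<int (G * t)}. coprime y (int G)}" by (rule finite_subset[of _ "{0..<int (G * t)}"]) blast+
    show "finite ((\<lambda>y. int (G * t) + y) ` {y \<in> {0..<int G}. coprime y (int G)})"
      by (rule finite_imageI, rule finite_subset[of _ "{0..<int G}"]) blast+
    show "{y \<in> {0..<int (G * t)}. coprime y (int G)} \<inter> (\<lambda>y. int (G * t) + y) ` {y \<in> {0..<int G}. coprime y (int G)} = {}"
    proof (rule equals0I)
      fix y assume y: "y \<in> {y \<in> {0..<int (G * t)}. coprime y (int G)} \<inter> (\<lambda>y. int (G * t) + y) ` {y \<in> {0..<int G}. coprime y (int G)}"
      then obtain z where "y = int (G * t) + z" "z \<in> {0..<int G}" by blast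
      moreover have "y < int (G * t)" using y by simp
      ultimately show False by simp
    qed
  qed
  also have "\<dots> = t * totient G + totient G"
  proof -
    have "card ((\<lambda>y. int (G * t) + y) ` {y \<in> {0..<int G}. coprime y (int G)}) = totient G"
      unfolding card_coprime_residues[OF assms, symmetric] by (rule card_image) (simp add: inj_on_def)
    thus ?thesis by (simp only: Suc)
  qed
  finally show ?case by (simp only: mult_Suc add.commute)
qed simp

lemma card_gcd_residues:
  assumes "N > 0" "G dvd N"
  shows "card {x \<in> {0..<int N}. nat (gcd x (int N)) = G} = totient (N div G)"
proof -
  have gcd_int: "nat (gcd (int k) (int N)) = gcd k N" for k by (simp add: gcd_int_int_eq)
  have "bij_betw (\<lambda>x. if x = 0 then N else nat x) {x \<in> {0..<int N}. nat (gcd x (int N)) = G} {k \<in> {0<..N}. gcd k N = G}"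
  proof (rule bij_betwI[where g = "\<lambda>k. if k = N then 0 else int k"])
    show "(\<lambda>x. if x = 0 then N else nat x) \<in> {x \<in> {0..<int N}. nat (gcd x (int N)) = G} \<rightarrow> {k \<in> {0<..N}. gcd k N = G}"
    proof
      fix x assume x: "x \<in> {x \<in> {0..<int N}. nat (gcd x (int N)) = G}"
      show "(if x = 0 then N else nat x) \<in> {k \<in> {0<..N}. gcd k N = G}"
      proof (cases "x = 0")
        case False
        define k where "k = nat x"
        have k: "x = int k" using x by (simp add: k_def)
        have "k > 0" "k < N" "gcd k N = G" using x False gcd_int[of k] unfolding k by auto
        thus ?thesis unfolding k by simp
      next
        case True
        thus ?thesis using x assms(1) by simp
      qed
    qed
    show "(\<lambda>k. if k = N then 0 else int k) \<in> {k \<in> {0<..N}. gcd k N = G} \<rightarrow> {x \<in> {0..<int N}. nat (gcd x (int N)) = G}"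
    proof
      fix k assume k: "k \<in> {k \<in> {0<..N}. gcd k N = G}"
      show "(if k = N then 0 else int k) \<in> {x \<in> {0..<int N}. nat (gcd x (int N)) = G}"
        using k assms(1) gcd_int[of k] by (cases "k = N") simp_all
    qed
    show "(if (if x = 0 then N else nat x) = N then 0 else int (if x = 0 then N else nat x)) = x"
      if "x \<in> {x \<in> {0..<int N}. nat (gcd x (int N)) = G}" for x
    proof -
      have "0 \<le> x" "x < int N" using that by simp_all
      thus ?thesis by (cases "x = 0") simp_all
    qed
    show "(if (if k = N then 0 else int k) = 0 then N else nat (if k = N then 0 else int k)) = k"
      if "k \<in> {k \<in> {0<..N}. gcd k N = G}" for k
      using that by (cases "k = N") simp_all
  qed
  hence "card {x \<in> {0..<int N}. nat (gcd x (int N)) = G} = card {k \<in> {0<..N}. gcd k N = G}"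
    by (rule bij_betw_same_card)
  thus ?thesis using card_gcd_eq_totient[OF assms] by simp
qed

text \<open>
  For a given first entry with greatest common divisor \<open>G\<close>, the second entry runs through the residues
  modulo \<open>N\<close> that are coprime to \<open>G\<close>.
\<close>

lemma sum_prim_rows_gcd:
  fixes F :: "nat \<Rightarrow> real"
  assumes N: "N > 0"
  shows "(\<Sum>v\<in>prim_rows N. F (nat (gcd (fst v) (int N)))) =
         (\<Sum>G | G dvd N. real (totient (N div G)) * (real (N div G) * real (totient G)) * F G)"
proof -
  have eq: "prim_rows N = (SIGMA x:{0..<int N}. {y \<in> {0..<int N}. coprime y (int (nat (gcd x (int N))))})"
  proof (rule set_eqI)
    fix v :: "int \<times> int"
    obtain x y where v: "v = (x, y)" by (cases v)
    have "int (nat (gcd x (int N))) = gcd x (int N)" by simp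
    moreover have "gcd (gcd x y) (int N) = gcd y (gcd x (int N))" by (simp only: gcd.assoc gcd.commute gcd.left_commute)
    ultimately show "v \<in> prim_rows N \<longleftrightarrow> v \<in> (SIGMA x:{0..<int N}. {y \<in> {0..<int N}. coprime y (int (nat (gcd x (int N))))})"
      unfolding v prim_rows_def coprime_iff_gcd_eq_1 by (simp only: mem_Collect_eq case_prod_conv mem_Sigma_iff) blast
  qed
  have cardy: "card {y \<in> {0..<int N}. coprime y (int G)} = (N div G) * totient G" if "G dvd N" for G
  proof -
    have "G > 0" "N = G * (N div G)" using that N by (auto intro: Nat.gr0I)
    thus ?thesis using card_coprime_multiple_range[of G "N div G"] by simp
  qed
  have dvd: "nat (gcd x (int N)) dvd N" for x
  proof -
    have "int (nat (gcd x (int N))) dvd int N" by simp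
    thus ?thesis by (simp only: int_dvd_int_iff)
  qed
  have "(\<Sum>v\<in>prim_rows N. F (nat (gcd (fst v) (int N)))) =
        (\<Sum>x\<in>{0..<int N}. \<Sum>y\<in>{y \<in> {0..<int N}. coprime y (int (nat (gcd x (int N))))}. F (nat (gcd x (int N))))"
    unfolding eq
  proof (subst sum.Sigma)
    show "\<forall>x\<in>{0..<int N}. finite {y \<in> {0..<int N}. coprime y (int (nat (gcd x (int N))))}"
      by (intro ballI, rule finite_subset[of _ "{0..<int N}"]) blast+
  qed (simp_all only: case_prod_unfold finite_atLeastLessThan_int)
  also have "\<dots> = (\<Sum>x\<in>{0..<int N}. real (N div nat (gcd x (int N)) * totient (nat (gcd x (int N)))) * F (nat (gcd x (int N))))"
    unfolding sum_constant cardy[OF dvd] ..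
  also have "\<dots> = (\<Sum>G\<in>{G. G dvd N}. \<Sum>x\<in>{x \<in> {0..<int N}. nat (gcd x (int N)) = G}. real (N div nat (gcd x (int N)) * totient (nat (gcd x (int N)))) * F (nat (gcd x (int N))))"
  proof (rule sum.group[symmetric])
    show "finite {G. G dvd N}" using N by simp
    show "(\<lambda>x. nat (gcd x (int N))) ` {0..<int N} \<subseteq> {G. G dvd N}" using dvd by blast
  qed simp
  also have "\<dots> = (\<Sum>G | G dvd N. real (totient (N div G)) * (real (N div G) * real (totient G)) * F G)"
  proof (rule sum.cong[OF refl])
    fix G assume "G \<in> {G. G dvd N}"
    hence G: "G dvd N" by simp
    have "(\<Sum>x\<in>{x \<in> {0..<int N}. nat (gcd x (int N)) = G}. real (N div nat (gcd x (int N)) * totient (nat (gcd x (int N)))) * F (nat (gcd x (int N)))) =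
          (\<Sum>x\<in>{x \<in> {0..<int N}. nat (gcd x (int N)) = G}. real (N div G * totient G) * F G)"
      by (intro sum.cong refl) auto
    thus "(\<Sum>x\<in>{x \<in> {0..<int N}. nat (gcd x (int N)) = G}. real (N div nat (gcd x (int N)) * totient (nat (gcd x (int N)))) * F (nat (gcd x (int N)))) =
         real (totient (N div G)) * (real (N div G) * real (totient G)) * F G"
      by (simp only: sum_constant card_gcd_residues[OF N G] of_nat_mult mult.assoc)
  qed
  finally show ?thesis .
qed

lemma card_prim_rows:
  assumes "N > 0"
  shows "real (card (prim_rows N)) = totient N * dedekind_psi N"
proof -
  have "real (card (prim_rows N)) = (\<Sum>v\<in>prim_rows N. 1)" by simp
  also have "\<dots> = (\<Sum>G | G dvd N. real (totient (N div G)) * (real (N div G) * real (totient G)) * 1)"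
    by (rule sum_prim_rows_gcd[OF assms])
  also have "\<dots> = div_sum N" unfolding div_sum_def div_weight_def by (intro sum.cong refl) simp
  finally show ?thesis using div_sum_values[OF assms] by simp
qed

text \<open>
  The factor \<open>G\<^sup>2/N\<close> turns the number of rows with greatest common divisor \<open>G\<close> into the number of
  rows with greatest common divisor \<open>N/G\<close>, and \<open>ln (G\<^sup>2/N) = ln N - 2 ln (N/G)\<close>.
\<close>

lemma sum_prim_rows_log:
  assumes N: "N > 0"
  defines "G \<equiv> (\<lambda>v. real (nat (gcd (fst v) (int N))))"
  shows "(\<Sum>v\<in>prim_rows N. (G v)\<^sup>2 / real N * (a * ln ((G v)\<^sup>2 / real N) - c)) =
         totient N * dedekind_psi N * (a * (ln (real N) - 2 * lambda N) - c)"
proof -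
  define F where "F = (\<lambda>g::nat. (real g)\<^sup>2 / real N * (a * ln ((real g)\<^sup>2 / real N) - c))"
  have "(\<Sum>v\<in>prim_rows N. (G v)\<^sup>2 / real N * (a * ln ((G v)\<^sup>2 / real N) - c)) =
        (\<Sum>g | g dvd N. real (totient (N div g)) * (real (N div g) * real (totient g)) * F g)"
    unfolding G_def using sum_prim_rows_gcd[OF N, of F] by (simp add: F_def)
  also have "\<dots> = (\<Sum>d | d dvd N. real (totient (N div (N div d))) * (real (N div (N div d)) * real (totient (N div d))) * F (N div d))"
  proof (rule sum.reindex_bij_witness[of _ "\<lambda>d. N div d" "\<lambda>d. N div d"])
    fix d assume "d \<in> {d. d dvd N}"
    thus "N div (N div d) = d" "N div d \<in> {d. d dvd N}" using N by auto
    thus "N div (N div d) = d" "N div d \<in> {d. d dvd N}" by auto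
  qed (use N in auto)
  also have "\<dots> = (\<Sum>d | d dvd N. div_weight N d * (a * (ln (real N) - 2 * ln (real d)) - c))"
  proof (rule sum.cong[OF refl])
    fix d assume "d \<in> {d. d dvd N}"
    then obtain g where g: "N = d * g" by auto
    have pos: "d > 0" "g > 0" using N g by auto
    have "real g * real g / (real d * real g) = real g / real d" using pos by simp
    hence q: "(real g)\<^sup>2 / real N = real g / real d" by (simp add: g power2_eq_square)
    have "ln ((real g)\<^sup>2 / real N) = ln (real N) - 2 * ln (real d)"
      unfolding q using pos by (simp add: g ln_div ln_mult)
    thus "real (totient (N div (N div d))) * (real (N div (N div d)) * real (totient (N div d))) * F (N div d) =
          div_weight N d * (a * (ln (real N) - 2 * ln (real d)) - c)"
      using pos by (simp add: F_def g div_weight_def q) (simp add: field_simps power2_eq_square g)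
  qed
  also have "\<dots> = (a * ln (real N) - c) * div_sum N - 2 * a * div_log_sum N"
    unfolding div_sum_def div_log_sum_def sum_distrib_left sum_subtractf[symmetric]
    by (intro sum.cong refl) (simp add: algebra_simps)
  also have "\<dots> = totient N * dedekind_psi N * (a * (ln (real N) - 2 * lambda N) - c)"
    using div_sum_values[OF N] by (simp add: algebra_simps)
  finally show ?thesis .
qed

text \<open>
  Completing \<open>(r, s)\<close> to a unimodular matrix gives a permutation of the rows modulo \<open>N\<close>.
\<close>

lemma sum_prim_rows_unimodular:
  fixes F :: "nat \<Rightarrow> real" and r s :: int
  assumes N: "N > 0" and cop: "coprime r s"
  shows "(\<Sum>v\<in>prim_rows N. F (nat (gcd (r * snd v - s * fst v) (int N)))) =
         (\<Sum>v\<in>prim_rows N. F (nat (gcd (fst v) (int N))))"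
proof -
  obtain u w where uw: "u * r + w * s = 1" using cop by (metis bezout_int coprime_iff_gcd_eq_1)
  define h where "h = (\<lambda>v. ((r * snd v - s * fst v) mod int N, (- u * fst v - w * snd v) mod int N))"
  have red: "gcd (x mod int N) (int N) = gcd x (int N)" for x
    by (metis gcd.commute gcd_red_int)
  have inv1: "- w * (r * d - s * c) - r * (- u * c - w * d) = c" for c d
  proof -
    have "- w * (r * d - s * c) - r * (- u * c - w * d) = c * (u * r + w * s)" by (simp add: algebra_simps)
    thus ?thesis by (simp add: uw)
  qed
  have inv2: "u * (r * d - s * c) - s * (- u * c - w * d) = d" for c d
  proof -
    have "u * (r * d - s * c) - s * (- u * c - w * d) = d * (u * r + w * s)" by (simp add: algebra_simps)
    thus ?thesis by (simp add: uw)
  qed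
  have im: "h v \<in> prim_rows N" if v: "v \<in> prim_rows N" for v
  proof -
    define X Y where "X = r * snd v - s * fst v" and "Y = - u * fst v - w * snd v"
    have "coprime (gcd X Y) (int N)"
    proof (rule coprimeI)
      fix e assume e: "e dvd gcd X Y" "e dvd int N"
      hence "e dvd X" "e dvd Y" by auto
      hence "e dvd - w * X - r * Y" "e dvd u * X - s * Y" by auto
      hence "e dvd fst v" "e dvd snd v" unfolding X_def Y_def inv1 inv2 by auto
      hence "e dvd gcd (gcd (fst v) (snd v)) (int N)" using e by simp
      moreover have "gcd (gcd (fst v) (snd v)) (int N) = 1" using v by (simp only: prim_rows_def) auto
      ultimately show "is_unit e" by simp
    qed
    moreover have "gcd (gcd (X mod int N) (Y mod int N)) (int N) = gcd (gcd X Y) (int N)"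
      by (metis gcd.assoc gcd.commute gcd_red_int)
    ultimately show ?thesis using N by (simp add: h_def prim_rows_def X_def Y_def)
  qed
  have inj: "inj_on h (prim_rows N)"
  proof (rule inj_onI)
    fix v v' assume v: "v \<in> prim_rows N" "v' \<in> prim_rows N" "h v = h v'"
    define X Y where "X = r * snd v - s * fst v" and "Y = - u * fst v - w * snd v"
    define X' Y' where "X' = r * snd v' - s * fst v'" and "Y' = - u * fst v' - w * snd v'"
    have XY: "[X = X'] (mod int N)" "[Y = Y'] (mod int N)"
      using v(3) by (simp_all add: h_def X_def Y_def X'_def Y'_def cong_def)
    have "[- w * X - r * Y = - w * X' - r * Y'] (mod int N)" "[u * X - s * Y = u * X' - s * Y'] (mod int N)"
      by (intro cong_diff cong_mult cong_refl XY)+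
    hence "[fst v = fst v'] (mod int N)" "[snd v = snd v'] (mod int N)"
      unfolding X_def Y_def X'_def Y'_def inv1 inv2 by auto
    moreover have "fst v \<in> {0..<int N}" "snd v \<in> {0..<int N}" "fst v' \<in> {0..<int N}" "snd v' \<in> {0..<int N}"
      using v(1,2) by (auto simp: prim_rows_def)
    ultimately show "v = v'" by (simp add: cong_def prod_eq_iff)
  qed
  have "h ` prim_rows N = prim_rows N" using finite_prim_rows inj im by (intro endo_inj_surj) auto
  hence "(\<Sum>v\<in>prim_rows N. F (nat (gcd (fst v) (int N)))) = (\<Sum>v\<in>prim_rows N. F (nat (gcd (fst (h v)) (int N))))"
    using sum.reindex[OF inj, of "\<lambda>v. F (nat (gcd (fst v) (int N)))"] by simp
  also have "\<dots> = (\<Sum>v\<in>prim_rows N. F (nat (gcd (r * snd v - s * fst v) (int N))))"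
    by (simp add: h_def red)
  finally show ?thesis by simp
qed

section \<open>Short vectors in the lattices of the conjugates\<close>

text \<open>
  The value at \<open>\<tau>\<close> of the conjugate with bottom row \<open>(c, d)\<close> depends on the lattice of all
  \<open>r \<tau> + s\<close> with \<open>N\<close> dividing \<open>r d - s c\<close>, of index \<open>N\<close> in \<open>\<int> \<tau> + \<int>\<close>. If \<open>r\<close>, \<open>s\<close> are coprime, then
  \<open>N / G\<close> is the least positive multiplier that moves \<open>(r, s)\<close> into it, and this multiple is primitive
  there.
\<close>

lemma conj_fun_height:
  assumes th: "theta a b c d" and N: "odd N" and \<tau>: "Im \<tau> > 0"
    and cop: "coprime r s" and par: "odd (r + s)"
  defines "G \<equiv> gcd (r * d - s * c) (int N)"
  obtains z where "norm (conj_fun N a b c d \<tau>) = norm (weber_f z)"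
    "Im z = (of_int G)\<^sup>2 / real N * (Im \<tau> / (norm (of_int r * \<tau> + of_int s))\<^sup>2)"
proof -
  have N0: "N > 0" using N by (auto intro: Nat.gr0I)
  define p x where "p = r * d - s * c" and "x = s * a - r * b"
  define g where "g = int N div G"
  have G: "G > 0" "G dvd p" "G dvd int N" using N0 by (auto simp: G_def p_def)
  have Ng: "int N = G * g" using G(3) by (simp add: g_def)
  have g0: "g > 0" using Ng G(1) N0 by (metis of_nat_0_less_iff zero_less_mult_pos)
  define p' where "p' = p div G"
  have p: "p = G * p'" using G(2) by (simp add: p'_def)
  have odd_Gg: "odd G" "odd g" using N Ng by (metis even_mult_iff even_of_nat)+
  have det: "a * d - b * c = 1" using th by (simp add: theta_def)
  have rs: "p * a + x * c = r" "p * b + x * d = s"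
  proof -
    have "p * a + x * c = r * (a * d - b * c)" "p * b + x * d = s * (a * d - b * c)"
      by (simp_all add: p_def x_def algebra_simps)
    thus "p * a + x * c = r" "p * b + x * d = s" by (simp_all add: det)
  qed
  have cop_px: "coprime p x"
  proof (rule coprimeI)
    fix e assume "e dvd p" "e dvd x"
    hence "e dvd p * a + x * c" "e dvd p * b + x * d" by auto
    thus "is_unit e" using cop unfolding rs by (meson coprime_common_divisor)
  qed
  have "coprime p' x" using cop_px p by simp
  moreover have "coprime p' g"
    using div_gcd_coprime[of p "int N"] N0 by (simp add: p'_def g_def G_def p_def)
  ultimately have cop': "coprime p' (g * x)" by simp
  have par': "odd (p' + g * x)"
  proof -
    have "odd (p + x)"
      using theta_parity[OF th] par by (auto simp: p_def x_def)
    thus ?thesis using p odd_Gg by simp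
  qed
  obtain \<alpha> \<beta> where th': "theta \<alpha> \<beta> p' (g * x)" by (rule theta_bottom_row[OF cop' par'])
  define w where "w = of_nat N * mob a b c d \<tau>"
  define D where "D = of_int c * \<tau> + of_int d"
  have D: "D \<noteq> 0" unfolding D_def by (rule linear_nonzero[OF \<tau>]) (use th in \<open>auto simp: theta_def\<close>)
  have Im_w: "Im w = real N * (Im \<tau> / (norm D)\<^sup>2)"
    using Im_mob_theta(1)[OF \<tau> th] by (simp add: w_def D_def)
  have w: "Im w > 0" using Im_mob_theta(2)[OF \<tau> th] N0 by (simp add: w_def)
  have "of_int p' * w + of_int (g * x) = of_int g * (of_int r * \<tau> + of_int s) / D"
  proof -
    define E where "E = of_int a * \<tau> + of_int b"
    have "w = of_int (G * g) * (E / D)"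
      unfolding Ng[symmetric] by (simp add: w_def mob_def D_def E_def)
    hence "of_int p' * w + of_int (g * x) = (of_int (G * p' * g) * E + of_int (g * x) * D) / D"
      using D by (simp add: add_divide_distrib)
    also have "of_int (G * p' * g) * E + of_int (g * x) * D =
        of_int g * (of_int (p * a + x * c) * \<tau> + of_int (p * b + x * d))"
      unfolding p[symmetric] D_def E_def by (simp add: p algebra_simps)
    finally show ?thesis unfolding rs .
  qed
  hence "(norm (of_int p' * w + of_int (g * x)))\<^sup>2 = (of_int g)\<^sup>2 * (norm (of_int r * \<tau> + of_int s))\<^sup>2 / (norm D)\<^sup>2"
    by (simp add: norm_mult norm_divide power_mult_distrib power_divide)
  hence "Im (mob \<alpha> \<beta> p' (g * x) w) = real N * (Im \<tau> / (norm D)\<^sup>2) / ((of_int g)\<^sup>2 * (norm (of_int r * \<tau> + of_int s))\<^sup>2 / (norm D)\<^sup>2)"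
    unfolding Im_mob_theta(1)[OF w th'] Im_w by simp
  also have "\<dots> = real N / (of_int g)\<^sup>2 * (Im \<tau> / (norm (of_int r * \<tau> + of_int s))\<^sup>2)"
    using D by simp
  also have "real N / (of_int g)\<^sup>2 = (of_int G)\<^sup>2 / real N"
  proof -
    have "real N = of_int G * of_int g" using Ng by (metis of_int_mult of_int_of_nat_eq)
    thus ?thesis using g0 G(1) by (simp add: power2_eq_square field_simps)
  qed
  finally have "Im (mob \<alpha> \<beta> p' (g * x) w) = (of_int G)\<^sup>2 / real N * (Im \<tau> / (norm (of_int r * \<tau> + of_int s))\<^sup>2)" .
  moreover have "norm (conj_fun N a b c d \<tau>) = norm (weber_f (mob \<alpha> \<beta> p' (g * x) w))"
    unfolding norm_weber_f_theta[OF th' w] using \<tau> by (simp add: conj_fun_def w_def)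
  ultimately show ?thesis using that by blast
qed

lemma coprime_diff_right:
  fixes x y :: int
  assumes "coprime x y"
  shows "coprime y (x - y)"
proof (rule coprimeI)
  fix e assume e: "e dvd y" "e dvd x - y"
  hence "e dvd (x - y) + y" by (intro dvd_add)
  hence "e dvd x" by simp
  thus "is_unit e" using e(1) assms by (meson coprime_common_divisor)
qed

text \<open>
  The determinant of two vectors of the lattice belonging to the row \<open>(x, y)\<close> is divisible by the index
  \<open>N\<close>. It is applied to multiples of \<open>(r, s)\<close> and \<open>(r', s')\<close>.
\<close>

lemma row_determinant_dvd:
  fixes x y r s r' s' :: int
  assumes "gcd (gcd x y) (int N) = 1" "N > 0"
  defines "G \<equiv> gcd (r * y - s * x) (int N)" and "G' \<equiv> gcd (r' * y - s' * x) (int N)"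
  shows "int N dvd (int N div G) * (int N div G') * (r * s' - s * r')"
proof -
  define g g' where "g = int N div G" and "g' = int N div G'"
  define P P' where "P = r * y - s * x" and "P' = r' * y - s' * x"
  have Ng: "int N = G * g" "int N = G' * g'" by (simp_all add: g_def g'_def G_def G'_def)
  have "int N dvd g * P"
  proof -
    have "G dvd P" by (simp add: G_def P_def)
    hence "G * g dvd P * g" by (intro mult_dvd_mono) auto
    thus ?thesis using Ng(1) by (simp add: mult.commute)
  qed
  hence "int N dvd g * P * (g' * r')" "int N dvd g * P * (g' * s')" by simp_all
  moreover have "int N dvd g' * P'"
  proof -
    have "G' dvd P'" by (simp add: G'_def P'_def)
    hence "G' * g' dvd P' * g'" by (intro mult_dvd_mono) auto
    thus ?thesis using Ng(2) by (simp add: mult.commute)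
  qed
  hence "int N dvd g' * P' * (g * r)" "int N dvd g' * P' * (g * s)" by simp_all
  ultimately have "int N dvd g' * P' * (g * r) - g * P * (g' * r')" "int N dvd g' * P' * (g * s) - g * P * (g' * s')"
    by (simp_all only: dvd_diff)
  moreover have "g' * P' * (g * r) - g * P * (g' * r') = - (g * g' * (r * s' - s * r')) * x"
    "g' * P' * (g * s) - g * P * (g' * s') = - (g * g' * (r * s' - s * r')) * y"
    by (simp_all add: P_def P'_def algebra_simps)
  ultimately have dvd: "int N dvd (g * g' * (r * s' - s * r')) * x" "int N dvd (g * g' * (r * s' - s * r')) * y"
    by simp_all
  obtain s1 t1 where 1: "s1 * x + t1 * y = gcd x y" using bezout_int by blast
  obtain u w where 2: "u * gcd x y + w * int N = gcd (gcd x y) (int N)" using bezout_int by blast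
  define E where "E = g * g' * (r * s' - s * r')"
  have "E = E * (u * (s1 * x + t1 * y) + w * int N)" using 1 2 assms(1) by simp
  also have "\<dots> = u * s1 * (E * x) + u * t1 * (E * y) + E * w * int N" by (simp add: algebra_simps)
  finally have "E = u * s1 * (E * x) + u * t1 * (E * y) + E * w * int N" .
  moreover have "int N dvd u * s1 * (E * x) + u * t1 * (E * y) + E * w * int N"
  proof (intro dvd_add)
    show "int N dvd u * s1 * (E * x)" by (rule dvd_mult) (use dvd in \<open>simp add: E_def\<close>)
    show "int N dvd u * t1 * (E * y)" by (rule dvd_mult) (use dvd in \<open>simp add: E_def\<close>)
  qed simp
  ultimately show ?thesis by (simp add: E_def g_def g'_def)
qed

lemma coprime_parallel:
  fixes u n u' n' :: int
  assumes "coprime u n" "coprime u' n'" "u * n' = n * u'"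
  shows "(u', n') = (u, n) \<or> (u', n') = (- u, - n)"
proof -
  have "u dvd u'" "n dvd n'"
  proof -
    have "u dvd n * u'" unfolding assms(3)[symmetric] by simp
    thus "u dvd u'" by (simp only: coprime_dvd_mult_left_iff[OF assms(1)] coprime_dvd_mult_right_iff[OF assms(1)])
    have "n dvd u * n'" unfolding assms(3) by simp
    moreover have "coprime n u" using assms(1) by (simp add: coprime_commute)
    ultimately show "n dvd n'" by (simp only: coprime_dvd_mult_right_iff)
  qed
  moreover have "u' dvd u" "n' dvd n"
  proof -
    have "u' dvd u * n'" unfolding assms(3) by simp
    thus "u' dvd u" by (simp only: coprime_dvd_mult_left_iff[OF assms(2)] coprime_dvd_mult_right_iff[OF assms(2)])
    have "n' dvd n * u'" unfolding assms(3)[symmetric] by simp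
    moreover have "coprime n' u'" using assms(2) by (simp add: coprime_commute)
    ultimately show "n' dvd n" by (simp only: coprime_dvd_mult_left_iff)
  qed
  ultimately have "\<bar>u\<bar> = \<bar>u'\<bar>" "\<bar>n\<bar> = \<bar>n'\<bar>" by (blast intro: zdvd_antisym_abs)+
  hence eq: "u' = u \<or> u' = - u" "n' = n \<or> n' = - n" by linarith+
  have zero: "u = 0 \<or> n = 0" if "u * n = - (u * n)"
  proof -
    have "u * n = 0" using that by linarith
    thus ?thesis by (simp only: mult_eq_0_iff)
  qed
  have mixed1: "u = 0 \<or> n = 0" if "u' = u" "n' = - n"
    by (rule zero) (use assms(3)[unfolded that] in \<open>simp only: mult_minus_right mult.commute[of n u]\<close>)
  have mixed2: "u = 0 \<or> n = 0" if "u' = - u" "n' = n"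
    by (rule zero) (use assms(3)[unfolded that] in \<open>simp only: mult_minus_right mult.commute[of n u]\<close>)
  show ?thesis
    using eq mixed1 mixed2 unfolding prod.inject by (metis minus_zero)
qed

text \<open>
  The quantity \<open>gcd (r d - s c) N\<close> of a row \<open>v = (c, d)\<close>, in the coordinates \<open>w = (r + s, r)\<close> of \<open>quad_form\<close>.
\<close>

definition row_gcd :: "nat \<Rightarrow> int \<times> int \<Rightarrow> int \<times> int \<Rightarrow> nat" where
  "row_gcd N w v = nat (gcd (snd w * snd v - (fst w - snd w) * fst v) (int N))"

text \<open>
  If \<open>w\<close> and \<open>w'\<close> are both short, then their determinant \<open>D\<close> has \<open>\<bar>D\<bar> < G G'/N\<close> by Lagrange's identity. As \<open>N\<close>
  divides \<open>(N/G) (N/G') D\<close>, the determinant vanishes, and primitive vectors on a line differ by a sign.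
\<close>

lemma short_vectors_le_2:
  assumes v: "v \<in> prim_rows N" and N: "N > 0" and K: "K > 0"
    and short: "\<And>w. w \<in> W \<Longrightarrow> coprime (fst w) (snd w) \<and> quad_form K w < real K * (real (row_gcd N w v))\<^sup>2 / real N"
  shows "finite W" "card W \<le> 2"
proof -
  have par: "w' = w \<or> w' = (- fst w, - snd w)" if w: "w \<in> W" "w' \<in> W" for w w'
  proof -
    define G G' where "G = row_gcd N w v" and "G' = row_gcd N w' v"
    define D where "D = fst w * snd w' - snd w * fst w'"
    have Gdvd: "int G = gcd (snd w * snd v - (fst w - snd w) * fst v) (int N)"
      "int G' = gcd (snd w' * snd v - (fst w' - snd w') * fst v) (int N)"
      unfolding G_def G'_def row_gcd_def by (rule nat_0_le, rule gcd_ge_0_int)+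
    have "int G dvd int N" "int G' dvd int N" unfolding Gdvd by (rule gcd_dvd2)+
    hence dvd: "G dvd N" "G' dvd N" by (simp_all only: int_dvd_int_iff)
    obtain g where g1: "N = G * g" using dvd(1) by (rule dvdE)
    obtain g' where g2: "N = G' * g'" using dvd(2) by (rule dvdE)
    note g = g1 g2
    have pos: "G > 0" "g > 0" "G' > 0" "g' > 0" using g N by (auto intro: Nat.gr0I)
    have "gcd (gcd (fst v) (snd v)) (int N) = 1" using v unfolding prim_rows_def case_prod_unfold by blast
    from row_determinant_dvd[OF this N, of "snd w" "fst w - snd w" "snd w'" "fst w' - snd w'"]
    have "int N dvd (int N div int G) * (int N div int G') * (snd w * (fst w' - snd w') - (fst w - snd w) * snd w')"
      unfolding Gdvd[symmetric] .
    also have "snd w * (fst w' - snd w') - (fst w - snd w) * snd w' = - D" by (simp add: D_def algebra_simps)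
    also have "int N div int G = int g" using g(1) pos by (simp flip: zdiv_int)
    also have "int N div int G' = int g'" using g(2) pos by (simp flip: zdiv_int)
    finally have Ndvd: "int N dvd int (g * g') * D" by simp
    have Q: "quad_form K w < real K * (real G)\<^sup>2 / real N" "quad_form K w' < real K * (real G')\<^sup>2 / real N"
      unfolding G_def G'_def using short[OF w(1)] short[OF w(2)] by blast+
    have "(real K)\<^sup>2 * (of_int D)\<^sup>2 \<le> quad_form K w * quad_form K w'"
    proof -
      have "quad_form K w * quad_form K w' - (real K)\<^sup>2 * (of_int D)\<^sup>2 =
            ((real K)\<^sup>2 * of_int (fst w) * of_int (fst w') + of_int (snd w) * of_int (snd w'))\<^sup>2"
        by (simp add: quad_form_def D_def power2_eq_square algebra_simps)
      moreover have "(x::real)\<^sup>2 \<ge> 0" for x by simp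
      ultimately show ?thesis by (metis diff_ge_0_iff_ge)
    qed
    also have "\<dots> < (real K * (real G)\<^sup>2 / real N) * (real K * (real G')\<^sup>2 / real N)"
      using Q by (intro mult_strict_mono') (auto simp: quad_form_def)
    also have "\<dots> = (real K)\<^sup>2 * (real G * real G' / real N)\<^sup>2" by (simp add: power2_eq_square)
    finally have "(of_int D)\<^sup>2 < (real G * real G' / real N)\<^sup>2" using K by simp
    hence "\<bar>of_int D\<bar>\<^sup>2 < (real G * real G' / real N)\<^sup>2" by (simp only: power2_abs)
    hence "\<bar>of_int D\<bar> < real G * real G' / real N" by (rule power2_less_imp_less) simp
    hence "real (g * g') * \<bar>of_int D\<bar> < real (g * g') * (real G * real G' / real N)"
      using pos by (intro mult_strict_left_mono) auto
    also have "real (g * g') * (real G * real G' / real N) = real (G * g) * real (G' * g') / real N" by simp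
    also have "\<dots> = real N" unfolding g[symmetric] using N by simp
    finally have "real_of_int \<bar>int (g * g') * D\<bar> < of_int (int N)" by (simp add: abs_mult)
    hence "\<bar>int (g * g') * D\<bar> < int N" by (simp only: of_int_less_iff)
    hence "int (g * g') * D = 0" using dvd_imp_le_int[OF _ Ndvd] by fastforce
    hence "D = 0" using pos by simp
    hence "fst w * snd w' = snd w * fst w'" by (simp add: D_def)
    have cop: "coprime (fst w) (snd w)" "coprime (fst w') (snd w')"
      using short[OF w(1)] short[OF w(2)] by blast+
    from coprime_parallel[OF cop \<open>fst w * snd w' = snd w * fst w'\<close>] show ?thesis by simp
  qed
  have "\<exists>w. W \<subseteq> {w, (- fst w, - snd w)}"
  proof (cases "W = {}")
    case False
    then obtain w where "w \<in> W" by blast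
    hence "W \<subseteq> {w, (- fst w, - snd w)}" using par by (intro subsetI) simp
    thus ?thesis by (rule exI)
  qed simp
  then obtain w where W: "W \<subseteq> {w, (- fst w, - snd w)}" by blast
  show "finite W" by (rule finite_subset[OF W]) simp
  have "card W \<le> card {w, (- fst w, - snd w)}" by (rule card_mono[OF _ W]) simp
  also have "\<dots> \<le> 2" by (simp add: card_insert_if)
  finally show "card W \<le> 2" .
qed

text \<open>
  Each short vector gives a lower bound, and at most two vectors, which are opposite, are short. Half the
  sum over all of them is therefore a lower bound, too, and unlike a maximum it allows an exchange of
  summations.
\<close>

lemma conjugate_value_ge:
  assumes N: "odd N" and K: "K > 0" and C1: "C1 \<ge> 0"
    and f_ge: "\<And>z. Im z \<ge> 1 \<Longrightarrow> pi / 24 * Im z - C1 \<le> ln (max 1 (norm (weber_f z)))"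
    and v: "v \<in> prim_rows N" "has_row N g (fst v) (snd v)"
    and W: "finite W" "\<And>w. w \<in> W \<Longrightarrow> odd (fst w) \<and> coprime (fst w) (snd w)"
  shows "(\<Sum>w | w \<in> W \<and> quad_form K w < real K * (real (row_gcd N w v))\<^sup>2 / real N.
            pi / 24 * (real K * (real (row_gcd N w v))\<^sup>2 / real N / quad_form K w) - C1) / 2
         \<le> ln (max 1 (norm (g (1 + \<i> / of_nat K))))"
proof -
  have N0: "N > 0" using N by (auto intro: Nat.gr0I)
  define \<tau> where "\<tau> = 1 + \<i> / of_nat K"
  define V where "V = {w. w \<in> W \<and> quad_form K w < real K * (real (row_gcd N w v))\<^sup>2 / real N}"
  define L where "L = ln (max 1 (norm (g \<tau>)))"
  have L0: "L \<ge> 0" by (simp add: L_def)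
  have Im_\<tau>: "Im \<tau> = 1 / real K" by (simp add: \<tau>_def Im_divide_of_nat)
  have Re_\<tau>: "Re \<tau> = 1" by (simp add: \<tau>_def Re_divide_of_nat)
  obtain a b c d where g: "weber_group a b c d" "[c = fst v] (mod int N)" "[d = snd v] (mod int N)" "g = conj_fun N a b c d"
    using v(2) by (auto simp: has_row_def)
  have th: "theta a b c d" using g(1) by (simp add: weber_group_def)
  have each: "pi / 24 * (real K * (real (row_gcd N w v))\<^sup>2 / real N / quad_form K w) - C1 \<le> L" if w: "w \<in> V" for w
  proof -
    define r s where "r = snd w" and "s = fst w - snd w"
    have "coprime (fst w) (snd w)" using w W(2) by (simp add: V_def)
    hence cop: "coprime r s"
      unfolding r_def s_def by (rule coprime_diff_right)
    have par: "odd (r + s)" using w W(2) by (simp add: V_def r_def s_def)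
    have Geq: "gcd (r * d - s * c) (int N) = int (row_gcd N w v)"
    proof -
      have "[r * d - s * c = r * snd v - s * fst v] (mod int N)"
        by (intro cong_diff cong_mult cong_refl g)
      hence "gcd (r * d - s * c) (int N) = gcd (r * snd v - s * fst v) (int N)" by (rule cong_gcd_eq)
      thus ?thesis by (simp add: row_gcd_def r_def s_def)
    qed
    obtain z where z: "norm (conj_fun N a b c d \<tau>) = norm (weber_f z)"
      "Im z = (of_int (gcd (r * d - s * c) (int N)))\<^sup>2 / real N * (Im \<tau> / (norm (of_int r * \<tau> + of_int s))\<^sup>2)"
      by (rule conj_fun_height[OF th N _ cop par, of \<tau>]) (use Im_\<tau> K in auto)
    have Q0: "quad_form K w > 0"
    proof -
      have "odd (fst w)" using w W(2)[of w] by (simp add: V_def)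
      hence "fst w \<noteq> 0" by auto
      hence "(real K * of_int (fst w))\<^sup>2 > 0" using K by simp
      thus ?thesis by (simp add: quad_form_def add_pos_nonneg)
    qed
    have "(norm (of_int r * \<tau> + of_int s))\<^sup>2 = quad_form K w / (real K)\<^sup>2"
    proof -
      have "Re (of_int r * \<tau> + of_int s) = of_int (fst w)" by (simp add: Re_\<tau> r_def s_def)
      moreover have "Im (of_int r * \<tau> + of_int s) = of_int (snd w) / real K" by (simp add: Im_\<tau> r_def)
      ultimately have "(norm (of_int r * \<tau> + of_int s))\<^sup>2 = (of_int (fst w))\<^sup>2 + (of_int (snd w) / real K)\<^sup>2"
        unfolding cmod_power2 by (simp only:)
      also have "\<dots> = quad_form K w / (real K)\<^sup>2"
        using K by (simp add: quad_form_def power_divide power_mult_distrib field_simps)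
      finally show ?thesis .
    qed
    hence Im_z: "Im z = real K * (real (row_gcd N w v))\<^sup>2 / real N / quad_form K w"
      unfolding z(2) Geq Im_\<tau> using K Q0 by (simp only:) (simp add: power2_eq_square)
    have "Im z \<ge> 1"
      unfolding Im_z pos_le_divide_eq[OF Q0] using w by (simp add: V_def)
    from f_ge[OF this] show ?thesis using z(1) by (simp add: L_def g(4) Im_z)
  qed
  have "card V \<le> 2" "finite V"
    using short_vectors_le_2[OF v(1) N0 K, of V] W(2) by (auto simp: V_def)
  have "(\<Sum>w\<in>V. pi / 24 * (real K * (real (row_gcd N w v))\<^sup>2 / real N / quad_form K w) - C1) \<le> (\<Sum>w\<in>V. L)"
    by (intro sum_mono each)
  also have "\<dots> = real (card V) * L" by simp
  also have "\<dots> \<le> 2 * L" using \<open>card V \<le> 2\<close> L0 by (intro mult_right_mono) auto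
  finally show ?thesis unfolding V_def[symmetric] L_def \<tau>_def by simp
qed

text \<open>
  The sums over rows and over vectors are exchanged. For a fixed vector, a unimodular change of rows
  replaces the greatest common divisor by that of the first entry, which does not depend on the vector;
  after a second exchange the lattice sum appears, with \<open>\<rho> = G\<^sup>2/N\<close>.
\<close>

theorem sum_conjugate_values_ge:
  assumes K: "K > 0"
  obtains C where "C \<ge> 0" "\<And>N. odd N \<Longrightarrow>
     dedekind_psi N * (1 / 12 * (ln (real N) - 2 * lambda N) - C) \<le> (\<Sum>g\<in>conjugates N. ln (max 1 (norm (g (1 + \<i> / of_nat K)))))"
proof -
  obtain m M where mM: "m > 0" "M > 0" "\<And>\<tau>. Im \<tau> \<ge> 1 \<Longrightarrow> m * exp (pi * Im \<tau> / 24) \<le> norm (weber_f \<tau>) \<and>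
          norm (weber_f \<tau>) \<le> M * exp (pi * Im \<tau> / 24)"
    by (rule weber_f_growth[OF zero_less_one]) (rule that, assumption+)
  define C1 where "C1 = \<bar>ln m\<bar>"
  have f_ge: "pi / 24 * Im z - C1 \<le> ln (max 1 (norm (weber_f z)))" if "Im z \<ge> 1" for z
  proof -
    have "ln m + pi * Im z / 24 = ln (m * exp (pi * Im z / 24))" using mM(1) by (simp add: ln_mult)
    also have "\<dots> \<le> ln (max 1 (norm (weber_f z)))"
      using mM(1) mM(3)[OF that] by (subst ln_le_cancel_iff) auto
    finally show ?thesis by (simp add: C1_def)
  qed
  obtain C0 where C0: "C0 \<ge> 0" "\<And>R. R \<ge> 1 \<Longrightarrow> (\<Sum>w\<in>prim_vectors K R. 1 / quad_form K w) \<ge> 4 / (pi * real K) * ln R - C0"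
    by (rule prim_sum_ge[OF K]) (rule that, assumption+)
  \<comment> \<open>The error of the lattice sum, and \<open>C1\<close> for each of the at most \<open>9 R\<close> vectors, where \<open>R = K \<rho>\<close>.\<close>
  define C2 where "C2 = pi / 24 * C0 + 9 * C1"
  define C where "C = C2 * real K / 2"
  have C2: "C2 \<ge> 0" using C0(1) by (simp add: C2_def C1_def)
  have inner: "(\<Sum>w\<in>prim_vectors K (real K * \<rho>). pi / 24 * (real K * \<rho> / quad_form K w) - C1) / 2 \<ge> \<rho> * (1 / 12 * ln \<rho> - C)"
    if \<rho>: "\<rho> > 0" for \<rho>
  proof (cases "real K * \<rho> \<ge> 1")
    case True
    define R where "R = real K * \<rho>"
    have R: "R \<ge> 1" using True by (simp add: R_def)
    have "(\<Sum>w\<in>prim_vectors K R. pi / 24 * (R / quad_form K w) - C1) =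
          pi / 24 * R * (\<Sum>w\<in>prim_vectors K R. 1 / quad_form K w) - C1 * real (card (prim_vectors K R))"
      by (simp add: sum_subtractf sum_distrib_left mult.commute)
    also have "\<dots> \<ge> pi / 24 * R * (4 / (pi * real K) * ln R - C0) - C1 * (9 * R)"
      using C0(2)[OF R] card_prim_vectors_le[OF K R] R
      by (intro diff_mono mult_left_mono) (auto simp: C1_def)
    also have "pi / 24 * R * (4 / (pi * real K) * ln R - C0) - C1 * (9 * R) = \<rho> / 6 * ln R - C2 * R"
      using K by (simp add: C2_def R_def field_simps)
    finally have ge: "(\<Sum>w\<in>prim_vectors K R. pi / 24 * (R / quad_form K w) - C1) \<ge> \<rho> / 6 * ln R - C2 * R" .
    have "ln \<rho> \<le> ln R"
      using K \<rho> by (subst ln_le_cancel_iff) (auto simp: R_def)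
    hence "\<rho> / 6 * ln \<rho> \<le> \<rho> / 6 * ln R" using \<rho> by (intro mult_left_mono) auto
    with ge have "\<rho> / 6 * ln \<rho> - C2 * R \<le> (\<Sum>w\<in>prim_vectors K R. pi / 24 * (R / quad_form K w) - C1)" by linarith
    hence "(\<rho> / 6 * ln \<rho> - C2 * R) / 2 \<le> (\<Sum>w\<in>prim_vectors K R. pi / 24 * (R / quad_form K w) - C1) / 2" by simp
    moreover have "(\<rho> / 6 * ln \<rho> - C2 * R) / 2 = \<rho> * (1 / 12 * ln \<rho> - C)"
      by (simp add: C_def R_def algebra_simps diff_divide_distrib)
    ultimately show ?thesis unfolding R_def by simp
  next
    case False
    have "prim_vectors K (real K * \<rho>) = {}" by (rule prim_vectors_empty[OF K]) (use False in simp)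
    moreover have "1 * \<rho> \<le> real K * \<rho>" using K \<rho> by (intro mult_right_mono) auto
    hence "\<rho> \<le> 1" using False by linarith
    hence "ln \<rho> \<le> 0" using \<rho> by simp
    hence "\<rho> * (1 / 12 * ln \<rho> - C) \<le> 0"
      using C2 \<rho> by (intro mult_nonneg_nonpos) (auto simp: C_def intro: order_trans[OF _ mult_nonneg_nonneg])
    ultimately show ?thesis by simp
  qed
  show ?thesis
  proof (rule that[of C])
    show "C \<ge> 0" using C2 by (simp add: C_def)
  next
    fix N :: nat assume N: "odd N"
    have N0: "N > 0" using N by (auto intro: Nat.gr0I)
    define L where "L = (\<lambda>g::complex \<Rightarrow> complex. ln (max 1 (norm (g (1 + \<i> / of_nat K)))))"
    define W where "W = prim_vectors K (real K * real N)"
    have finW: "finite W" unfolding W_def by (rule finite_prim_vectors[OF K])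
    have W: "odd (fst w) \<and> coprime (fst w) (snd w)" if "w \<in> W" for w
      using that by (simp add: W_def prim_vectors_def)
    define h where "h = (\<lambda>w G. if quad_form K w < real K * (real G)\<^sup>2 / real N
       then pi / 24 * (real K * (real G)\<^sup>2 / real N / quad_form K w) - C1 else 0)"
    define l where "l = (\<lambda>v. (\<Sum>w\<in>W. h w (row_gcd N w v)) / 2)"
    have l_le: "l v \<le> L g" if "v \<in> prim_rows N" "has_row N g (fst v) (snd v)" for v g
    proof -
      have "(\<Sum>w\<in>W. h w (row_gcd N w v)) = (\<Sum>w | w \<in> W \<and> quad_form K w < real K * (real (row_gcd N w v))\<^sup>2 / real N.
            pi / 24 * (real K * (real (row_gcd N w v))\<^sup>2 / real N / quad_form K w) - C1)"
        unfolding h_def by (rule sum.inter_filter[OF finW, symmetric])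
      thus ?thesis
        unfolding l_def L_def using conjugate_value_ge[OF N K _ f_ge that finW W] by (simp add: C1_def)
    qed
    have "(\<Sum>v\<in>prim_rows N. l v) = (\<Sum>w\<in>W. \<Sum>v\<in>prim_rows N. h w (row_gcd N w v)) / 2"
      unfolding l_def sum_divide_distrib[symmetric] by (subst sum.swap) (rule refl)
    also have "(\<Sum>w\<in>W. \<Sum>v\<in>prim_rows N. h w (row_gcd N w v)) = (\<Sum>w\<in>W. \<Sum>v\<in>prim_rows N. h w (nat (gcd (fst v) (int N))))"
    proof (rule sum.cong[OF refl])
      fix w assume "w \<in> W"
      have "coprime (snd w) (fst w - snd w)"
        using W[OF \<open>w \<in> W\<close>] by (intro coprime_diff_right) simp
      from sum_prim_rows_unimodular[OF N0 this, of "h w"]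
      show "(\<Sum>v\<in>prim_rows N. h w (row_gcd N w v)) = (\<Sum>v\<in>prim_rows N. h w (nat (gcd (fst v) (int N))))"
        unfolding row_gcd_def .
    qed
    also have "\<dots> = (\<Sum>v\<in>prim_rows N. \<Sum>w\<in>W. h w (nat (gcd (fst v) (int N))))" by (rule sum.swap)
    also have "(\<Sum>v\<in>prim_rows N. \<Sum>w\<in>W. h w (nat (gcd (fst v) (int N)))) / 2 =
        (\<Sum>v\<in>prim_rows N. (\<Sum>w\<in>W. h w (nat (gcd (fst v) (int N)))) / 2)" by (rule sum_divide_distrib)
    also have "\<dots> \<ge> (\<Sum>v\<in>prim_rows N. (real (nat (gcd (fst v) (int N))))\<^sup>2 / real N * (1 / 12 * ln ((real (nat (gcd (fst v) (int N))))\<^sup>2 / real N) - C))"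
    proof (rule sum_mono)
      fix v assume "v \<in> prim_rows N"
      define G where "G = nat (gcd (fst v) (int N))"
      have G: "G > 0" "G \<le> N"
      proof -
        have "int G = gcd (fst v) (int N)" by (simp add: G_def)
        hence "int G > 0" "int G \<le> int N" using N0 by (auto intro: zdvd_imp_le)
        thus "G > 0" "G \<le> N" by simp_all
      qed
      define \<rho> where "\<rho> = (real G)\<^sup>2 / real N"
      have \<rho>: "\<rho> > 0" using G N0 by (simp add: \<rho>_def)
      have "\<rho> \<le> real N"
      proof -
        have "(real G)\<^sup>2 \<le> (real N)\<^sup>2" using G by (intro power_mono) auto
        thus ?thesis using N0 by (simp add: \<rho>_def power2_eq_square field_simps)
      qed
      hence le: "real K * \<rho> \<le> real K * real N" by (intro mult_left_mono) auto
      have "(\<Sum>w\<in>W. h w G) = (\<Sum>w | w \<in> W \<and> quad_form K w < real K * \<rho>. pi / 24 * (real K * \<rho> / quad_form K w) - C1)"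
        unfolding h_def \<rho>_def times_divide_eq_right by (rule sum.inter_filter[OF finW, symmetric])
      also have "{w. w \<in> W \<and> quad_form K w < real K * \<rho>} = prim_vectors K (real K * \<rho>)"
        using le by (auto simp: W_def prim_vectors_def)
      finally have "(\<Sum>w\<in>W. h w G) / 2 \<ge> \<rho> * (1 / 12 * ln \<rho> - C)" using inner[OF \<rho>] by simp
      thus "(real (nat (gcd (fst v) (int N))))\<^sup>2 / real N * (1 / 12 * ln ((real (nat (gcd (fst v) (int N))))\<^sup>2 / real N) - C)
         \<le> (\<Sum>w\<in>W. h w (nat (gcd (fst v) (int N)))) / 2"
        unfolding G_def[symmetric] \<rho>_def[symmetric] .
    qed
    finally have "(\<Sum>v\<in>prim_rows N. l v) \<ge> (\<Sum>v\<in>prim_rows N. (real (nat (gcd (fst v) (int N))))\<^sup>2 / real N * (1 / 12 * ln ((real (nat (gcd (fst v) (int N))))\<^sup>2 / real N) - C))" .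
    also have "(\<Sum>v\<in>prim_rows N. (real (nat (gcd (fst v) (int N))))\<^sup>2 / real N * (1 / 12 * ln ((real (nat (gcd (fst v) (int N))))\<^sup>2 / real N) - C))
       = totient N * dedekind_psi N * (1 / 12 * (ln (real N) - 2 * lambda N) - C)"
      by (rule sum_prim_rows_log[OF N0])
    finally have "real (totient N) * (dedekind_psi N * (1 / 12 * (ln (real N) - 2 * lambda N) - C)) \<le> (\<Sum>v\<in>prim_rows N. l v)"
      by (simp add: mult.assoc)
    also have "\<dots> \<le> real (totient N) * (\<Sum>g\<in>conjugates N. L g)"
      by (rule sum_conjugates_ge[OF N _ l_le]) (auto simp: L_def)
    finally show "dedekind_psi N * (1 / 12 * (ln (real N) - 2 * lambda N) - C) \<le> (\<Sum>g\<in>conjugates N. ln (max 1 (norm (g (1 + \<i> / of_nat K)))))"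
      using N0 unfolding L_def by simp
  qed
qed

section \<open>The height\<close>

lemma weber_f_small_point:
  obtains K :: nat where "K > 0" "norm (weber_f (1 + \<i> / of_nat K)) \<le> 1"
proof -
  obtain m M where mM: "m > 0" "M > 0" "\<And>z. Im z \<ge> 1 \<Longrightarrow> m * exp (- pi * Im z / 12) \<le> norm (weber_f (1 - 1 / z)) \<and>
          norm (weber_f (1 - 1 / z)) \<le> M * exp (- pi * Im z / 12)"
    by (rule weber_f_decay_at_cusp_1[OF zero_less_one]) (rule that, assumption+)
  have decay: "norm (weber_f (1 - 1 / z)) \<le> M * exp (- (pi / 12) * Im z)" if "Im z \<ge> 1" for z
    using mM(3)[OF that] by simp
  have "\<exists>Y. \<forall>z. Im z \<ge> Y \<longrightarrow> norm (weber_f (1 - 1 / z)) < 1"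
    by (rule exp_decay_imp_small[OF _ decay]) auto
  then obtain Y where Y: "\<And>z. Im z \<ge> Y \<Longrightarrow> norm (weber_f (1 - 1 / z)) < 1" by blast
  obtain K :: nat where K: "real K \<ge> max Y 1" using real_arch_simple by blast
  define z where "z = \<i> * complex_of_real (real K)"
  have z: "1 - 1 / z = 1 + \<i> / of_nat K" using K by (simp add: z_def field_simps)
  have "norm (weber_f (1 - 1 / z)) < 1" by (rule Y) (use K in \<open>simp add: z_def\<close>)
  hence "norm (weber_f (1 + \<i> / of_nat K)) \<le> 1" unfolding z by (rule less_imp_le)
  thus ?thesis using K by (intro that[of K]) auto
qed

lemma coeff_in_coeffs:
  assumes "coeff p i \<noteq> 0"
  shows "coeff p i \<in> set (coeffs p)"
proof -
  have "i \<le> degree p" using assms by (rule le_degree)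
  moreover have "p \<noteq> 0" using assms by auto
  ultimately show ?thesis by (simp add: coeffs_def del: upt_Suc)
qed

lemma height_ge:
  assumes "P \<noteq> 0"
  shows "norm (coeff (coeff P i) j) \<le> Max (\<Union>a\<in>set (coeffs P). norm ` set (coeffs a))
       \<or> coeff (coeff P i) j = 0"
proof (cases "coeff (coeff P i) j = 0")
  case False
  hence "coeff P i \<noteq> 0" by auto
  hence 1: "coeff P i \<in> set (coeffs P)" by (rule coeff_in_coeffs)
  have 2: "coeff (coeff P i) j \<in> set (coeffs (coeff P i))"
    using False by (rule coeff_in_coeffs)
  have "norm (coeff (coeff P i) j) \<in> (\<Union>a\<in>set (coeffs P). norm ` set (coeffs a))" using 1 2 by blast
  thus ?thesis by (intro disjI1 Max_ge) auto
qed simp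

text \<open>
  At a point with \<open>\<bar>f(\<tau>)\<bar> \<le> 1\<close> the substitution of \<open>f(\<tau>)\<close> for \<open>Y\<close> enlarges the coefficients at most by the
  number of terms, which is polynomial in \<open>N\<close>.
\<close>

theorem height_weber_modular_polynomial_ge:
  assumes N: "odd N" and \<tau>: "Im \<tau> > 0" "norm (weber_f \<tau>) \<le> 1"
  shows "(\<Sum>g\<in>conjugates N. ln (max 1 (norm (g \<tau>)))) - 122 * dedekind_psi N \<le> height (weber_modular_polynomial N)"
proof -
  have N0: "N > 0" using N by (auto intro: Nat.gr0I)
  have fin: "finite (conjugates N)" by (rule finite_conjugates[OF N])
  define P where "P = weber_modular_polynomial N"
  define n where "n = card (conjugates N)"
  define D where "D = 24 + 24 * (N * n)"
  define H where "H = Max (\<Union>a\<in>set (coeffs P). norm ` set (coeffs a))"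
  note P = weber_modular_polynomial_conjugates[OF N, folded P_def, folded n_def, folded D_def]
  have P0: "P \<noteq> 0" using P(4) by auto
  have "coeff (coeff P (degree P)) 0 = 1" using P(4) by simp
  hence H1: "H \<ge> 1" using height_ge[OF P0, of "degree P" 0] by (auto simp: H_def)
  have coeff_le: "norm (coeff (coeff P i) j) \<le> H" for i j
    using height_ge[OF P0, of i j] H1 by (auto simp: H_def)
  have "norm (coeff (\<Prod>g\<in>conjugates N. [:- g \<tau>, 1:]) i) \<le> (real D + 1) * H" for i
  proof -
    have "coeff (\<Prod>g\<in>conjugates N. [:- g \<tau>, 1:]) i = poly (coeff P i) (weber_f \<tau>)"
      using P(2)[OF \<tau>(1)] by (simp add: conj_poly_def)
    also have "\<dots> = (\<Sum>j\<le>degree (coeff P i). coeff (coeff P i) j * weber_f \<tau> ^ j)" by (rule poly_altdef)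
    also have "norm \<dots> \<le> (\<Sum>j\<le>degree (coeff P i). H)"
    proof (rule sum_norm_le)
      fix j
      have "norm (coeff (coeff P i) j) * norm (weber_f \<tau>) ^ j \<le> H * 1"
        using coeff_le H1 \<tau>(2) by (intro mult_mono power_le_one) auto
      thus "norm (coeff (coeff P i) j * weber_f \<tau> ^ j) \<le> H" by (simp add: norm_mult norm_power)
    qed
    also have "\<dots> = (real (degree (coeff P i)) + 1) * H" by (simp add: algebra_simps)
    also have "\<dots> \<le> (real D + 1) * H" using P(3)[of i] H1 by (intro mult_right_mono) auto
    finally show ?thesis .
  qed
  from sum_ln_roots_le[OF fin _ this] have
    "(\<Sum>g\<in>conjugates N. ln (max 1 (norm (g \<tau>)))) \<le> ln ((real D + 1) * H) + ln (real n + 1) + real n * ln 2"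
    using H1 by (simp add: n_def)
  also have "ln ((real D + 1) * H) = ln (real D + 1) + ln H" using H1 by (simp add: ln_mult)
  finally have main: "(\<Sum>g\<in>conjugates N. ln (max 1 (norm (g \<tau>)))) \<le> ln (real D + 1) + ln H + ln (real n + 1) + real n * ln 2" .
  have psi_ge: "real N \<le> dedekind_psi N"
  proof -
    have "(\<Prod>p\<in>prime_factors N. 1 + 1 / real p) \<ge> 1" by (intro prod_ge_1) auto
    thus ?thesis using mult_left_mono[of 1 "\<Prod>p\<in>prime_factors N. 1 + 1 / real p" "real N"] by (simp add: dedekind_psi_def)
  qed
  have n_le: "real n \<le> 24 * dedekind_psi N"
  proof -
    have "real (n * totient N) \<le> real (24 * card (prim_rows N))"
      using card_conjugates_le[OF N] unfolding n_def by (rule of_nat_mono)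
    hence "real n * real (totient N) \<le> (24 * dedekind_psi N) * real (totient N)"
      using card_prim_rows[OF N0] by (simp add: mult_ac)
    thus ?thesis using N0 by simp
  qed
  have "ln (real D + 1) \<le> 48 + real N + real n"
  proof -
    define n' where "n' = real n + 1"
    have "real D + 1 \<le> 49 * real N * n'"
    proof -
      have "1 * 1 \<le> real N * n'" using N0 by (intro mult_mono) (auto simp: n'_def)
      moreover have "real D + 1 = 25 + 24 * (real N * real n)" by (simp add: D_def)
      moreover have "real N * real n \<le> real N * n'" by (intro mult_left_mono) (simp_all add: n'_def)
      ultimately show ?thesis by linarith
    qed
    hence "ln (real D + 1) \<le> ln (49 * real N * n')"
      using N0 by (subst ln_le_cancel_iff) (auto simp: n'_def add_pos_nonneg intro!: mult_pos_pos)
    also have "\<dots> = ln 49 + ln (real N) + ln n'" using N0 by (simp add: ln_mult n'_def)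
    also have "\<dots> \<le> (49 - 1) + real N + (n' - 1)"
      using N0 ln_le_minus_one[of "49::real"] ln_le_minus_one[of "real N"] ln_le_minus_one[of n']
      by (simp add: n'_def)
    finally show ?thesis by (simp add: n'_def)
  qed
  moreover have "ln (real n + 1) \<le> real n" using ln_le_minus_one[of "real n + 1"] by simp
  moreover have "real n * ln 2 \<le> real n * 1" using ln_le_minus_one[of "2::real"] by (intro mult_left_mono) auto
  moreover have "1 \<le> dedekind_psi N" using psi_ge N0 by (simp add: order_trans[rotated])
  ultimately have "(\<Sum>g\<in>conjugates N. ln (max 1 (norm (g \<tau>)))) \<le> ln H + 122 * dedekind_psi N"
    using main n_le psi_ge by linarith
  thus ?thesis by (simp add: height_def H_def P_def)
qed

theorem mainTheorem7:
  shows "\<exists>C::real. \<forall>N::nat. N > 0 \<and> coprime N 48 \<longrightarrow>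
    height (weber_modular_polynomial N) > dedekind_psi N / 12 * (ln (real N) - 2 * lambda N + C)"
proof -
  obtain K :: nat where K: "K > 0" "norm (weber_f (1 + \<i> / of_nat K)) \<le> 1"
    by (rule weber_f_small_point)
  obtain C where C: "\<And>N. odd N \<Longrightarrow>
     dedekind_psi N * (1 / 12 * (ln (real N) - 2 * lambda N) - C) \<le> (\<Sum>g\<in>conjugates N. ln (max 1 (norm (g (1 + \<i> / of_nat K)))))"
    by (rule sum_conjugate_values_ge[OF K(1)]) (rule that, assumption)
  show ?thesis
  proof (intro exI[of _ "- 12 * (C + 123)"] allI impI)
    fix N :: nat assume "N > 0 \<and> coprime N 48"
    hence N0: "N > 0" and "coprime N 48" by auto
    hence N: "odd N" by (metis coprime_common_divisor even_numeral odd_one)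
    have Im: "Im (1 + \<i> / of_nat K) > 0" using K(1) by (simp add: Im_divide_of_nat)
    have psi: "dedekind_psi N > 0" unfolding dedekind_psi_def
      using N0 by (intro mult_pos_pos prod_pos) (auto simp: add_pos_nonneg)
    have "dedekind_psi N / 12 * (ln (real N) - 2 * lambda N + - 12 * (C + 123)) =
          dedekind_psi N * (1 / 12 * (ln (real N) - 2 * lambda N) - C) - 122 * dedekind_psi N - dedekind_psi N"
      by (simp add: algebra_simps)
    also have "\<dots> < height (weber_modular_polynomial N)"
      using C[OF N] height_weber_modular_polynomial_ge[OF N Im K(2)] psi by linarith
    finally show "height (weber_modular_polynomial N) > dedekind_psi N / 12 * (ln (real N) - 2 * lambda N + - 12 * (C + 123))" .
  qed
qed

end
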